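(* Let $(\mathcal{A},\varphi)$ be a $W^*$-probability space with faithful normal tracial state $\varphi$. Let $U,V\in\mathcal{A}$ be free with $0\le U<1$ and $V\ge 0$ ($V$ bounded). Let $f,g$ be functions such that $f(U)$ and $g(U)$ are bounded. Let $\omega_1,\omega_2$ be the subordination functions of the pair $(U,V)$, i.e. $$\mathbb{E}_V\,\Psi_{V^{1/2}UV^{1/2}}(z)=\Psi_V(\omega_1(z)),\qquad \mathbb{E}_U\,\Psi_{U^{1/2}VU^{1/2}}(z)=\Psi_U(\omega_2(z)).$$ Then for all $z$ in some neighbourhood of $0$ $$\mathbb{E}_V\left[f(U)\,U^{-1/2}\,\Psi_{U^{1/2}VU^{1/2}}(z)\,U^{-1/2}g(U)\right]=\omega_2(z)\,\eta_U^{f,g}(\omega_2(z))+z\,\eta_U^f(\omega_2(z))\,\eta_U^g(\omega_2(z))\,V\left(1+\Psi_V(\omega_1(z))\right),$$ where $$\eta^{f,g}_U(z)=\sum_{\ell=0}^{\infty}\beta_{\ell+2}(f(U),\underbrace{U,\ldots,U}_{\ell},g(U))\,z^{\ell},\qquad \eta^f_U(z)=\sum_{\ell=0}^{\infty}\beta_{\ell+1}(f(U),\underbrace{U,\ldots,U}_{\ell})\,z^{\ell},$$ and $\eta_U^g$ is defined as $\eta_U^f$ with $g$ in place of $f$.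
   Context: $\mathcal{A}$ is a finite von Neumann algebra with faithful normal tracial state $\varphi$. $0\le U<1$ means that $U$ and $1-U$ are positive and $1-U$ has trivial kernel; $f(U),g(U)$ are defined by functional calculus. $\mathbb{E}_X$ denotes the $\varphi$-preserving conditional expectation onto the von Neumann subalgebra generated by $X$ and $1_{\mathcal{A}}$. Set $\Psi_X(z)=zX(1-zX)^{-1}$. The expression $U^{-1/2}\Psi_{U^{1/2}VU^{1/2}}(z)U^{-1/2}$ is understood, for small $z$, as $\sum_{n\ge1}z^nV(UV)^{n-1}$ (so $U$ need not be invertible). Boolean cumulants $\beta_n:\mathcal{A}^n\to\mathbb{C}$ are defined recursively by $$\varphi(X_1\cdots X_m)=\sum_{\pi\in Int(m)}\ \prod_{B\in\pi}\beta_{|B|}(X_i;\,i\in B),\qquad m\ge1,$$ where $Int(m)$ is the set of interval partitions of $\{1,\dots,m\}$ (partitions all of whose blocks consist of consecutive integers), and the arguments indexed by a block are taken in increasing order of indices. In a neighbourhood of $0$ the subordination functions are analytic and given by $\omega_1(z)=\sum_{k\ge1}\beta_{2k-1}(U,V,U,\ldots,V,U)z^k$ and $\omega_2(z)=\sum_{k\ge1}\beta_{2k-1}(V,U,V,\ldots,U,V)z^k$ (arguments alternating). *)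

theory Defs
  imports "HOL-Analysis.Analysis"
begin

section \<open>Bounded operators on a complex Hilbert space\<close>

class scaleC =
  fixes scaleC :: "complex \<Rightarrow> 'a \<Rightarrow> 'a" (infixr "*\<^sub>C" 75)

(* The inner product is linear in its first argument. The zero space is excluded so that the
   bounded operators form a unital Banach algebra with 0 \<noteq> 1; a von Neumann algebra carrying a
   state acts on a nonzero space anyway. *)
class complex_hilbert = scaleC + real_inner + banach +
  fixes cinner :: "'a \<Rightarrow> 'a \<Rightarrow> complex"
  assumes scaleC_add_right: "c *\<^sub>C (x + y) = c *\<^sub>C x + c *\<^sub>C y"
    and scaleC_add_left: "(c + d) *\<^sub>C x = c *\<^sub>C x + d *\<^sub>C x"
    and scaleC_scaleC: "c *\<^sub>C (d *\<^sub>C x) = (c * d) *\<^sub>C x"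
    and scaleC_of_real: "complex_of_real r *\<^sub>C x = r *\<^sub>R x"
    and cinner_commute: "cinner x y = cnj (cinner y x)"
    and cinner_add_left: "cinner (x + y) z = cinner x z + cinner y z"
    and cinner_scaleC_left: "cinner (c *\<^sub>C x) y = c * cinner x y"
    and Re_cinner: "Re (cinner x y) = inner x y"
    and nontrivial: "\<exists>x::'a. x \<noteq> 0"

lemma cinner_same: "cinner x x = complex_of_real ((norm x)\<^sup>2)"
  for x :: "'a::complex_hilbert"
proof (rule complex_eqI)
  show "Re (cinner x x) = Re (complex_of_real ((norm x)\<^sup>2))"
    by (simp add: Re_cinner dot_square_norm)
  have "Im (cinner x x) = Im (cnj (cinner x x))"
    using cinner_commute[of x x] by simp
  then show "Im (cinner x x) = Im (complex_of_real ((norm x)\<^sup>2))"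
    by simp
qed

lemma norm_scaleC: "norm (c *\<^sub>C x) = cmod c * norm x"
  for x :: "'a::complex_hilbert"
proof -
  have "cinner (c *\<^sub>C x) (c *\<^sub>C x) = c * cnj c * cinner x x"
    by (metis cinner_commute cinner_scaleC_left complex_cnj_mult mult.assoc)
  then have "complex_of_real ((norm (c *\<^sub>C x))\<^sup>2) = complex_of_real ((cmod c * norm x)\<^sup>2)"
    by (simp add: cinner_same power_mult_distrib complex_norm_square[symmetric])
  then have "(norm (c *\<^sub>C x))\<^sup>2 = (cmod c * norm x)\<^sup>2"
    using of_real_eq_iff by blast
  then show ?thesis
    by (simp add: power2_eq_iff_nonneg)
qed

lemma bounded_linear_scaleC: "bounded_linear (\<lambda>x::'a::complex_hilbert. c *\<^sub>C x)"
proof (rule bounded_linear_intro[where K = "cmod c"])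
  fix x y :: 'a and r :: real
  show "c *\<^sub>C (x + y) = c *\<^sub>C x + c *\<^sub>C y" by (rule scaleC_add_right)
  show "c *\<^sub>C (r *\<^sub>R x) = r *\<^sub>R (c *\<^sub>C x)"
    by (simp add: scaleC_of_real[symmetric] scaleC_scaleC mult.commute)
  show "norm (c *\<^sub>C x) \<le> norm x * cmod c"
    by (simp add: norm_scaleC mult.commute)
qed

typedef (overloaded) 'h bop =
  "{T :: 'h::complex_hilbert \<Rightarrow>\<^sub>L 'h. \<forall>c x. blinfun_apply T (c *\<^sub>C x) = c *\<^sub>C blinfun_apply T x}"
  morphisms blinfun_of_bop Bop
proof -
  have "c *\<^sub>C (0::'h) = 0" for c
    using scaleC_add_right[of c "0::'h" 0] by simp
  then show ?thesis
    by (intro exI[of _ 0]) simp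
qed

setup_lifting type_definition_bop

lift_definition bop_apply :: "'h::complex_hilbert bop \<Rightarrow> 'h \<Rightarrow> 'h" is blinfun_apply .

lemma bop_eqI: "(\<And>x. bop_apply S x = bop_apply T x) \<Longrightarrow> S = T"
  by transfer (rule blinfun_eqI)

instantiation bop :: (complex_hilbert) scaleC
begin
lift_definition scaleC_bop :: "complex \<Rightarrow> 'a bop \<Rightarrow> 'a bop"
  is "\<lambda>c T. Blinfun (\<lambda>x. c *\<^sub>C x) o\<^sub>L T"
  by (simp add: bounded_linear_Blinfun_apply[OF bounded_linear_scaleC] scaleC_scaleC mult.commute)
instance ..
end

instantiation bop :: (complex_hilbert) real_normed_algebra_1
begin

lift_definition zero_bop :: "'a bop" is 0
  by (simp add: linear_0 bounded_linear.linear[OF bounded_linear_scaleC])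
lift_definition one_bop :: "'a bop" is id_blinfun by simp
lift_definition plus_bop :: "'a bop \<Rightarrow> 'a bop \<Rightarrow> 'a bop" is "(+)"
  by (simp add: blinfun.add_left scaleC_add_right)
lift_definition uminus_bop :: "'a bop \<Rightarrow> 'a bop" is uminus
  by (simp add: blinfun.minus_left linear_neg bounded_linear.linear[OF bounded_linear_scaleC])
lift_definition minus_bop :: "'a bop \<Rightarrow> 'a bop \<Rightarrow> 'a bop" is "(-)"
  by (simp add: blinfun.diff_left linear_diff bounded_linear.linear[OF bounded_linear_scaleC])
lift_definition scaleR_bop :: "real \<Rightarrow> 'a bop \<Rightarrow> 'a bop" is scaleR
  by (simp add: blinfun.scaleR_left linear_cmul bounded_linear.linear[OF bounded_linear_scaleC])
lift_definition times_bop :: "'a bop \<Rightarrow> 'a bop \<Rightarrow> 'a bop" is "(o\<^sub>L)" by simp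
lift_definition norm_bop :: "'a bop \<Rightarrow> real" is norm .

definition dist_bop :: "'a bop \<Rightarrow> 'a bop \<Rightarrow> real" where "dist_bop S T = norm (S - T)"
definition sgn_bop :: "'a bop \<Rightarrow> 'a bop" where "sgn_bop T = scaleR (inverse (norm T)) T"
definition uniformity_bop :: "('a bop \<times> 'a bop) filter" where
  "uniformity_bop = (INF e\<in>{0<..}. principal {(S, T). dist S T < e})"
definition open_bop :: "'a bop set \<Rightarrow> bool" where
  "open_bop S = (\<forall>x\<in>S. \<forall>\<^sub>F (x', y) in uniformity. x' = x \<longrightarrow> y \<in> S)"

instance
proof
  fix a b c :: "'a bop" and r s :: real
  show "dist a b = norm (a - b)" by (rule dist_bop_def)
  show "sgn a = inverse (norm a) *\<^sub>R a" by (rule sgn_bop_def)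
  show "uniformity = (INF e\<in>{0<..}. principal {(x, y::'a bop). dist x y < e})"
    by (rule uniformity_bop_def)
  show "open S = (\<forall>x\<in>S. \<forall>\<^sub>F (x', y) in uniformity. x' = x \<longrightarrow> y \<in> S)" for S :: "'a bop set"
    by (rule open_bop_def)
  show "a + b + c = a + (b + c)" by transfer simp
  show "a + b = b + a" by transfer simp
  show "0 + a = a" by transfer simp
  show "- a + a = 0" by transfer simp
  show "a - b = a + - b" by transfer simp
  show "r *\<^sub>R (a + b) = r *\<^sub>R a + r *\<^sub>R b" by transfer (rule scaleR_add_right)
  show "(r + s) *\<^sub>R a = r *\<^sub>R a + s *\<^sub>R a" by transfer (rule scaleR_add_left)
  show "r *\<^sub>R s *\<^sub>R a = (r * s) *\<^sub>R a" by transfer simp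
  show "1 *\<^sub>R a = a" by transfer simp
  show "a * b * c = a * (b * c)" by transfer (rule blinfun_eqI, simp)
  show "(a + b) * c = a * c + b * c"
    by transfer (rule blinfun_eqI, simp add: blinfun.add_left blinfun.add_right blinfun.scaleR_left blinfun.scaleR_right)
  show "a * (b + c) = a * b + a * c"
    by transfer (rule blinfun_eqI, simp add: blinfun.add_left blinfun.add_right blinfun.scaleR_left blinfun.scaleR_right)
  show "r *\<^sub>R a * b = r *\<^sub>R (a * b)"
    by transfer (rule blinfun_eqI, simp add: blinfun.add_left blinfun.add_right blinfun.scaleR_left blinfun.scaleR_right)
  show "a * r *\<^sub>R b = r *\<^sub>R (a * b)"
    by transfer (rule blinfun_eqI, simp add: blinfun.add_left blinfun.add_right blinfun.scaleR_left blinfun.scaleR_right)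
  show "1 * a = a" by transfer (rule blinfun_eqI, simp)
  show "a * 1 = a" by transfer (rule blinfun_eqI, simp)
  obtain x :: 'a where x: "x \<noteq> 0" using nontrivial by blast
  show "(0::'a bop) \<noteq> 1"
    by transfer (metis x blinfun_apply_id_blinfun zero_blinfun.rep_eq)
  show "(norm a = 0) = (a = 0)" by transfer simp
  show "norm (a + b) \<le> norm a + norm b" by transfer (rule norm_triangle_ineq)
  show "norm (r *\<^sub>R a) = \<bar>r\<bar> * norm a" by transfer simp
  show "norm (a * b) \<le> norm a * norm b" by transfer (rule norm_blinfun_compose)
  show "norm (1::'a bop) = 1"
  proof transfer
    show "norm (id_blinfun :: 'a \<Rightarrow>\<^sub>L 'a) = 1"
    proof (rule antisym)
      show "norm (id_blinfun :: 'a \<Rightarrow>\<^sub>L 'a) \<le> 1" by (rule norm_blinfun_bound) auto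
      show "1 \<le> norm (id_blinfun :: 'a \<Rightarrow>\<^sub>L 'a)"
        using norm_blinfun[of "id_blinfun :: 'a \<Rightarrow>\<^sub>L 'a" x] x by simp
    qed
  qed
qed

end

instance bop :: (complex_hilbert) banach
proof
  fix X :: "nat \<Rightarrow> 'a bop" assume "Cauchy X"
  have dist_eq: "dist S T = dist (blinfun_of_bop S) (blinfun_of_bop T)" for S T :: "'a bop"
    unfolding dist_norm by transfer simp
  have "Cauchy (\<lambda>n. blinfun_of_bop (X n))"
    using \<open>Cauchy X\<close> unfolding Cauchy_def dist_eq .
  then obtain L where L: "(\<lambda>n. blinfun_of_bop (X n)) \<longlonglongrightarrow> L"
    using Cauchy_convergent convergent_def by blast
  have lim: "(\<lambda>n. blinfun_apply (blinfun_of_bop (X n)) x) \<longlonglongrightarrow> blinfun_apply L x" for x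
    by (intro tendsto_intros L)
  have "blinfun_apply L (c *\<^sub>C x) = c *\<^sub>C blinfun_apply L x" for c x
  proof (rule LIMSEQ_unique[OF lim])
    show "(\<lambda>n. blinfun_apply (blinfun_of_bop (X n)) (c *\<^sub>C x)) \<longlonglongrightarrow> c *\<^sub>C blinfun_apply L x"
      using bounded_linear.tendsto[OF bounded_linear_scaleC[of c] lim[of x]]
      by (simp add: blinfun_of_bop[simplified])
  qed
  then have "blinfun_of_bop (Bop L) = L"
    by (simp add: Bop_inverse)
  then have "X \<longlonglongrightarrow> Bop L"
    using L by (simp add: tendsto_iff dist_eq)
  then show "convergent X"
    by (auto simp: convergent_def)
qed

lemma bop_apply_simps [simp]:
  "bop_apply 0 x = 0" "bop_apply 1 x = x"
  "bop_apply (S + T) x = bop_apply S x + bop_apply T x"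
  "bop_apply (S - T) x = bop_apply S x - bop_apply T x"
  "bop_apply (- S) x = - bop_apply S x"
  "bop_apply (S * T) x = bop_apply S (bop_apply T x)"
  "bop_apply (r *\<^sub>R S) x = r *\<^sub>R bop_apply S x"
  "bop_apply (c *\<^sub>C S) x = c *\<^sub>C bop_apply S x"
  "bop_apply S (x + y) = bop_apply S x + bop_apply S y"
  "bop_apply S (c *\<^sub>C x) = c *\<^sub>C bop_apply S x"
  by (transfer; simp add: blinfun.add_left blinfun.diff_left blinfun.minus_left
      blinfun.scaleR_left blinfun.add_right
      bounded_linear_Blinfun_apply[OF bounded_linear_scaleC])+

definition adj :: "'h::complex_hilbert bop \<Rightarrow> 'h bop" where
  "adj T = (THE S. \<forall>x y. cinner (bop_apply T x) y = cinner x (bop_apply S y))"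

(* On a complex Hilbert space this forces T to be self-adjoint. *)
definition positive_op :: "'h::complex_hilbert bop \<Rightarrow> bool" where
  "positive_op T \<longleftrightarrow> (\<forall>x. cinner (bop_apply T x) x \<in> \<real>\<^sub>\<ge>\<^sub>0)"

definition op_sqrt :: "'h::complex_hilbert bop \<Rightarrow> 'h bop" where
  "op_sqrt T = (THE S. positive_op S \<and> S * S = T)"

definition op_inverse :: "'h::complex_hilbert bop \<Rightarrow> 'h bop" where
  "op_inverse T = (THE S. S * T = 1 \<and> T * S = 1)"

section \<open>Borel functional calculus\<close>

definition projection_valued_measure :: "(real set \<Rightarrow> 'h::complex_hilbert bop) \<Rightarrow> bool" where
  "projection_valued_measure E \<longleftrightarrow>
     (\<forall>B\<in>sets borel. adj (E B) = E B \<and> E B * E B = E B) \<and>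
     E UNIV = 1 \<and>
     (\<forall>A x. range A \<subseteq> sets borel \<longrightarrow> disjoint_family A \<longrightarrow>
        (\<lambda>n::nat. bop_apply (E (A n)) x) sums bop_apply (E (\<Union>n. A n)) x)"

definition pvm_measure :: "(real set \<Rightarrow> 'h::complex_hilbert bop) \<Rightarrow> 'h \<Rightarrow> real measure" where
  "pvm_measure E x = measure_of UNIV (sets borel) (\<lambda>B. ennreal (Re (cinner (bop_apply (E B) x) x)))"

(* T is the bounded operator \<integral> f dE; the second conjunct says that f is E-essentially
   bounded, i.e. that \<integral> f dE is bounded. *)
definition has_pvm_integral ::
    "(real set \<Rightarrow> 'h::complex_hilbert bop) \<Rightarrow> (real \<Rightarrow> complex) \<Rightarrow> 'h bop \<Rightarrow> bool" where
  "has_pvm_integral E f T \<longleftrightarrow>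
     f \<in> borel_measurable borel \<and>
     (\<exists>C. E {t. C < cmod (f t)} = 0) \<and>
     (\<forall>x. cinner (bop_apply T x) x = (\<integral>t. f t \<partial>pvm_measure E x))"

(* f(X) = T for self-adjoint X: E is the spectral measure of X. *)
definition has_fun_calc :: "'h::complex_hilbert bop \<Rightarrow> (real \<Rightarrow> complex) \<Rightarrow> 'h bop \<Rightarrow> bool" where
  "has_fun_calc X f T \<longleftrightarrow>
     (\<exists>E. projection_valued_measure E \<and> has_pvm_integral E complex_of_real X \<and> has_pvm_integral E f T)"

definition fun_calc_bounded :: "'h::complex_hilbert bop \<Rightarrow> (real \<Rightarrow> complex) \<Rightarrow> bool" where
  "fun_calc_bounded X f \<longleftrightarrow> (\<exists>T. has_fun_calc X f T)"

definition fun_calc :: "'h::complex_hilbert bop \<Rightarrow> (real \<Rightarrow> complex) \<Rightarrow> 'h bop" where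
  "fun_calc X f = (THE T. has_fun_calc X f T)"

section \<open>Von Neumann algebras and \<open>W\<^sup>*\<close>-probability spaces\<close>

definition commutant :: "'h::complex_hilbert bop set \<Rightarrow> 'h bop set" where
  "commutant S = {T. \<forall>A\<in>S. T * A = A * T}"

definition von_neumann_algebra :: "'h::complex_hilbert bop set \<Rightarrow> bool" where
  "von_neumann_algebra M \<longleftrightarrow> (\<forall>T\<in>M. adj T \<in> M) \<and> commutant (commutant M) = M"

definition finite_von_neumann_algebra :: "'h::complex_hilbert bop set \<Rightarrow> bool" where
  "finite_von_neumann_algebra M \<longleftrightarrow>
     von_neumann_algebra M \<and> (\<forall>W\<in>M. adj W * W = 1 \<longrightarrow> W * adj W = 1)"

(* Every von Neumann algebra in the sense above contains 1. *)
definition vn_generated :: "'h::complex_hilbert bop \<Rightarrow> 'h bop set" where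
  "vn_generated X = \<Inter>{N. von_neumann_algebra N \<and> X \<in> N}"

(* The weakest topology making T \<mapsto> \<Sum>k. \<langle>T \<xi>_k, \<zeta>_k\<rangle> continuous for all square-summable
   sequences \<xi>, \<zeta>. *)
definition ultraweak_topology :: "'h::complex_hilbert bop topology" where
  "ultraweak_topology = topology_generated_by
     {{T. (\<Sum>k. cinner (bop_apply T (\<xi> k)) (\<zeta> k)) \<in> S} | \<xi> \<zeta> S.
        summable (\<lambda>k::nat. (norm (\<xi> k))\<^sup>2) \<and> summable (\<lambda>k. (norm (\<zeta> k))\<^sup>2) \<and> open S}"

definition normal_on :: "'h::complex_hilbert bop set \<Rightarrow> ('h bop \<Rightarrow> complex) \<Rightarrow> bool" where
  "normal_on M \<phi> \<longleftrightarrow> continuous_map (subtopology ultraweak_topology M) euclidean \<phi>"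

definition state_on :: "'h::complex_hilbert bop set \<Rightarrow> ('h bop \<Rightarrow> complex) \<Rightarrow> bool" where
  "state_on M \<phi> \<longleftrightarrow>
     (\<forall>a\<in>M. \<forall>b\<in>M. \<phi> (a + b) = \<phi> a + \<phi> b) \<and>
     (\<forall>c. \<forall>a\<in>M. \<phi> (c *\<^sub>C a) = c * \<phi> a) \<and>
     (\<forall>a\<in>M. \<phi> (adj a * a) \<in> \<real>\<^sub>\<ge>\<^sub>0) \<and> \<phi> 1 = 1"

definition wstar_probability_space ::
    "'h::complex_hilbert bop set \<Rightarrow> ('h bop \<Rightarrow> complex) \<Rightarrow> bool" where
  "wstar_probability_space M \<phi> \<longleftrightarrow>
     finite_von_neumann_algebra M \<and> state_on M \<phi> \<and> normal_on M \<phi> \<and>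
     (\<forall>a\<in>M. \<phi> (adj a * a) = 0 \<longrightarrow> a = 0) \<and>
     (\<forall>a\<in>M. \<forall>b\<in>M. \<phi> (a * b) = \<phi> (b * a))"

definition conditional_expectation ::
    "'h::complex_hilbert bop set \<Rightarrow> ('h bop \<Rightarrow> complex) \<Rightarrow> 'h bop set \<Rightarrow> ('h bop \<Rightarrow> 'h bop) \<Rightarrow> bool" where
  "conditional_expectation M \<phi> N E \<longleftrightarrow>
     (\<forall>a\<in>M. E a \<in> N) \<and> (\<forall>b\<in>N. E b = b) \<and>
     (\<forall>a\<in>M. \<forall>b\<in>M. E (a + b) = E a + E b) \<and> (\<forall>c. \<forall>a\<in>M. E (c *\<^sub>C a) = c *\<^sub>C E a) \<and>
     (\<forall>a\<in>M. positive_op a \<longrightarrow> positive_op (E a)) \<and>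
     (\<forall>a\<in>M. \<forall>b\<in>N. \<forall>c\<in>N. E (b * a * c) = b * E a * c) \<and>
     (\<forall>a\<in>M. \<phi> (E a) = \<phi> a)"

section \<open>Freeness and Boolean cumulants\<close>

definition free_subalgebras ::
    "('h::complex_hilbert bop \<Rightarrow> complex) \<Rightarrow> ('i \<Rightarrow> 'h bop set) \<Rightarrow> bool" where
  "free_subalgebras \<phi> A \<longleftrightarrow>
     (\<forall>xs. xs \<noteq> [] \<longrightarrow> distinct_adj (map fst xs) \<longrightarrow>
        (\<forall>(i, a)\<in>set xs. a \<in> A i \<and> \<phi> a = 0) \<longrightarrow> \<phi> (prod_list (map snd xs)) = 0)"

definition unital_algebra_generated :: "'h::complex_hilbert bop \<Rightarrow> 'h bop set" where
  "unital_algebra_generated X = {\<Sum>k\<le>n. c k *\<^sub>C X ^ k | (c :: nat \<Rightarrow> complex) n. True}"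

definition free_elements ::
    "('h::complex_hilbert bop \<Rightarrow> complex) \<Rightarrow> 'h bop \<Rightarrow> 'h bop \<Rightarrow> bool" where
  "free_elements \<phi> X Y \<longleftrightarrow>
     free_subalgebras \<phi> (\<lambda>i::bool. unital_algebra_generated (if i then X else Y))"

(* Positions are counted from 0, so the ground set is {0, ..., m - 1}. *)
definition interval_partitions :: "nat \<Rightarrow> nat set set set" where
  "interval_partitions m = {\<pi>. partition_on {..<m} \<pi> \<and> (\<forall>B\<in>\<pi>. \<exists>a b. B = {a..<b})}"

lemma nths_length_less:
  assumes \<pi>: "\<pi> \<in> interval_partitions (length xs) - {{{..<length xs}}}" and B: "B \<in> \<pi>"
  shows "length (nths xs B) < length xs"
proof -
  have P: "partition_on {..<length xs} \<pi>" and ne: "\<pi> \<noteq> {{..<length xs}}"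
    using \<pi> by (auto simp: interval_partitions_def)
  have sub: "B \<subseteq> {..<length xs}"
    using partition_onD1[OF P] B by blast
  have "B \<noteq> {..<length xs}"
  proof
    assume eq: "B = {..<length xs}"
    have "C = B" if "C \<in> \<pi>" for C
    proof (rule ccontr)
      assume "C \<noteq> B"
      then have "C \<inter> B = {}"
        using partition_onD2[OF P] that B by (auto simp: disjoint_def)
      moreover have "C \<subseteq> B" "C \<noteq> {}"
        using partition_onD1[OF P] partition_onD3[OF P] that eq by auto
      ultimately show False by blast
    qed
    then have "\<pi> = {B}" using B by blast
    then show False using ne eq by simp
  qed
  then have "B \<subset> {..<length xs}" using sub by blast
  then have "card B < length xs"
    by (metis card_lessThan finite_lessThan psubset_card_mono)
  moreover have "{i. i < length xs \<and> i \<in> B} = B" using sub by auto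
  ultimately show ?thesis by (simp add: length_nths)
qed

(* The moment-cumulant relation solved for the term of the one-block partition. *)
function boolean_cumulant ::
    "('h::complex_hilbert bop \<Rightarrow> complex) \<Rightarrow> 'h bop list \<Rightarrow> complex" where
  "boolean_cumulant \<phi> xs = \<phi> (prod_list xs) -
     (\<Sum>\<pi>\<in>interval_partitions (length xs) - {{{..<length xs}}}.
        \<Prod>B\<in>\<pi>. boolean_cumulant \<phi> (nths xs B))"
  by auto
termination
  by (relation "Wellfounded.measure (\<lambda>(\<phi>, xs). length xs)") (use nths_length_less in auto)

declare boolean_cumulant.simps [simp del]

lemma finite_interval_partitions: "finite (interval_partitions m)"
proof (rule finite_subset)
  show "interval_partitions m \<subseteq> Pow (Pow {..<m})"
    by (auto simp: interval_partitions_def partition_on_def)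
qed simp

theorem moment_boolean_cumulant:
  assumes "xs \<noteq> []"
  shows "\<phi> (prod_list xs) =
    (\<Sum>\<pi>\<in>interval_partitions (length xs). \<Prod>B\<in>\<pi>. boolean_cumulant \<phi> (nths xs B))"
proof -
  let ?I = "interval_partitions (length xs)" and ?w = "{{..<length xs}}"
  have "partition_on {..<length xs} ?w"
    using assms by (auto simp: partition_on_def disjoint_def)
  moreover have "{..<length xs} = {0..<length xs}" by auto
  ultimately have w: "?w \<in> ?I"
    unfolding interval_partitions_def by blast
  have "(\<Sum>\<pi>\<in>?I. \<Prod>B\<in>\<pi>. boolean_cumulant \<phi> (nths xs B)) =
    boolean_cumulant \<phi> (nths xs {..<length xs}) +
    (\<Sum>\<pi>\<in>?I - {?w}. \<Prod>B\<in>\<pi>. boolean_cumulant \<phi> (nths xs B))"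
    by (simp add: sum.remove[OF finite_interval_partitions w])
  moreover have "nths xs {..<length xs} = xs"
    by (rule nths_all) simp
  ultimately show ?thesis
    using boolean_cumulant.simps[of \<phi> xs] by simp
qed

definition eta1 ::
    "('h::complex_hilbert bop \<Rightarrow> complex) \<Rightarrow> 'h bop \<Rightarrow> 'h bop \<Rightarrow> complex \<Rightarrow> complex" where
  "eta1 \<phi> X F z = (\<Sum>l. boolean_cumulant \<phi> (F # replicate l X) * z ^ l)"

definition eta2 ::
    "('h::complex_hilbert bop \<Rightarrow> complex) \<Rightarrow> 'h bop \<Rightarrow> 'h bop \<Rightarrow> 'h bop \<Rightarrow> complex \<Rightarrow> complex" where
  "eta2 \<phi> X F G z = (\<Sum>l. boolean_cumulant \<phi> (F # replicate l X @ [G]) * z ^ l)"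

section \<open>Subordination functions\<close>

definition Psi :: "'h::complex_hilbert bop \<Rightarrow> complex \<Rightarrow> 'h bop" where
  "Psi X z = (z *\<^sub>C X) * op_inverse (1 - z *\<^sub>C X)"

(* U\<^sup>-\<^sup>1\<^sup>/\<^sup>2 \<Psi>(z) U\<^sup>-\<^sup>1\<^sup>/\<^sup>2 with \<Psi> taken at U\<^sup>1\<^sup>/\<^sup>2 V U\<^sup>1\<^sup>/\<^sup>2, read as a norm-convergent power series
   because U need not be invertible. *)
definition Psi_reduced :: "'h::complex_hilbert bop \<Rightarrow> 'h bop \<Rightarrow> complex \<Rightarrow> 'h bop" where
  "Psi_reduced U V z = (\<Sum>n. z ^ Suc n *\<^sub>C (V * (U * V) ^ n))"

(* The alternating list X, Y, X, ..., Y, X of length 2k + 1. *)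
definition alternating :: "'a \<Rightarrow> 'a \<Rightarrow> nat \<Rightarrow> 'a list" where
  "alternating X Y k = X # concat (replicate k [Y, X])"

(* \<omega>1 and \<omega>2 are the subordination functions of (U, V) near 0; EU and EV are the conditional
   expectations onto the von Neumann algebras generated by U and by V. In the degenerate cases
   U = 0 or V = 0 the functional equations do not determine both functions, the series do. *)
definition subordination_functions ::
    "('h::complex_hilbert bop \<Rightarrow> complex) \<Rightarrow> ('h bop \<Rightarrow> 'h bop) \<Rightarrow> ('h bop \<Rightarrow> 'h bop) \<Rightarrow>
     'h bop \<Rightarrow> 'h bop \<Rightarrow> (complex \<Rightarrow> complex) \<Rightarrow> (complex \<Rightarrow> complex) \<Rightarrow> bool" where
  "subordination_functions \<phi> EU EV U V \<omega>1 \<omega>2 \<longleftrightarrow>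
     (\<forall>\<^sub>F z in nhds 0. EV (Psi (op_sqrt V * U * op_sqrt V) z) = Psi V (\<omega>1 z)) \<and>
     (\<forall>\<^sub>F z in nhds 0. EU (Psi (op_sqrt U * V * op_sqrt U) z) = Psi U (\<omega>2 z)) \<and>
     (\<forall>\<^sub>F z in nhds 0.
        (\<lambda>k. boolean_cumulant \<phi> (alternating U V k) * z ^ Suc k) sums \<omega>1 z) \<and>
     (\<forall>\<^sub>F z in nhds 0.
        (\<lambda>k. boolean_cumulant \<phi> (alternating V U k) * z ^ Suc k) sums \<omega>2 z)"

end

theory Submission
  imports Defs
begin

text \<open>Put \<open>D a = a - \<phi> a\<close>. The Boolean cumulant of \<open>x\<^sub>1, \<dots>, x\<^sub>n\<close> is \<open>\<phi> (x\<^sub>1 D (x\<^sub>2 D (\<dots> D x\<^sub>n)))\<close>,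
  so every generating series of the statement is \<open>\<phi> (x y)\<close> for the solution \<open>y\<close> of a linear fixed-point
  equation and is a rational expression in moments of resolvents.

  Let \<open>R\<^sub>1 = (1 - w\<^sub>2 U)\<^sup>-\<^sup>1\<close> and \<open>R\<^sub>2 = (1 - w\<^sub>1 V)\<^sup>-\<^sup>1\<close>, where, for small \<open>z\<close>, Brouwer's theorem gives
  \<open>w\<^sub>1 = z \<alpha> \<phi> (U R\<^sub>1)\<close>, \<open>w\<^sub>2 = z \<alpha> \<phi> (V R\<^sub>2)\<close> with \<open>\<alpha> = 1 / \<phi> R\<^sub>1 = 1 / \<phi> R\<^sub>2\<close>. With the centred elements
  \<open>a = D (U R\<^sub>1)\<close> and \<open>b = D (V R\<^sub>2)\<close> one has \<open>\<alpha> R\<^sub>1 (1 - z U V) R\<^sub>2 = 1 - z \<alpha>\<^sup>2 a b\<close>, hence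
  \<open>(1 - z U V)\<^sup>-\<^sup>1 = \<alpha> R\<^sub>2 (\<Sum>n. (z \<alpha>\<^sup>2 a b)\<^sup>n) R\<^sub>1\<close>, and by freeness only finitely many terms contribute to
  the moments that are needed. This identifies \<open>w\<^sub>1, w\<^sub>2\<close> with the given power series and yields the formula
  after pairing with powers of \<open>V\<close>, on which an element of the von Neumann algebra of \<open>V\<close> is
  determined because \<open>\<phi>\<close> is normal and faithful.\<close>

section \<open>Hilbert-space groundwork\<close>

section \<open>The algebra of bounded operators\<close>

text \<open>The obstacle is the gap between the hypothesis of freeness and its use. It is assumed
  for polynomials in \<open>U\<close> and \<open>V\<close>, but it is applied to
  \<open>fun_calc U f\<close>, to resolvents and to elements of the von Neumann algebra of
  \<open>V\<close>. Approximating all letters of a word at once would call for norm-bounded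
  approximants, as in Kaplansky's density theorem. Instead the letters are exchanged one at a time:
  the trace collects the rest of the word into one right factor \<open>c\<close>, and a linear
  condition tested against all \<open>c\<close>, membership in \<open>bipolar X\<close>, suffices.
  The double commutant of \<open>X\<close> satisfies it because normality bounds \<phi> by a single
  vector of H (x) l^2, and \<open>c\<close> can be absorbed into that vector. Since
  \<open>fun_calc\<close> is given through some spectral measure, that measure must first be
  recovered from the operator; growth rates of powers do this. Any fixed point \<open>w1\<close> in
  the disc will do: at fixed \<open>z\<close> the given series are summed in terms of moments of (1
  - z U V)^-1, and the factorization evaluates the same moments in terms of \<open>w1\<close> and
  \<open>w2\<close>.\<close>

lemma scaleC_bop [simp]:
  fixes S T :: "'h::complex_hilbert bop"
  shows "c *\<^sub>C (S + T) = c *\<^sub>C S + c *\<^sub>C T" "(c + d) *\<^sub>C S = c *\<^sub>C S + d *\<^sub>C S"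
    "c *\<^sub>C d *\<^sub>C S = (c * d) *\<^sub>C S" "1 *\<^sub>C S = S" "0 *\<^sub>C S = 0"
    "c *\<^sub>C S * T = c *\<^sub>C (S * T)" "S * c *\<^sub>C T = c *\<^sub>C (S * T)" "c *\<^sub>C (0::'h bop) = 0"
proof -
  have "1 *\<^sub>C x = x" "0 *\<^sub>C x = 0" "c *\<^sub>C (0::'h) = 0" for x :: 'h
    using scaleC_of_real[of 1 x] scaleC_of_real[of 0 x] scaleC_scaleC[of c 0 x]
    by (auto simp: scaleC_of_real[of 0, simplified])
  then show "c *\<^sub>C (S + T) = c *\<^sub>C S + c *\<^sub>C T" "(c + d) *\<^sub>C S = c *\<^sub>C S + d *\<^sub>C S"
    "c *\<^sub>C d *\<^sub>C S = (c * d) *\<^sub>C S" "1 *\<^sub>C S = S" "0 *\<^sub>C S = 0"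
    "c *\<^sub>C S * T = c *\<^sub>C (S * T)" "S * c *\<^sub>C T = c *\<^sub>C (S * T)" "c *\<^sub>C (0::'h bop) = 0"
    by (auto intro!: bop_eqI simp: scaleC_add_right scaleC_add_left scaleC_scaleC)
qed

lemma scaleC_hilbert [simp]:
  fixes x :: "'h::complex_hilbert"
  shows "1 *\<^sub>C x = x" "0 *\<^sub>C x = 0" "c *\<^sub>C (0::'h) = 0" "(-1) *\<^sub>C x = - x"
    "c *\<^sub>C (- x) = - (c *\<^sub>C x)" "(- c) *\<^sub>C x = - (c *\<^sub>C x)"
    "c *\<^sub>C (x - y) = c *\<^sub>C x - c *\<^sub>C y" "(c - d) *\<^sub>C x = c *\<^sub>C x - d *\<^sub>C x"
proof -
  show 1: "1 *\<^sub>C x = x" "0 *\<^sub>C x = 0"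
    using scaleC_of_real[of 1 x] scaleC_of_real[of 0 x] by auto
  show 0: "c *\<^sub>C (0::'h) = 0"
    using scaleC_add_right[of c "0::'h" 0] by simp
  show n: "c *\<^sub>C (- x) = - (c *\<^sub>C x)" for x :: 'h and c
    using scaleC_add_right[of c x "- x"] scaleC_add_right[of c "0::'h" 0] by (simp add: eq_neg_iff_add_eq_0 add.commute)
  show n': "(- c) *\<^sub>C x = - (c *\<^sub>C x)" for c and x :: 'h
    using scaleC_add_left[of c "- c" x] 1(2) scaleC_of_real[of 0 x] by (simp add: eq_neg_iff_add_eq_0 add.commute)
  show "(-1) *\<^sub>C x = - x" using n'[of 1 x] 1 by simp
  show "c *\<^sub>C (x - y) = c *\<^sub>C x - c *\<^sub>C y"
    using scaleC_add_right[of c x "- y"] by (simp add: n)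
  show "(c - d) *\<^sub>C x = c *\<^sub>C x - d *\<^sub>C x"
    using scaleC_add_left[of c "- d" x] by (simp add: n')
qed

lemma scaleC_bop_diff [simp]:
  fixes S T :: "'h::complex_hilbert bop"
  shows "c *\<^sub>C (S - T) = c *\<^sub>C S - c *\<^sub>C T" "(c - d) *\<^sub>C S = c *\<^sub>C S - d *\<^sub>C S"
    "c *\<^sub>C (- S) = - (c *\<^sub>C S)" "(- c) *\<^sub>C S = - (c *\<^sub>C S)"
  by (auto intro!: bop_eqI)

lemma bop_apply_bounded: "norm (bop_apply T x) \<le> norm T * norm x"
  by transfer (rule norm_blinfun)

lemma bounded_linear_bop_apply: "bounded_linear (bop_apply T)"
  by transfer (rule blinfun.bounded_linear_right)

lemma norm_bop_bound:
  assumes "\<And>x. norm (bop_apply T x) \<le> b * norm x" "0 \<le> b"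
  shows "norm T \<le> b"
  using assms by transfer (rule norm_blinfun_bound)

lemma norm_scaleC_bop: "norm (c *\<^sub>C T) = cmod c * norm T" for T :: "'h::complex_hilbert bop"
proof -
  have *: "norm (c *\<^sub>C T) \<le> cmod c * norm T" for c and T :: "'h bop"
    by (rule norm_bop_bound)
      (simp_all add: norm_scaleC mult.assoc mult_left_mono bop_apply_bounded)
  show ?thesis
  proof (cases "c = 0")
    case False
    have "norm T = norm (inverse c *\<^sub>C c *\<^sub>C T)" using False by simp
    also have "\<dots> \<le> inverse (cmod c) * norm (c *\<^sub>C T)"
      using *[of "inverse c" "c *\<^sub>C T"] by (simp add: norm_inverse)
    finally have "cmod c * norm T \<le> norm (c *\<^sub>C T)"
      using False by (simp add: field_simps)
    then show ?thesis using *[of c T] by simp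
  qed simp
qed

lemma scaleC_bop_of_real: "complex_of_real r *\<^sub>C T = r *\<^sub>R T" for T :: "'h::complex_hilbert bop"
  by (rule bop_eqI) (simp add: scaleC_of_real)

lemma bounded_linear_scaleC_bop: "bounded_linear (\<lambda>T::'h::complex_hilbert bop. c *\<^sub>C T)"
  by (rule bounded_linear_intro[where K = "cmod c"])
    (simp_all add: norm_scaleC_bop mult.commute scaleC_bop_of_real[symmetric])

lemma scaleC_bop_power: "(c *\<^sub>C T) ^ n = c ^ n *\<^sub>C T ^ n" for T :: "'h::complex_hilbert bop"
  by (induction n) (simp_all add: mult.commute)

text \<open>Serves the operators that are known only by their values on vectors: adjoints, and the
  matrix entries of a projection on \<open>ell2\<close>.\<close>

lemma bop_exists:
  fixes F :: "'h::complex_hilbert \<Rightarrow> 'h"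
  assumes add: "\<And>x y. F (x + y) = F x + F y" and scale: "\<And>c x. F (c *\<^sub>C x) = c *\<^sub>C F x"
    and bound: "\<And>x. norm (F x) \<le> b * norm x"
  shows "\<exists>T. \<forall>x. bop_apply T x = F x"
proof -
  have "bounded_linear F"
    by (rule bounded_linear_intro[where K = b])
      (use add scale bound in \<open>auto simp: scaleC_of_real[symmetric] mult.commute\<close>)
  then have "bop_apply (Bop (Blinfun F)) x = F x" for x
    using scale by (simp add: bop_apply.rep_eq Bop_inverse bounded_linear_Blinfun_apply)
  then show ?thesis by blast
qed

lemma cinner_simps [simp]:
  fixes x y z :: "'h::complex_hilbert"
  shows "cinner (x + y) z = cinner x z + cinner y z" "cinner x (y + z) = cinner x y + cinner x z"
    "cinner (c *\<^sub>C x) y = c * cinner x y" "cinner x (c *\<^sub>C y) = cnj c * cinner x y"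
    "cinner (- x) y = - cinner x y" "cinner x (- y) = - cinner x y"
    "cinner (x - y) z = cinner x z - cinner y z" "cinner x (y - z) = cinner x y - cinner x z"
    "cinner 0 y = 0" "cinner x 0 = 0"
proof -
  show a: "cinner (x + y) z = cinner x z + cinner y z" for x y z :: 'h by (rule cinner_add_left)
  show b: "cinner x (y + z) = cinner x y + cinner x z" for x y z :: 'h
    by (metis a cinner_commute complex_cnj_add)
  show c: "cinner (c *\<^sub>C x) y = c * cinner x y" for c and x y :: 'h by (rule cinner_scaleC_left)
  show d: "cinner x (c *\<^sub>C y) = cnj c * cinner x y" for c and x y :: 'h
    by (metis c cinner_commute complex_cnj_mult)
  show e: "cinner (- x) y = - cinner x y" for x y :: 'h using c[of "-1" x y] by simp
  show f: "cinner x (- y) = - cinner x y" for x y :: 'h using d[of x "-1" y] by simp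
  show "cinner (x - y) z = cinner x z - cinner y z" using a[of x "- y" z] by (simp add: e)
  show "cinner x (y - z) = cinner x y - cinner x z" using b[of x y "- z"] by (simp add: f)
  show "cinner 0 y = 0" using c[of 0 0 y] by simp
  show "cinner x 0 = 0" using d[of x 0 0] by simp
qed

lemma inner_scaleC_ii: "inner (\<i> *\<^sub>C x) y = - Im (cinner x y)" for x :: "'h::complex_hilbert"
  by (simp flip: Re_cinner)

text \<open>The complex inner product is recovered from the real one, so that projection and
  representation theorems can be proved over the reals.\<close>

lemma cinner_eq_inner: "cinner x y = Complex (inner x y) (- inner (\<i> *\<^sub>C x) y)"
  for x :: "'h::complex_hilbert"
  by (simp add: inner_scaleC_ii complex_eq_iff Re_cinner)

lemma cmod_cinner_le: "cmod (cinner x y) \<le> norm x * norm y" for x :: "'h::complex_hilbert"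
proof (cases "cinner x y = 0")
  case False
  \<comment> \<open>A phase that rotates the inner product onto the positive half-axis, where the
    real Cauchy-Schwarz inequality applies.\<close>
  define c where "c = cnj (sgn (cinner x y))"
  have "cinner (c *\<^sub>C x) y = cmod (cinner x y)"
    using False by (simp add: c_def sgn_eq complex_norm_square[symmetric] field_simps power2_eq_square)
  then have "cmod (cinner x y) = inner (c *\<^sub>C x) y"
    by (metis Re_cinner Re_complex_of_real)
  also have "\<dots> \<le> norm (c *\<^sub>C x) * norm y" by (rule norm_cauchy_schwarz)
  also have "norm (c *\<^sub>C x) = norm x"
    using False by (simp add: norm_scaleC c_def norm_sgn)
  finally show ?thesis .
qed simp

lemma cinner_eqI:
  fixes x y :: "'h::complex_hilbert"
  assumes "\<And>z. cinner x z = cinner y z"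
  shows "x = y"
proof -
  have "cinner (x - y) (x - y) = cinner x (x - y) - cinner y (x - y)" by (rule cinner_simps(7))
  then have "cinner (x - y) (x - y) = 0" using assms[of "x - y"] by (simp del: cinner_simps)
  then show ?thesis by (simp add: cinner_same del: cinner_simps)
qed

section \<open>Orthogonal projections and adjoints\<close>

text \<open>A minimising sequence is Cauchy by the parallelogram law, since midpoints stay in
  \<open>K\<close>; varying the minimiser along \<open>k\<close> gives orthogonality. Real spaces
  are the right generality because \<open>ell2\<close> carries only a real structure.\<close>

theorem orthogonal_projection_exists:
  fixes K :: "'a::{real_inner, banach} set"
  assumes "subspace K" "closed K"
  shows "\<exists>y\<in>K. \<forall>k\<in>K. inner (x - y) k = 0"
proof -
  define d where "d = (INF k\<in>K. (norm (x - k))\<^sup>2)"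
  have K0: "0 \<in> K" using assms(1) by (rule subspace_0)
  have bdd: "bdd_below ((\<lambda>k. (norm (x - k))\<^sup>2) ` K)" by (rule bdd_belowI[where m = 0]) auto
  have dle: "d \<le> (norm (x - k))\<^sup>2" if "k \<in> K" for k
    unfolding d_def by (rule cINF_lower[OF bdd that])
  have "\<exists>k\<in>K. (norm (x - k))\<^sup>2 < d + inverse (Suc n)" for n :: nat
    using cINF_less_iff[OF _ bdd, of "d + inverse (Suc n)"] K0 by (auto simp: d_def[symmetric])
  then obtain u where u: "\<And>n. u n \<in> K" "\<And>n. (norm (x - u n))\<^sup>2 < d + inverse (Suc n)"
    by metis
  have par: "(norm (u m - u n))\<^sup>2 \<le> 2 * inverse (Suc m) + 2 * inverse (Suc n)" for m n
  proof -
    have "(1/2) *\<^sub>R (u m + u n) \<in> K"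
      using assms(1) u(1) by (simp add: subspace_add subspace_scale)
    from dle[OF this] have "4 * d \<le> (norm (2 *\<^sub>R (x - (1/2) *\<^sub>R (u m + u n))))\<^sup>2"
      by (simp add: power_mult_distrib)
    also have "2 *\<^sub>R (x - (1/2) *\<^sub>R (u m + u n)) = (x - u m) + (x - u n)"
      by (simp add: algebra_simps scaleR_2)
    finally have "4 * d \<le> (norm ((x - u m) + (x - u n)))\<^sup>2" .
    moreover have "(norm ((x - u m) + (x - u n)))\<^sup>2 + (norm (u m - u n))\<^sup>2 =
        2 * (norm (x - u m))\<^sup>2 + 2 * (norm (x - u n))\<^sup>2"
      by (simp add: power2_norm_eq_inner inner_simps inner_commute)
    ultimately show ?thesis using u(2)[of m] u(2)[of n] by linarith
  qed
  have "Cauchy u"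
  proof (rule CauchyI)
    fix e :: real assume "0 < e"
    then obtain N where N: "inverse (Suc N) < e\<^sup>2 / 4"
      using reals_Archimedean[of "e\<^sup>2 / 4"] by auto
    have "norm (u m - u n) < e" if "N \<le> m" "N \<le> n" for m n
    proof -
      have "inverse (real (Suc m)) \<le> inverse (Suc N)" "inverse (real (Suc n)) \<le> inverse (Suc N)"
        using that by (auto intro!: le_imp_inverse_le)
      then have "(norm (u m - u n))\<^sup>2 < e\<^sup>2" using par[of m n] N by linarith
      then show ?thesis using \<open>0 < e\<close> by (simp add: power2_less_imp_less)
    qed
    then show "\<exists>M. \<forall>m\<ge>M. \<forall>n\<ge>M. norm (u m - u n) < e" by blast
  qed
  then obtain y where y: "u \<longlonglongrightarrow> y" using Cauchy_convergent convergent_def by blast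
  have "y \<in> K" using assms(2) u(1) y closed_sequentially by blast
  have "(\<lambda>n. (norm (x - u n))\<^sup>2) \<longlonglongrightarrow> (norm (x - y))\<^sup>2" by (intro tendsto_intros y)
  moreover have "(\<lambda>n. d + inverse (real (Suc n))) \<longlonglongrightarrow> d"
    using tendsto_add[OF tendsto_const LIMSEQ_inverse_real_of_nat, of d] by simp
  ultimately have yd: "(norm (x - y))\<^sup>2 \<le> d"
    by (rule LIMSEQ_le) (use u(2) less_imp_le in blast)
  have "inner (x - y) k = 0" if k: "k \<in> K" for k
  proof (cases "k = 0")
    case False
    \<comment> \<open>The value that minimises the distance from \<open>x\<close> to
      \<open>y + t *\<^sub>R k\<close>.\<close>
    define t where "t = inner (x - y) k / (norm k)\<^sup>2"
    have "y + t *\<^sub>R k \<in> K" using assms(1) \<open>y \<in> K\<close> k by (simp add: subspace_add subspace_scale)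
    then have "(norm (x - y))\<^sup>2 \<le> (norm (x - (y + t *\<^sub>R k)))\<^sup>2"
      using yd dle order_trans by blast
    also have "x - (y + t *\<^sub>R k) = (x - y) - t *\<^sub>R k" by simp
    also have "(norm ((x - y) - t *\<^sub>R k))\<^sup>2 = (norm (x - y))\<^sup>2 - 2 * t * inner (x - y) k + t\<^sup>2 * (norm k)\<^sup>2"
      unfolding power2_norm_eq_inner
      by (simp add: inner_diff_left inner_diff_right inner_commute power2_eq_square algebra_simps)
    also have "\<dots> = (norm (x - y))\<^sup>2 - (inner (x - y) k)\<^sup>2 / (norm k)\<^sup>2"
      using False by (simp add: t_def power2_eq_square field_simps)
    finally have "(inner (x - y) k)\<^sup>2 / (norm k)\<^sup>2 \<le> 0" by simp
    then show ?thesis using False by (simp add: divide_le_0_iff)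
  qed simp
  then show ?thesis using \<open>y \<in> K\<close> by blast
qed

lemma riesz_representation:
  fixes F :: "'a::{real_inner, banach} \<Rightarrow> real"
  assumes "bounded_linear F"
  shows "\<exists>y. \<forall>x. F x = inner x y"
proof (cases "\<forall>x. F x = 0")
  case True
  then show ?thesis by (intro exI[of _ 0]) simp
next
  case False
  then obtain x0 where x0: "F x0 \<noteq> 0" by blast
  interpret bounded_linear F by fact
  have "subspace {x. F x = 0}" by (auto simp: subspace_def add scaleR)
  moreover have "closed {x. F x = 0}"
    by (intro closed_Collect_eq linear_continuous_on[OF assms] continuous_on_const)
  ultimately obtain y where y: "F y = 0" "\<And>k. F k = 0 \<Longrightarrow> inner (x0 - y) k = 0"
    using orthogonal_projection_exists[of "{x. F x = 0}" x0] by auto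
  define z where "z = x0 - y"
  have Fz: "F z \<noteq> 0" using x0 y(1) by (simp add: z_def diff)
  then have z0: "z \<noteq> 0" using zero by auto
  have "F x = inner x ((F z / (norm z)\<^sup>2) *\<^sub>R z)" for x
  proof -
    have "F (x - (F x / F z) *\<^sub>R z) = 0" using Fz by (simp add: diff scaleR)
    then have "inner z (x - (F x / F z) *\<^sub>R z) = 0" unfolding z_def by (rule y(2))
    then have "inner x z = F x / F z * (norm z)\<^sup>2"
      by (simp add: inner_diff_right inner_commute power2_norm_eq_inner)
    then show ?thesis using Fz z0 by (simp add: field_simps)
  qed
  then show ?thesis by blast
qed

lemma adjoint_unique:
  fixes S S' T :: "'h::complex_hilbert bop"
  assumes "\<And>x y. cinner (bop_apply T x) y = cinner x (bop_apply S y)"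
    and "\<And>x y. cinner (bop_apply T x) y = cinner x (bop_apply S' y)"
  shows "S = S'"
proof (rule bop_eqI, rule cinner_eqI)
  fix y z
  have "cinner z (bop_apply S y) = cinner z (bop_apply S' y)" using assms by metis
  then show "cinner (bop_apply S y) z = cinner (bop_apply S' y) z" by (metis cinner_commute)
qed

lemma adjoint_exists:
  fixes T :: "'h::complex_hilbert bop"
  shows "\<exists>S. \<forall>x y. cinner (bop_apply T x) y = cinner x (bop_apply S y)"
proof -
  have "bounded_linear (\<lambda>x. inner (bop_apply T x) y)" for y
    by (rule bounded_linear_compose[OF bounded_linear_inner_left bounded_linear_bop_apply])
  then have "\<exists>w. \<forall>x. inner (bop_apply T x) y = inner x w" for y
    by (rule riesz_representation)
  then obtain S where S: "\<And>x y. inner (bop_apply T x) y = inner x (S y)" by metis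
  \<comment> \<open>Real representation fixes only the real part; evaluating it also at
    \<open>\<i> *\<^sub>C x\<close> yields the imaginary part.\<close>
  have c: "cinner (bop_apply T x) y = cinner x (S y)" for x y
    using S[of x y] S[of "\<i> *\<^sub>C x" y] by (simp add: cinner_eq_inner)
  have c': "cinner (S y) x = cinner y (bop_apply T x)" for x y
    by (metis c cinner_commute)
  have "\<exists>S'. \<forall>x. bop_apply S' x = S x"
  proof (rule bop_exists[where b = "norm T"])
    show "S (x + y) = S x + S y" for x y by (rule cinner_eqI) (simp add: c')
    show "S (a *\<^sub>C x) = a *\<^sub>C S x" for a x by (rule cinner_eqI) (simp add: c')
    fix x
    have "(norm (S x))\<^sup>2 = inner (bop_apply T (S x)) x"
      by (simp add: S power2_norm_eq_inner)
    also have "\<dots> \<le> norm (bop_apply T (S x)) * norm x" by (rule norm_cauchy_schwarz)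
    also have "\<dots> \<le> norm T * norm (S x) * norm x" by (intro mult_right_mono bop_apply_bounded) simp
    finally have "norm (S x) * norm (S x) \<le> norm (S x) * (norm T * norm x)"
      by (simp add: power2_eq_square mult_ac)
    then show "norm (S x) \<le> norm T * norm x"
      by (cases "norm (S x) = 0") auto
  qed
  then show ?thesis using c by metis
qed

lemma cinner_adj: "cinner (bop_apply T x) y = cinner x (bop_apply (adj T) y)"
proof -
  have "\<exists>!S. \<forall>x y. cinner (bop_apply T x) y = cinner x (bop_apply S y)"
    using adjoint_exists[of T] adjoint_unique[of T] by blast
  from theI'[OF this] show ?thesis unfolding adj_def by blast
qed

lemma cinner_adj': "cinner (bop_apply (adj T) x) y = cinner x (bop_apply T y)"
  by (metis cinner_adj cinner_commute)

lemma adj_eqI: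
  assumes "\<And>x y. cinner (bop_apply T x) y = cinner x (bop_apply S y)"
  shows "adj T = S"
  using adjoint_unique[of T "adj T" S] cinner_adj assms by blast

lemma adj_adj [simp]: "adj (adj T) = T"
  by (rule adj_eqI) (rule cinner_adj')

lemma adj_mult: "adj (S * T) = adj T * adj S"
  by (rule adj_eqI) (simp add: cinner_adj)

text \<open>Spectral integrals are specified by their quadratic form only; this transfers equality
  and convergence from the diagonal to all pairs of vectors.\<close>

lemma polarization:
  fixes T :: "'h::complex_hilbert bop"
  defines "q \<equiv> \<lambda>x. cinner (bop_apply T x) x"
  shows "4 * cinner (bop_apply T x) y =
    q (x + y) - q (x - y) + \<i> * q (x + \<i> *\<^sub>C y) - \<i> * q (x - \<i> *\<^sub>C y)"
proof -
  have T_diff: "bop_apply T (u - v) = bop_apply T u - bop_apply T v" for u v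
    using bounded_linear.linear[OF bounded_linear_bop_apply] by (rule linear_diff)
  show ?thesis
    unfolding q_def by (simp add: T_diff distrib_left right_diff_distrib mult.assoc[symmetric])
qed

lemma bop_eqI_quadratic:
  assumes "\<And>x. cinner (bop_apply S x) x = cinner (bop_apply T x) x"
  shows "S = T"
proof (rule bop_eqI, rule cinner_eqI)
  fix x z
  show "cinner (bop_apply S x) z = cinner (bop_apply T x) z"
    using polarization[of S x z] polarization[of T x z] unfolding assms
    by (metis mult_cancel_left zero_neq_numeral)
qed

lemma positive_op_self_adjoint:
  assumes "positive_op T"
  shows "adj T = T"
proof (rule bop_eqI_quadratic)
  fix x
  have "cinner (bop_apply T x) x \<in> \<real>"
    using assms unfolding positive_op_def by (meson nonneg_Reals_subset_Reals subsetD)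
  then show "cinner (bop_apply (adj T) x) x = cinner (bop_apply T x) x"
    by (metis Reals_cnj_iff cinner_adj' cinner_commute)
qed

section \<open>Amplification, density and the ultraweak topology\<close>

section \<open>Square-summable sequences\<close>

text \<open>The Hilbert space H (x) l^2. One vector of it bundles a square-summable sequence from
  the definition of the ultraweak topology, so that a normal functional is controlled by a single
  vector.\<close>

typedef (overloaded) 'a ell2 = "{x :: nat \<Rightarrow> 'a::real_inner. summable (\<lambda>k. (norm (x k))\<^sup>2)}"
  morphisms coord Ell2
  by (rule exI[of _ "\<lambda>_. 0"]) simp

setup_lifting type_definition_ell2

lemma summable_norm_coord: "summable (\<lambda>k. (norm (coord x k))\<^sup>2)"
  using coord[of x] by simp

lemma summable_norm_add_power2:
  fixes x y :: "nat \<Rightarrow> 'a::real_inner"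
  assumes "summable (\<lambda>k. (norm (x k))\<^sup>2)" "summable (\<lambda>k. (norm (y k))\<^sup>2)"
  shows "summable (\<lambda>k. (norm (x k + y k))\<^sup>2)"
proof (rule summable_comparison_test')
  show "summable (\<lambda>k. 2 * (norm (x k))\<^sup>2 + 2 * (norm (y k))\<^sup>2)"
    by (intro summable_add summable_mult assms)
  fix k
  have "(norm (x k + y k))\<^sup>2 + (norm (x k - y k))\<^sup>2 = 2 * (norm (x k))\<^sup>2 + 2 * (norm (y k))\<^sup>2"
    unfolding power2_norm_eq_inner
    by (simp add: inner_add_left inner_add_right inner_diff_left inner_diff_right inner_commute)
  then show "norm ((norm (x k + y k))\<^sup>2) \<le> 2 * (norm (x k))\<^sup>2 + 2 * (norm (y k))\<^sup>2"
    using zero_le_power2[of "norm (x k - y k)"] unfolding real_norm_def abs_power2 by linarith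
qed

lemma summable_inner:
  fixes x y :: "nat \<Rightarrow> 'a::real_inner"
  assumes "summable (\<lambda>k. (norm (x k))\<^sup>2)" "summable (\<lambda>k. (norm (y k))\<^sup>2)"
  shows "summable (\<lambda>k. inner (x k) (y k))"
proof (rule summable_comparison_test')
  show "summable (\<lambda>k. (norm (x k))\<^sup>2 + (norm (y k))\<^sup>2)"
    by (intro summable_add assms)
  fix k
  have "\<bar>inner (x k) (y k)\<bar> \<le> norm (x k) * norm (y k)" by (rule Cauchy_Schwarz_ineq2)
  also have "\<dots> \<le> (norm (x k))\<^sup>2 + (norm (y k))\<^sup>2"
    using sum_squares_bound[of "norm (x k)" "norm (y k)"]
      zero_le_power2[of "norm (x k)"] zero_le_power2[of "norm (y k)"] by linarith
  finally show "norm (inner (x k) (y k)) \<le> (norm (x k))\<^sup>2 + (norm (y k))\<^sup>2" by simp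
qed

instantiation ell2 :: (real_inner) real_inner
begin

lift_definition zero_ell2 :: "'a ell2" is "\<lambda>_. 0" by simp
lift_definition plus_ell2 :: "'a ell2 \<Rightarrow> 'a ell2 \<Rightarrow> 'a ell2" is "\<lambda>x y k. x k + y k"
  by (rule summable_norm_add_power2)
lift_definition uminus_ell2 :: "'a ell2 \<Rightarrow> 'a ell2" is "\<lambda>x k. - x k" by simp
lift_definition minus_ell2 :: "'a ell2 \<Rightarrow> 'a ell2 \<Rightarrow> 'a ell2" is "\<lambda>x y k. x k - y k"
  using summable_norm_add_power2[of _ "\<lambda>k. - _ k"] by (simp add: diff_conv_add_uminus del: add_uminus_conv_diff)
lift_definition scaleR_ell2 :: "real \<Rightarrow> 'a ell2 \<Rightarrow> 'a ell2" is "\<lambda>r x k. r *\<^sub>R x k"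
  by (simp add: power_mult_distrib)
definition inner_ell2 :: "'a ell2 \<Rightarrow> 'a ell2 \<Rightarrow> real" where
  "inner_ell2 x y = (\<Sum>k. inner (coord x k) (coord y k))"
definition norm_ell2 :: "'a ell2 \<Rightarrow> real" where "norm_ell2 x = sqrt (inner x x)"
definition dist_ell2 :: "'a ell2 \<Rightarrow> 'a ell2 \<Rightarrow> real" where "dist_ell2 x y = norm (x - y)"
definition sgn_ell2 :: "'a ell2 \<Rightarrow> 'a ell2" where "sgn_ell2 x = scaleR (inverse (norm x)) x"
definition uniformity_ell2 :: "('a ell2 \<times> 'a ell2) filter" where
  "uniformity_ell2 = (INF e\<in>{0<..}. principal {(x, y). dist x y < e})"
definition open_ell2 :: "'a ell2 set \<Rightarrow> bool" where
  "open_ell2 S = (\<forall>x\<in>S. \<forall>\<^sub>F (x', y) in uniformity. x' = x \<longrightarrow> y \<in> S)"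

instance
proof
  fix x y z :: "'a ell2" and r s :: real
  show "dist x y = norm (x - y)" by (rule dist_ell2_def)
  show "sgn x = inverse (norm x) *\<^sub>R x" by (rule sgn_ell2_def)
  show "uniformity = (INF e\<in>{0<..}. principal {(x, y::'a ell2). dist x y < e})"
    by (rule uniformity_ell2_def)
  show "open S = (\<forall>x\<in>S. \<forall>\<^sub>F (x', y) in uniformity. x' = x \<longrightarrow> y \<in> S)" for S :: "'a ell2 set"
    by (rule open_ell2_def)
  show "norm x = sqrt (inner x x)" by (rule norm_ell2_def)
  show "x + y + z = x + (y + z)" by transfer (simp add: add.assoc)
  show "x + y = y + x" by transfer (simp add: add.commute)
  show "0 + x = x" by transfer simp
  show "- x + x = 0" by transfer simp
  show "x - y = x + - y" by transfer simp
  show "r *\<^sub>R (x + y) = r *\<^sub>R x + r *\<^sub>R y" by transfer (simp add: scaleR_add_right)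
  show "(r + s) *\<^sub>R x = r *\<^sub>R x + s *\<^sub>R x" by transfer (simp add: scaleR_add_left)
  show "r *\<^sub>R s *\<^sub>R x = (r * s) *\<^sub>R x" by transfer simp
  show "1 *\<^sub>R x = x" by transfer simp
  show "inner x y = inner y x" by (simp add: inner_ell2_def inner_commute)
  have s: "summable (\<lambda>k. inner (coord x k) (coord y k))" for x y :: "'a ell2"
    by (rule summable_inner) (rule summable_norm_coord)+
  show "inner (x + y) z = inner x z + inner y z"
    by (simp add: inner_ell2_def plus_ell2.rep_eq inner_add_left suminf_add[OF s s])
  show "inner (r *\<^sub>R x) y = r * inner x y"
    by (simp add: inner_ell2_def scaleR_ell2.rep_eq suminf_mult[OF s])
  show "0 \<le> inner x x" by (simp add: inner_ell2_def suminf_nonneg[OF s])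
  have "(inner x x = 0) = (\<forall>k. inner (coord x k) (coord x k) = 0)"
    unfolding inner_ell2_def by (rule suminf_eq_zero_iff[OF s]) simp
  also have "\<dots> = (x = 0)"
    by (simp add: coord_inject[symmetric] zero_ell2.rep_eq fun_eq_iff)
  finally show "(inner x x = 0) = (x = 0)" .
qed

end

lemma coord_simps [simp]:
  "coord 0 k = 0" "coord (x + y) k = coord x k + coord y k"
  "coord (x - y) k = coord x k - coord y k" "coord (- x) k = - coord x k"
  "coord (r *\<^sub>R x) k = r *\<^sub>R coord x k"
  by (transfer; simp)+

lemma ell2_eqI: "(\<And>k. coord x k = coord y k) \<Longrightarrow> x = y"
  by (simp add: coord_inject[symmetric] fun_eq_iff)

lemma norm_ell2_power2: "(norm x)\<^sup>2 = (\<Sum>k. (norm (coord x k))\<^sup>2)"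
  by (simp add: power2_norm_eq_inner) (simp add: inner_ell2_def)

lemma sum_norm_coord_le: "(\<Sum>k<n. (norm (coord x k))\<^sup>2) \<le> (norm x)\<^sup>2"
  unfolding norm_ell2_power2 by (rule sum_le_suminf[OF summable_norm_coord]) auto

lemma norm_ell2_leI:
  assumes "\<And>n. (\<Sum>k<n. (norm (coord x k))\<^sup>2) \<le> e\<^sup>2" "0 \<le> e"
  shows "norm x \<le> e"
  using suminf_le_const[OF summable_norm_coord assms(1)] assms(2)
  by (simp add: norm_ell2_power2[symmetric] power2_le_iff_abs_le)

lemma norm_coord_le: "norm (coord x k) \<le> norm x"
proof -
  have "(norm (coord x k))\<^sup>2 \<le> (\<Sum>k<Suc k. (norm (coord x k))\<^sup>2)"
    by (simp add: sum_nonneg)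
  also have "\<dots> \<le> (norm x)\<^sup>2" by (rule sum_norm_coord_le)
  finally show ?thesis by (simp add: power2_le_iff_abs_le)
qed

lemma bounded_linear_coord: "bounded_linear (\<lambda>x. coord x k)"
  by (rule bounded_linear_intro[where K = 1]) (simp_all add: norm_coord_le)

instance ell2 :: ("{real_inner, banach}") banach
proof
  fix X :: "nat \<Rightarrow> 'a ell2" assume X: "Cauchy X"
  have "Cauchy (\<lambda>n. coord (X n) k)" for k
    by (rule bounded_linear.Cauchy[OF bounded_linear_coord X])
  then have "\<forall>k. \<exists>l. (\<lambda>n. coord (X n) k) \<longlonglongrightarrow> l"
    using Cauchy_convergent convergent_def by blast
  then obtain L where L: "\<And>k. (\<lambda>n. coord (X n) k) \<longlonglongrightarrow> L k" by metis
  \<comment> \<open>Finite truncations come first: the limit in \<open>n\<close> passes through a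
    finite sum, and the bound does not depend on \<open>N\<close>.\<close>
  have close: "(\<Sum>k<N. (norm (coord (X m) k - L k))\<^sup>2) \<le> e\<^sup>2"
    if e: "\<And>m n. M \<le> m \<Longrightarrow> M \<le> n \<Longrightarrow> norm (X m - X n) < e" and m: "M \<le> m" for M N m e
  proof (rule LIMSEQ_le_const2)
    show "(\<lambda>n. \<Sum>k<N. (norm (coord (X m) k - coord (X n) k))\<^sup>2) \<longlonglongrightarrow>
        (\<Sum>k<N. (norm (coord (X m) k - L k))\<^sup>2)"
      by (intro tendsto_intros L)
    have "(\<Sum>k<N. (norm (coord (X m) k - coord (X n) k))\<^sup>2) \<le> e\<^sup>2" if "M \<le> n" for n
    proof -
      have "(\<Sum>k<N. (norm (coord (X m - X n) k))\<^sup>2) \<le> (norm (X m - X n))\<^sup>2"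
        by (rule sum_norm_coord_le)
      also have "\<dots> \<le> e\<^sup>2" using e[OF m that] by (intro power_mono) auto
      finally show ?thesis by simp
    qed
    then show "\<exists>N'. \<forall>n\<ge>N'. (\<Sum>k<N. (norm (coord (X m) k - coord (X n) k))\<^sup>2) \<le> e\<^sup>2" by blast
  qed
  obtain M where M: "\<And>m n. M \<le> m \<Longrightarrow> M \<le> n \<Longrightarrow> norm (X m - X n) < 1"
    using CauchyD[OF X, of 1] by auto
  have "summable (\<lambda>k. (norm (coord (X M) k - L k))\<^sup>2)"
    by (rule summableI_nonneg_bounded[where x = "1\<^sup>2"]) (use close[OF M] in auto)
  then have "summable (\<lambda>k. (norm (- (coord (X M) k - L k) + coord (X M) k))\<^sup>2)"
    by (intro summable_norm_add_power2 summable_norm_coord) (simp add: norm_minus_commute)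
  then have "summable (\<lambda>k. (norm (L k))\<^sup>2)" by simp
  then have c: "coord (Ell2 L) = L" by (simp add: Ell2_inverse)
  have "X \<longlonglongrightarrow> Ell2 L"
  proof (rule LIMSEQ_I)
    fix e :: real assume "0 < e"
    then obtain M where M: "\<And>m n. M \<le> m \<Longrightarrow> M \<le> n \<Longrightarrow> norm (X m - X n) < e / 2"
      using CauchyD[OF X, of "e / 2"] by auto
    have "norm (X m - Ell2 L) \<le> e / 2" if "M \<le> m" for m
      by (rule norm_ell2_leI) (use close[OF M that] \<open>0 < e\<close> in \<open>auto simp: c\<close>)
    then show "\<exists>no. \<forall>n\<ge>no. norm (X n - Ell2 L) < e"
      using \<open>0 < e\<close> by (intro exI[of _ M]) (fastforce intro: le_less_trans)
  qed
  then show "convergent X" by (auto simp: convergent_def)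
qed

lift_definition single :: "nat \<Rightarrow> 'a::real_inner \<Rightarrow> 'a ell2" is "\<lambda>j h k. if k = j then h else 0"
proof -
  show "summable (\<lambda>k. (norm (if k = j then h else 0))\<^sup>2)" for j and h :: 'a
    by (rule summable_finite[of "{j}"]) auto
qed

lemma coord_single: "coord (single j h) k = (if k = j then h else 0)"
  by transfer simp

lemma norm_single: "norm (single j h) = norm h"
proof -
  have "(norm (single j h))\<^sup>2 = (\<Sum>k. if k = j then (norm h)\<^sup>2 else 0)"
    unfolding norm_ell2_power2 by (intro suminf_cong) (simp add: coord_single)
  also have "\<dots> = (norm h)\<^sup>2"
    using sums_unique[OF sums_single[of j "\<lambda>_. (norm h)\<^sup>2"]] by simp
  finally show ?thesis by (simp add: power2_eq_iff_nonneg)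
qed

text \<open>The remainder after \<open>n\<close> terms has squared norm equal to the tail of a
  convergent series. The expansion lets a projection on \<open>ell2\<close> be recovered from its
  matrix entries.\<close>

lemma ell2_sums_single: "(\<lambda>j. single j (coord x j)) sums x"
proof -
  have c: "coord (\<Sum>j<n. single j (coord x j)) k = (if k < n then coord x k else 0)" for n k
    by (induction n) (auto simp: coord_single less_Suc_eq)
  have n: "(norm (x - (\<Sum>j<n. single j (coord x j))))\<^sup>2 = (norm x)\<^sup>2 - (\<Sum>k<n. (norm (coord x k))\<^sup>2)" for n
  proof -
    let ?d = "x - (\<Sum>j<n. single j (coord x j))"
    have "(norm ?d)\<^sup>2 = (\<Sum>k. (norm (coord ?d (k + n)))\<^sup>2) + (\<Sum>k<n. (norm (coord ?d k))\<^sup>2)"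
      unfolding norm_ell2_power2 by (rule suminf_split_initial_segment[OF summable_norm_coord])
    also have "\<dots> = (\<Sum>k. (norm (coord x (k + n)))\<^sup>2)" by (simp add: c)
    also have "\<dots> = (norm x)\<^sup>2 - (\<Sum>k<n. (norm (coord x k))\<^sup>2)"
      unfolding norm_ell2_power2 using suminf_split_initial_segment[OF summable_norm_coord, of x n] by simp
    finally show ?thesis .
  qed
  have "(\<lambda>n. (norm x)\<^sup>2 - (\<Sum>k<n. (norm (coord x k))\<^sup>2)) \<longlonglongrightarrow> (norm x)\<^sup>2 - (norm x)\<^sup>2"
    using summable_LIMSEQ[OF summable_norm_coord, of x]
    by (intro tendsto_diff tendsto_const) (simp add: norm_ell2_power2)
  then have "(\<lambda>n. sqrt ((norm (x - (\<Sum>j<n. single j (coord x j))))\<^sup>2)) \<longlonglongrightarrow> sqrt 0"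
    by (intro tendsto_real_sqrt) (simp add: n)
  then have "(\<lambda>n. norm (x - (\<Sum>j<n. single j (coord x j)))) \<longlonglongrightarrow> 0"
    by (simp only: real_sqrt_abs abs_norm_cancel real_sqrt_zero)
  then have "(\<lambda>n. x - (x - (\<Sum>j<n. single j (coord x j)))) \<longlonglongrightarrow> x - 0"
    by (intro tendsto_diff tendsto_const) (rule tendsto_norm_zero_cancel)
  then show ?thesis by (simp add: sums_def)
qed

section \<open>The double commutant theorem on square-summable sequences\<close>

lemma summable_bop_apply:
  assumes "summable (\<lambda>k. (norm (x k))\<^sup>2)"
  shows "summable (\<lambda>k. (norm (bop_apply T (x k)))\<^sup>2)"
proof (rule summable_comparison_test')
  show "summable (\<lambda>k. (norm T)\<^sup>2 * (norm (x k))\<^sup>2)" by (rule summable_mult[OF assms])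
  show "norm ((norm (bop_apply T (x k)))\<^sup>2) \<le> (norm T)\<^sup>2 * (norm (x k))\<^sup>2" for k
    using power_mono[OF bop_apply_bounded[of T "x k"], of 2] by (simp add: power_mult_distrib)
qed

text \<open>The amplification T (x) 1.\<close>

lift_definition ampl :: "'h::complex_hilbert bop \<Rightarrow> 'h ell2 \<Rightarrow> 'h ell2" is
  "\<lambda>T x k. bop_apply T (x k)"
  by (rule summable_bop_apply)

lemma coord_ampl [simp]: "coord (ampl T x) k = bop_apply T (coord x k)"
  by transfer simp

lemma norm_ampl_le: "norm (ampl T x) \<le> norm T * norm x"
proof (rule norm_ell2_leI)
  fix n
  have "(\<Sum>k<n. (norm (coord (ampl T x) k))\<^sup>2) \<le> (\<Sum>k<n. (norm T)\<^sup>2 * (norm (coord x k))\<^sup>2)"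
    by (intro sum_mono) (simp add: power_mono bop_apply_bounded flip: power_mult_distrib)
  also have "\<dots> \<le> (norm T)\<^sup>2 * (norm x)\<^sup>2"
    by (simp add: sum_distrib_left[symmetric] mult_left_mono sum_norm_coord_le)
  finally show "(\<Sum>k<n. (norm (coord (ampl T x) k))\<^sup>2) \<le> (norm T * norm x)\<^sup>2"
    by (simp add: power_mult_distrib)
qed simp

lemma bop_apply_diff [simp]: "bop_apply T (x - y) = bop_apply T x - bop_apply T y"
  using bounded_linear.linear[OF bounded_linear_bop_apply] by (rule linear_diff)

lemma bop_apply_scaleR [simp]: "bop_apply T (r *\<^sub>R x) = r *\<^sub>R bop_apply T x"
  using bounded_linear.linear[OF bounded_linear_bop_apply] by (rule linear_cmul)

lemma bop_apply_zero [simp]: "bop_apply T 0 = 0"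
  using bounded_linear.linear[OF bounded_linear_bop_apply] by (rule linear_0)

lemma bounded_linear_ampl: "bounded_linear (ampl T)"
  by (rule bounded_linear_intro[where K = "norm T"])
    (auto intro!: ell2_eqI simp: norm_ampl_le mult.commute[of _ "norm T"])

lemma ampl_simps: "ampl 1 x = x" "ampl (S * T) x = ampl S (ampl T x)"
  "ampl (S + T) x = ampl S x + ampl T x" "ampl (S - T) x = ampl S x - ampl T x"
  by (rule ell2_eqI; simp)+

lemma inner_ampl_adj: "inner (ampl T x) y = inner x (ampl (adj T) y)"
  unfolding inner_ell2_def by (simp add: cinner_adj flip: Re_cinner)

lemma unital_algebra_generatedI:
  assumes "finite I"
  shows "(\<Sum>k\<in>I. c k *\<^sub>C X ^ k) \<in> unital_algebra_generated X"
proof -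
  obtain n where n: "I \<subseteq> {..n}" using finite_nat_iff_bounded_le assms by blast
  have "(\<Sum>k\<in>I. c k *\<^sub>C X ^ k) = (\<Sum>k\<le>n. (if k \<in> I then c k else 0) *\<^sub>C X ^ k)"
    by (rule sum.mono_neutral_cong_left) (use n in auto)
  then show ?thesis unfolding unital_algebra_generated_def mem_Collect_eq
    by (intro exI[of _ "\<lambda>k. if k \<in> I then c k else 0"] exI[of _ n]) simp
qed

lemma unital_algebra_generated_closed:
  shows "1 \<in> unital_algebra_generated X" "X ^ k \<in> unital_algebra_generated X"
    "S \<in> unital_algebra_generated X \<Longrightarrow> T \<in> unital_algebra_generated X \<Longrightarrow> S + T \<in> unital_algebra_generated X"
    "S \<in> unital_algebra_generated X \<Longrightarrow> c *\<^sub>C S \<in> unital_algebra_generated X"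
    "S \<in> unital_algebra_generated X \<Longrightarrow> X * S \<in> unital_algebra_generated X"
proof -
  show pw: "X ^ k \<in> unital_algebra_generated X" for k
    using unital_algebra_generatedI[of "{k}" "\<lambda>_. 1" X] by simp
  from pw[of 0] show "1 \<in> unital_algebra_generated X" by simp
  have lin: "c *\<^sub>C (\<Sum>k\<in>I. f k) = (\<Sum>k\<in>I. c *\<^sub>C f k)" for c and I :: "nat set" and f :: "nat \<Rightarrow> 'a bop"
    by (rule linear_sum[OF bounded_linear.linear[OF bounded_linear_scaleC_bop]])
  { assume "S \<in> unital_algebra_generated X" "T \<in> unital_algebra_generated X"
    then obtain c m d n where S: "S = (\<Sum>k\<le>m. c k *\<^sub>C X ^ k)" and T: "T = (\<Sum>k\<le>n. d k *\<^sub>C X ^ k)"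
      unfolding unital_algebra_generated_def by blast
    have "S = (\<Sum>k\<le>max m n. (if k \<le> m then c k else 0) *\<^sub>C X ^ k)"
      unfolding S by (rule sum.mono_neutral_cong_left) auto
    moreover have "T = (\<Sum>k\<le>max m n. (if k \<le> n then d k else 0) *\<^sub>C X ^ k)"
      unfolding T by (rule sum.mono_neutral_cong_left) auto
    ultimately have "S + T = (\<Sum>k\<le>max m n. ((if k \<le> m then c k else 0) + (if k \<le> n then d k else 0)) *\<^sub>C X ^ k)"
      by (simp only: scaleC_bop(2) sum.distrib)
    then show "S + T \<in> unital_algebra_generated X"
      by (simp only: scaleC_bop(2)[symmetric] unital_algebra_generatedI finite_atMost) }
  { assume "S \<in> unital_algebra_generated X"
    then obtain d m where S: "S = (\<Sum>k\<le>m. d k *\<^sub>C X ^ k)"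
      unfolding unital_algebra_generated_def by blast
    then have "c *\<^sub>C S = (\<Sum>k\<le>m. (c * d k) *\<^sub>C X ^ k)" by (simp add: lin)
    then show "c *\<^sub>C S \<in> unital_algebra_generated X" by (simp add: unital_algebra_generatedI)
    have "X * S = (\<Sum>k\<le>m. d k *\<^sub>C X ^ Suc k)" by (simp add: S sum_distrib_left)
    also have "\<dots> = (\<Sum>k\<in>Suc ` {..m}. d (k - 1) *\<^sub>C X ^ k)" by (simp add: sum.reindex)
    finally show "X * S \<in> unital_algebra_generated X"
      by (metis unital_algebra_generatedI finite_atMost finite_imageI) }
qed

lemma subspace_closure:
  fixes S :: "'a::real_normed_vector set"
  assumes "subspace S"
  shows "subspace (closure S)"
  unfolding subspace_def
proof (intro conjI ballI allI)
  show "0 \<in> closure S" using subspace_0[OF assms] closure_subset by blast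
next
  fix x y assume "x \<in> closure S" "y \<in> closure S"
  then obtain u v where "\<And>n. u n \<in> S" "u \<longlonglongrightarrow> x" "\<And>n. v n \<in> S" "v \<longlonglongrightarrow> y"
    unfolding closure_sequential by blast
  then have "\<forall>n. u n + v n \<in> S" "(\<lambda>n. u n + v n) \<longlonglongrightarrow> x + y"
    using assms by (auto intro: tendsto_add subspace_add)
  then show "x + y \<in> closure S" unfolding closure_sequential by (intro exI conjI)
next
  fix r :: real and x assume "x \<in> closure S"
  then obtain u where "\<And>n. u n \<in> S" "u \<longlonglongrightarrow> x"
    unfolding closure_sequential by blast
  then have "\<forall>n. r *\<^sub>R u n \<in> S" "(\<lambda>n. r *\<^sub>R u n) \<longlonglongrightarrow> r *\<^sub>R x"
    using assms by (auto intro: tendsto_intros subspace_scale)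
  then show "r *\<^sub>R x \<in> closure S" unfolding closure_sequential by (intro exI conjI)
qed

text \<open>Von Neumann's argument. Let \<open>P\<close> project onto the closure of the orbit of
  \<xi> under polynomials in \<open>X\<close>. Its matrix entries lie in the commutant of
  \<open>X\<close>, so \<open>T\<close> commutes with each of them and its amplification commutes
  with \<open>P\<close>. As \<open>P\<close> fixes \<xi>, the vector \<open>ampl T \<xi>\<close>
  stays in that closure.\<close>

theorem double_commutant_approximation:
  fixes X T :: "'h::complex_hilbert bop" and \<xi> :: "'h ell2"
  assumes X: "adj X = X" and T: "T \<in> commutant (commutant {X})" and "0 < e"
  shows "\<exists>S\<in>unital_algebra_generated X. norm (ampl (T - S) \<xi>) < e"
proof -
  \<comment> \<open>Multiplication by i. Since \<open>ell2\<close> has only a real structure,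
    complex linearity of \<open>P\<close> is obtained by showing that \<open>P\<close> commutes with
    \<open>J\<close>.\<close>
  define J :: "'h ell2 \<Rightarrow> 'h ell2" where "J = ampl (\<i> *\<^sub>C 1)"
  define K0 where "K0 = (\<lambda>S. ampl S \<xi>) ` unital_algebra_generated X"
  define K where "K = closure K0"
  note alg = unital_algebra_generated_closed[where X = X]
  have scR: "r *\<^sub>R ampl S \<xi> = ampl (complex_of_real r *\<^sub>C S) \<xi>" for r S
    by (rule ell2_eqI) (simp add: scaleC_of_real)
  have "subspace K0"
    unfolding subspace_def
  proof (intro conjI ballI allI)
    show "0 \<in> K0"
      using alg(4)[OF alg(1), of 0] by (auto simp: K0_def image_iff intro!: bexI[of _ 0] ell2_eqI)
    show "x + y \<in> K0" if "x \<in> K0" "y \<in> K0" for x y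
      using that alg(3) unfolding K0_def by (force simp: ampl_simps(3)[symmetric])
    show "r *\<^sub>R x \<in> K0" if "x \<in> K0" for r x
      using that alg(4) by (auto simp: K0_def scR)
  qed
  then have K: "subspace K" "closed K" unfolding K_def by (auto intro: subspace_closure)
  have inv: "L x \<in> K" if L: "bounded_linear L" "\<And>x. x \<in> K0 \<Longrightarrow> L x \<in> K0" and x: "x \<in> K" for L x
  proof -
    have "L ` closure K0 \<subseteq> closure (L ` K0)"
      by (intro image_closure_subset linear_continuous_on L(1)) (auto simp: closure_subset)
    also have "\<dots> \<subseteq> closure K0" using L(2) by (intro closure_mono) auto
    finally show ?thesis using x by (auto simp: K_def)
  qed
  have XK: "ampl X x \<in> K" if "x \<in> K" for x
    by (rule inv[OF bounded_linear_ampl _ that]) (auto simp: K0_def ampl_simps(2)[symmetric] intro!: imageI alg(5))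
  have JK: "J x \<in> K" if "x \<in> K" for x
  proof (rule inv[OF _ _ that])
    show "bounded_linear J" unfolding J_def by (rule bounded_linear_ampl)
    have "J (ampl S \<xi>) = ampl (\<i> *\<^sub>C S) \<xi>" for S by (rule ell2_eqI) (simp add: J_def)
    then show "J x \<in> K0" if "x \<in> K0" for x using that alg(4) by (auto simp: K0_def)
  qed
  obtain P where P: "\<And>y. P y \<in> K" "\<And>y k. k \<in> K \<Longrightarrow> inner (y - P y) k = 0"
    using orthogonal_projection_exists[OF K] by metis
  have P_eq: "P y = p" if "p \<in> K" "\<And>k. k \<in> K \<Longrightarrow> inner (y - p) k = 0" for y p
  proof -
    have d: "P y - p \<in> K" using P(1) that(1) K(1) by (simp add: subspace_diff)
    have "inner (P y - p) (P y - p) = inner (y - p) (P y - p) - inner (y - P y) (P y - p)"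
      by (simp add: inner_diff_left)
    also have "\<dots> = 0" using that(2)[OF d] P(2)[OF d] by simp
    finally show ?thesis by simp
  qed
  have P_commute: "P (L y) = L (P y)"
    if L: "bounded_linear L" "\<And>x. x \<in> K \<Longrightarrow> L x \<in> K" "\<And>x. x \<in> K \<Longrightarrow> L' x \<in> K"
      "\<And>x y. inner (L x) y = inner x (L' y)" for L L' y
  proof (rule P_eq)
    show "L (P y) \<in> K" by (rule L(2)[OF P(1)])
    fix k assume k: "k \<in> K"
    have "L y - L (P y) = L (y - P y)"
      by (simp add: linear_diff[OF bounded_linear.linear[OF L(1)]])
    then show "inner (L y - L (P y)) k = 0" using P(2)[OF L(3)[OF k], of y] by (simp add: L(4))
  qed
  have P_add: "P (x + y) = P x + P y" for x y
  proof (rule P_eq)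
    show "P x + P y \<in> K" using P(1) K(1) by (simp add: subspace_add)
    show "inner (x + y - (P x + P y)) k = 0" if "k \<in> K" for k
      using P(2)[OF that, of x] P(2)[OF that, of y] by (simp add: inner_diff_left inner_add_left)
  qed
  have P_scaleR: "P (r *\<^sub>R x) = r *\<^sub>R P x" for r x
    by (rule P_eq) (use P K(1) in \<open>auto simp: subspace_scale scaleR_diff_right[symmetric]\<close>)
  have P_norm: "norm (P y) \<le> norm y" for y
  proof -
    have "inner (P y) (P y) = inner y (P y)" using P(2)[OF P(1), of y y] by (simp add: inner_diff_left)
    then have "norm (P y) * norm (P y) \<le> norm y * norm (P y)"
      using norm_cauchy_schwarz[of y "P y"] by (simp add: power2_norm_eq_inner[symmetric] power2_eq_square)
    then show ?thesis by (cases "P y = 0") auto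
  qed
  have P_bl: "bounded_linear P"
    by (rule bounded_linear_intro[where K = 1]) (auto simp: P_add P_scaleR P_norm)
  have PX: "P (ampl X y) = ampl X (P y)" for y
    by (rule P_commute[where L' = "ampl X"]) (auto simp: bounded_linear_ampl XK inner_ampl_adj X)
  have adjJ: "adj (\<i> *\<^sub>C 1 :: 'h bop) = - (\<i> *\<^sub>C 1)" by (rule adj_eqI) simp
  have PJ: "P (J y) = J (P y)" for y
  proof (rule P_commute[where L' = "\<lambda>x. - J x"])
    show "inner (J x) y = inner x (- J y)" for x y
    proof -
      have "ampl (- (\<i> *\<^sub>C 1)) y = - J y" by (rule ell2_eqI) (simp add: J_def)
      then show ?thesis by (simp add: J_def inner_ampl_adj adjJ)
    qed
  qed (use JK K(1) in \<open>auto simp: J_def bounded_linear_ampl subspace_neg\<close>)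
  \<comment> \<open>The matrix entries of \<open>P\<close> between the copies of H.\<close>
  define E where "E = (\<lambda>i j h. coord (P (single j h)) i)"
  have "\<exists>S. \<forall>h. bop_apply S h = E i j h" for i j
  proof (rule bop_exists[where b = 1])
    have single_add: "single j (x + y) = single j x + single j y" for x y :: 'h
      by (rule ell2_eqI) (simp add: coord_single)
    show E_add: "E i j (x + y) = E i j x + E i j y" for x y
      by (simp add: E_def single_add P_add)
    have E_R: "E i j (r *\<^sub>R x) = r *\<^sub>R E i j x" for r x
    proof -
      have "single j (r *\<^sub>R x) = r *\<^sub>R single j x" by (rule ell2_eqI) (simp add: coord_single)
      then show ?thesis by (simp add: E_def P_scaleR)
    qed
    have E_J: "E i j (\<i> *\<^sub>C x) = \<i> *\<^sub>C E i j x" for x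
    proof -
      have "single j (\<i> *\<^sub>C x) = J (single j x)" by (rule ell2_eqI) (simp add: coord_single J_def)
      then show ?thesis by (simp add: E_def PJ) (simp add: J_def)
    qed
    show "E i j (c *\<^sub>C x) = c *\<^sub>C E i j x" for c x
    proof -
      have c: "c *\<^sub>C y = Re c *\<^sub>R y + Im c *\<^sub>R (\<i> *\<^sub>C y)" for y :: 'h
      proof -
        have "c = complex_of_real (Re c) + complex_of_real (Im c) * \<i>"
          by (simp add: complex_eq mult.commute)
        then have "c *\<^sub>C y = (complex_of_real (Re c) + complex_of_real (Im c) * \<i>) *\<^sub>C y" by metis
        then show ?thesis by (simp add: scaleC_add_left scaleC_scaleC[symmetric] scaleC_of_real)
      qed
      show ?thesis unfolding c by (simp add: E_add E_R E_J)
    qed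
    show "norm (E i j x) \<le> 1 * norm x" for x
      using norm_coord_le[of "P (single j x)" i] P_norm[of "single j x"] by (simp add: E_def norm_single)
  qed
  then obtain Q where Q: "\<And>i j h. bop_apply (Q i j) h = E i j h" by metis
  have single_ampl: "single j (bop_apply S h) = ampl S (single j h)" for j S h
    by (rule ell2_eqI) (simp add: coord_single)
  have "Q i j \<in> commutant {X}" for i j
    by (auto simp: commutant_def Q E_def single_ampl PX intro!: bop_eqI)
  then have TQ: "T * Q i j = Q i j * T" for i j using T by (auto simp: commutant_def)
  have P_coord: "(\<lambda>j. bop_apply (Q i j) (coord y j)) sums coord (P y) i" for i y
    using bounded_linear.sums[OF bounded_linear_compose[OF bounded_linear_coord P_bl] ell2_sums_single[of y]]
    by (simp add: Q E_def)
  have "P (ampl T y) = ampl T (P y)" for y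
  proof (rule ell2_eqI)
    fix i
    have "(\<lambda>j. bop_apply T (bop_apply (Q i j) (coord y j))) sums bop_apply T (coord (P y) i)"
      by (rule bounded_linear.sums[OF bounded_linear_bop_apply P_coord])
    moreover have "bop_apply T (bop_apply (Q i j) h) = bop_apply (Q i j) (bop_apply T h)" for j h
      using TQ[of i j] by (metis bop_apply_simps(6))
    ultimately have "(\<lambda>j. bop_apply (Q i j) (bop_apply T (coord y j))) sums bop_apply T (coord (P y) i)"
      by simp
    moreover have "(\<lambda>j. bop_apply (Q i j) (bop_apply T (coord y j))) sums coord (P (ampl T y)) i"
      using P_coord[of i "ampl T y"] by simp
    ultimately show "coord (P (ampl T y)) i = coord (ampl T (P y)) i"
      using sums_unique2 by fastforce
  qed
  moreover have "P \<xi> = \<xi>"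
  proof (rule P_eq)
    have "\<xi> \<in> K0" using alg(1) by (auto simp: K0_def image_iff ampl_simps intro!: bexI[of _ 1])
    then show "\<xi> \<in> K" unfolding K_def using closure_subset by blast
  qed simp
  ultimately have "ampl T \<xi> \<in> K" using P(1) by metis
  then obtain x where "x \<in> K0" "dist x (ampl T \<xi>) < e"
    using \<open>0 < e\<close> unfolding K_def closure_approachable by blast
  then show ?thesis by (auto simp: K0_def ampl_simps dist_norm norm_minus_commute)
qed

section \<open>Von Neumann algebras and normal functionals\<close>

lemma commutant_closed:
  shows "1 \<in> commutant S" "0 \<in> commutant S"
    "A \<in> commutant S \<Longrightarrow> B \<in> commutant S \<Longrightarrow> A + B \<in> commutant S"
    "A \<in> commutant S \<Longrightarrow> B \<in> commutant S \<Longrightarrow> A * B \<in> commutant S"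
    "A \<in> commutant S \<Longrightarrow> c *\<^sub>C A \<in> commutant S"
    "closed (commutant S)"
proof -
  show "1 \<in> commutant S" "0 \<in> commutant S"
    "A \<in> commutant S \<Longrightarrow> B \<in> commutant S \<Longrightarrow> A + B \<in> commutant S"
    "A \<in> commutant S \<Longrightarrow> c *\<^sub>C A \<in> commutant S"
    by (auto simp: commutant_def distrib_left distrib_right)
  show "A \<in> commutant S \<Longrightarrow> B \<in> commutant S \<Longrightarrow> A * B \<in> commutant S"
    unfolding commutant_def mem_Collect_eq by (metis mult.assoc)
  have "commutant S = (\<Inter>A\<in>S. {T. T * A = A * T})" by (auto simp: commutant_def)
  moreover have "closed {T. T * A = A * T}" for A :: "'a bop"
    by (intro closed_Collect_eq continuous_intros)
  ultimately show "closed (commutant S)" by (simp add: closed_INT)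
qed

lemma commutant_antimono: "S \<subseteq> T \<Longrightarrow> commutant T \<subseteq> commutant S"
  by (auto simp: commutant_def)

lemma subset_double_commutant: "S \<subseteq> commutant (commutant S)"
  by (auto simp: commutant_def)

lemma adj_commutant:
  assumes "\<And>A. A \<in> S \<Longrightarrow> adj A \<in> S" "T \<in> commutant S"
  shows "adj T \<in> commutant S"
  unfolding commutant_def
proof (clarify)
  fix A assume "A \<in> S"
  then have "adj (T * adj A) = adj (adj A * T)" using assms by (auto simp: commutant_def)
  then show "adj T * A = A * adj T" by (simp add: adj_mult)
qed

lemma von_neumann_algebra_commutant:
  assumes "\<And>A. A \<in> S \<Longrightarrow> adj A \<in> S"
  shows "von_neumann_algebra (commutant S)"
proof -
  have "commutant (commutant (commutant S)) = commutant S"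
    using subset_double_commutant[of S] subset_double_commutant[of "commutant S"] commutant_antimono
    by blast
  then show ?thesis using adj_commutant[OF assms] by (auto simp: von_neumann_algebra_def)
qed

lemma vn_generated_subset: "von_neumann_algebra N \<Longrightarrow> X \<in> N \<Longrightarrow> vn_generated X \<subseteq> N"
  by (auto simp: vn_generated_def)

lemma vn_generated_subset_double_commutant:
  assumes "adj X = X"
  shows "vn_generated X \<subseteq> commutant (commutant {X})"
proof (rule vn_generated_subset)
  show "von_neumann_algebra (commutant (commutant {X}))"
    by (intro von_neumann_algebra_commutant adj_commutant) (use assms in auto)
  show "X \<in> commutant (commutant {X})" using subset_double_commutant by blast
qed

lemma von_neumann_algebra_closed:
  assumes "von_neumann_algebra N"
  shows "1 \<in> N" "A \<in> N \<Longrightarrow> B \<in> N \<Longrightarrow> A + B \<in> N" "A \<in> N \<Longrightarrow> B \<in> N \<Longrightarrow> A * B \<in> N"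
    "A \<in> N \<Longrightarrow> c *\<^sub>C A \<in> N" "closed N"
  using commutant_closed[where S = "commutant N"] assms by (simp_all add: von_neumann_algebra_def)

lemma vn_generated_closed:
  shows "1 \<in> vn_generated X" "X \<in> vn_generated X"
    "A \<in> vn_generated X \<Longrightarrow> B \<in> vn_generated X \<Longrightarrow> A + B \<in> vn_generated X"
    "A \<in> vn_generated X \<Longrightarrow> B \<in> vn_generated X \<Longrightarrow> A * B \<in> vn_generated X"
    "A \<in> vn_generated X \<Longrightarrow> c *\<^sub>C A \<in> vn_generated X"
    "A \<in> vn_generated X \<Longrightarrow> adj A \<in> vn_generated X" "closed (vn_generated X)"
  unfolding vn_generated_def
  by (auto simp: von_neumann_algebra_closed von_neumann_algebra_def
      intro: von_neumann_algebra_closed)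

text \<open>Even coordinates of \<theta> carry \<xi>, odd ones carry \<zeta>. Two seminorms are
  thereby dominated by one, which handles intersections of neighbourhoods.\<close>

lemma interleave_ell2:
  fixes \<xi> \<zeta> :: "'h::complex_hilbert ell2"
  shows "\<exists>\<theta>. \<forall>T. norm (ampl T \<xi>) \<le> norm (ampl T \<theta>) \<and> norm (ampl T \<zeta>) \<le> norm (ampl T \<theta>)"
proof -
  define w where "w k = (if even k then coord \<xi> (k div 2) else coord \<zeta> (k div 2))" for k
  have even_odd: "(\<Sum>j<2 * n. f j) = (\<Sum>k<n. f (2 * k)) + (\<Sum>k<n. f (Suc (2 * k)))"
    for f :: "nat \<Rightarrow> real" and n
    by (induction n) simp_all
  have "summable (\<lambda>k. (norm (w k))\<^sup>2)"
  proof (rule summableI_nonneg_bounded)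
    fix n
    have "(\<Sum>k<n. (norm (w k))\<^sup>2) \<le> (\<Sum>k<2 * n. (norm (w k))\<^sup>2)"
      by (rule sum_mono2) auto
    also have "\<dots> \<le> (norm \<xi>)\<^sup>2 + (norm \<zeta>)\<^sup>2"
      using sum_norm_coord_le[of \<xi> n] sum_norm_coord_le[of \<zeta> n] by (simp add: even_odd w_def)
    finally show "(\<Sum>k<n. (norm (w k))\<^sup>2) \<le> (norm \<xi>)\<^sup>2 + (norm \<zeta>)\<^sup>2" .
  qed simp
  then have c: "coord (Ell2 w) = w" by (simp add: Ell2_inverse)
  have *: "(\<Sum>k<n. (norm (coord (ampl T \<xi>) k))\<^sup>2) + (\<Sum>k<n. (norm (coord (ampl T \<zeta>) k))\<^sup>2)
      \<le> (norm (ampl T (Ell2 w)))\<^sup>2" for n T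
    using sum_norm_coord_le[of "ampl T (Ell2 w)" "2 * n"] by (simp add: even_odd c w_def)
  have nn: "0 \<le> (\<Sum>k<n. (norm (coord x k))\<^sup>2)" for n and x :: "'h ell2" by (rule sum_nonneg) simp
  have "norm (ampl T \<xi>) \<le> norm (ampl T (Ell2 w))" for T
  proof (rule norm_ell2_leI)
    show "(\<Sum>k<n. (norm (coord (ampl T \<xi>) k))\<^sup>2) \<le> (norm (ampl T (Ell2 w)))\<^sup>2" for n
      using *[of T n] nn[of "ampl T \<zeta>" n] by linarith
  qed simp
  moreover have "norm (ampl T \<zeta>) \<le> norm (ampl T (Ell2 w))" for T
  proof (rule norm_ell2_leI)
    show "(\<Sum>k<n. (norm (coord (ampl T \<zeta>) k))\<^sup>2) \<le> (norm (ampl T (Ell2 w)))\<^sup>2" for n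
      using *[of T n] nn[of "ampl T \<xi>" n] by linarith
  qed simp
  ultimately show ?thesis by blast
qed

text \<open>The factor 2 arises because real and imaginary parts are bounded separately, each by the
  real Cauchy-Schwarz inequality on \<open>ell2\<close>.\<close>

lemma cmod_suminf_cinner_le:
  fixes \<xi> \<zeta> :: "'h::complex_hilbert ell2"
  shows "cmod (\<Sum>k. cinner (bop_apply T (coord \<xi> k)) (coord \<zeta> k)) \<le> 2 * norm (ampl T \<xi>) * norm \<zeta>"
proof -
  let ?c = "\<lambda>k. cinner (bop_apply T (coord \<xi> k)) (coord \<zeta> k)"
  have "summable ?c"
  proof (rule summable_comparison_test')
    show "summable (\<lambda>k. (norm (coord (ampl T \<xi>) k))\<^sup>2 + (norm (coord \<zeta> k))\<^sup>2)"
      by (intro summable_add summable_norm_coord)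
    fix k
    show "norm (?c k) \<le> (norm (coord (ampl T \<xi>) k))\<^sup>2 + (norm (coord \<zeta> k))\<^sup>2"
      using cmod_cinner_le[of "coord (ampl T \<xi>) k" "coord \<zeta> k"]
        sum_squares_bound[of "norm (coord (ampl T \<xi>) k)" "norm (coord \<zeta> k)"]
        zero_le_power2[of "norm (coord (ampl T \<xi>) k)"] zero_le_power2[of "norm (coord \<zeta> k)"]
      unfolding coord_ampl by linarith
  qed
  then have re: "Re (suminf ?c) = inner (ampl T \<xi>) \<zeta>"
    by (simp add: bounded_linear.suminf[OF bounded_linear_Re] Re_cinner inner_ell2_def)
  have "Im (suminf ?c) = (\<Sum>k. - inner (coord (ampl (\<i> *\<^sub>C T) \<xi>) k) (coord \<zeta> k))"
    by (simp add: bounded_linear.suminf[OF bounded_linear_Im \<open>summable ?c\<close>] inner_scaleC_ii)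
  also have "\<dots> = - inner (ampl (\<i> *\<^sub>C T) \<xi>) \<zeta>"
    unfolding inner_ell2_def by (intro suminf_minus summable_inner summable_norm_coord)
  finally have im: "Im (suminf ?c) = - inner (ampl (\<i> *\<^sub>C T) \<xi>) \<zeta>" .
  have "norm (ampl (\<i> *\<^sub>C T) \<xi>) \<le> norm (ampl T \<xi>)"
    by (rule norm_ell2_leI) (use sum_norm_coord_le[of "ampl T \<xi>"] in \<open>auto simp: norm_scaleC\<close>)
  then have "\<bar>Im (suminf ?c)\<bar> \<le> norm (ampl T \<xi>) * norm \<zeta>"
    unfolding im abs_minus_cancel by (metis Cauchy_Schwarz_ineq2 mult_right_mono norm_ge_zero order_trans)
  moreover have "\<bar>Re (suminf ?c)\<bar> \<le> norm (ampl T \<xi>) * norm \<zeta>"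
    unfolding re by (rule Cauchy_Schwarz_ineq2)
  ultimately show ?thesis using cmod_le[of "suminf ?c"] by linarith
qed

text \<open>Passes from ultraweak neighbourhoods to the finer seminorms
  \<open>norm (ampl T \<xi>)\<close>, by induction over the generation of the topology. In these
  seminorms a right factor of \<open>T\<close> can be moved into the vector.\<close>

lemma ultraweak_neighbourhood:
  fixes W :: "'h::complex_hilbert bop set"
  assumes "openin ultraweak_topology W" "0 \<in> W"
  shows "\<exists>\<xi>::'h ell2. \<forall>T. norm (ampl T \<xi>) < 1 \<longrightarrow> T \<in> W"
proof -
  have "generate_topology_on
     {{T. (\<Sum>k. cinner (bop_apply T (\<xi> k)) (\<zeta> k)) \<in> S} | \<xi> \<zeta> S.
        summable (\<lambda>k::nat. (norm (\<xi> k :: 'h))\<^sup>2) \<and> summable (\<lambda>k. (norm (\<zeta> k))\<^sup>2) \<and> open S} W"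
    using assms(1) by (simp add: ultraweak_topology_def openin_topology_generated_by_iff)
  then show ?thesis using assms(2)
  proof (induction rule: generate_topology_on.induct)
    case (Int A B)
    then obtain \<xi> \<zeta> :: "'h ell2" where *: "\<And>T. norm (ampl T \<xi>) < 1 \<Longrightarrow> T \<in> A"
        "\<And>T. norm (ampl T \<zeta>) < 1 \<Longrightarrow> T \<in> B" by blast
    obtain \<theta> where "\<And>T. norm (ampl T \<xi>) \<le> norm (ampl T \<theta>)" "\<And>T. norm (ampl T \<zeta>) \<le> norm (ampl T \<theta>)"
      using interleave_ell2[of \<xi> \<zeta>] by blast
    then show ?case using * by (meson IntI le_less_trans)
  next
    case (UN \<K>)
    then show ?case by blast
  next
    case (Basis A)
    then obtain x y and S :: "complex set"
      where A: "A = {T. (\<Sum>k. cinner (bop_apply T (x k)) (y k)) \<in> S}"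
        and s: "summable (\<lambda>k::nat. (norm (x k :: 'h))\<^sup>2)" "summable (\<lambda>k. (norm (y k))\<^sup>2)" "open S"
      by blast
    define \<xi> \<zeta> where "\<xi> = Ell2 x" "\<zeta> = Ell2 y"
    have c: "coord \<xi> = x" "coord \<zeta> = y" using s by (simp_all add: \<xi>_\<zeta>_def Ell2_inverse)
    have "0 \<in> S" using Basis(2) by (simp add: A)
    then obtain e where e: "0 < e" "ball 0 e \<subseteq> S" using s(3) open_contains_ball by blast
    \<comment> \<open>Chosen so that \<open>norm (ampl T (r *\<^sub>R \<xi>)) < 1\<close> makes the
      pairing smaller than \<open>e\<close>; the summand 1 keeps \<open>r\<close> positive when
      \<zeta> is 0.\<close>
    define r where "r = 2 * (norm \<zeta> + 1) / e"
    have r: "0 < r" using e(1) by (simp add: r_def add_nonneg_pos)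
    have "T \<in> A" if "norm (ampl T (r *\<^sub>R \<xi>)) < 1" for T
    proof -
      have "r * norm (ampl T \<xi>) < 1"
        using that r by (simp add: linear_cmul[OF bounded_linear.linear[OF bounded_linear_ampl]])
      then have "2 * norm (ampl T \<xi>) * (norm \<zeta> + 1) < e"
        using e(1) by (simp add: r_def field_simps)
      then have "2 * norm (ampl T \<xi>) * norm \<zeta> < e"
        using norm_ge_zero[of "ampl T \<xi>"] unfolding distrib_left by linarith
      then have "cmod (\<Sum>k. cinner (bop_apply T (x k)) (y k)) < e"
        using cmod_suminf_cinner_le[of T \<xi> \<zeta>] by (simp add: c)
      then show ?thesis using e(2) by (auto simp: A)
    qed
    then show ?case by blast
  qed simp
qed

text \<open>Continuity at 0 bounds \<phi> by 1 on the unit ball of one seminorm, and homogeneity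
  extends the bound to all of \<open>M\<close>.\<close>

lemma normal_on_bound:
  fixes M :: "'h::complex_hilbert bop set"
  assumes M: "von_neumann_algebra M" and \<phi>: "state_on M \<phi>" "normal_on M \<phi>"
  shows "\<exists>\<xi>::'h ell2. \<forall>T\<in>M. cmod (\<phi> T) \<le> norm (ampl T \<xi>)"
proof -
  note Mc = von_neumann_algebra_closed[OF M]
  have sc: "\<phi> (c *\<^sub>C T) = c * \<phi> T" if "T \<in> M" for c T using \<phi>(1) that by (simp add: state_on_def)
  have M0: "0 \<in> M" using Mc(4)[OF Mc(1), of 0] by simp
  have \<phi>0: "\<phi> 0 = 0" using sc[OF Mc(1), of 0] by simp
  let ?t = "subtopology ultraweak_topology M"
  have "openin ?t {T \<in> topspace ?t. \<phi> T \<in> ball 0 1}"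
    using \<phi>(2) unfolding normal_on_def continuous_map by (auto dest: spec[of _ "ball 0 1"])
  then obtain W where W: "openin ultraweak_topology W" "{T \<in> topspace ?t. \<phi> T \<in> ball 0 1} = W \<inter> M"
    by (auto simp: openin_subtopology)
  have "0 \<in> topspace (ultraweak_topology :: 'h bop topology)"
    unfolding ultraweak_topology_def topology_generated_by_topspace
    by (rule UnionI[of "{T. (\<Sum>k::nat. cinner (bop_apply T (0::'h)) 0) \<in> UNIV}"])
      (auto intro!: exI[of _ "\<lambda>_. 0"] exI[of _ UNIV])
  then have "0 \<in> {T \<in> topspace ?t. \<phi> T \<in> ball 0 1}" using M0 \<phi>0 by simp
  then have "0 \<in> W" unfolding W(2) by simp
  then obtain \<xi> :: "'h ell2" where \<xi>: "\<And>T. norm (ampl T \<xi>) < 1 \<Longrightarrow> T \<in> W"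
    using ultraweak_neighbourhood[OF W(1)] by blast
  have "cmod (\<phi> T) \<le> norm (ampl T \<xi>)" if T: "T \<in> M" for T
  proof (rule field_le_epsilon)
    fix e :: real assume "0 < e"
    \<comment> \<open>The extra \<open>e\<close> permits division by \<open>t\<close> even if
      \<open>ampl T \<xi>\<close> vanishes.\<close>
    define t where "t = norm (ampl T \<xi>) + e"
    have t: "0 < t" using \<open>0 < e\<close> by (simp add: t_def add_nonneg_pos)
    have "ampl (complex_of_real (inverse t) *\<^sub>C T) \<xi> = inverse t *\<^sub>R ampl T \<xi>"
      by (rule ell2_eqI) (simp only: coord_ampl bop_apply_simps coord_simps scaleC_of_real)
    then have "norm (ampl (complex_of_real (inverse t) *\<^sub>C T) \<xi>) = norm (ampl T \<xi>) / t"
      using t by (simp add: field_simps)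
    also have "\<dots> < 1" using t \<open>0 < e\<close> by (simp add: t_def)
    finally have "complex_of_real (inverse t) *\<^sub>C T \<in> W \<inter> M" using \<xi> Mc(4)[OF T] by blast
    then have "cmod (\<phi> (complex_of_real (inverse t) *\<^sub>C T)) < 1" unfolding W(2)[symmetric] by simp
    then have "cmod (\<phi> T) / t < 1"
      unfolding sc[OF T] norm_mult norm_of_real using t by (simp add: divide_inverse mult.commute)
    then show "cmod (\<phi> T) \<le> norm (ampl T \<xi>) + e" using t by (simp add: t_def)
  qed
  then show ?thesis by blast
qed

section \<open>Extending identities from polynomials to the double commutant\<close>

section \<open>Functionals and the subalgebra they generate\<close>

text \<open>The setting of the algebraic part. The bound \<open>bd\<close> is a parameter because
  normality supplies it as the norm of a vector of \<open>ell2\<close>.\<close>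

locale tracial_functional =
  fixes M :: "'h::complex_hilbert bop set" and \<phi> :: "'h bop \<Rightarrow> complex" and bd :: real
  assumes one_mem [simp]: "1 \<in> M"
    and add_mem [simp]: "a \<in> M \<Longrightarrow> b \<in> M \<Longrightarrow> a + b \<in> M"
    and mult_mem [simp]: "a \<in> M \<Longrightarrow> b \<in> M \<Longrightarrow> a * b \<in> M"
    and scaleC_mem [simp]: "a \<in> M \<Longrightarrow> c *\<^sub>C a \<in> M"
    and closed_M: "closed M"
    and \<phi>_add [simp]: "a \<in> M \<Longrightarrow> b \<in> M \<Longrightarrow> \<phi> (a + b) = \<phi> a + \<phi> b"
    and \<phi>_scaleC [simp]: "a \<in> M \<Longrightarrow> \<phi> (c *\<^sub>C a) = c * \<phi> a"
    and \<phi>_one [simp]: "\<phi> 1 = 1"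
    and \<phi>_bounded: "a \<in> M \<Longrightarrow> cmod (\<phi> a) \<le> bd * norm a"
    and \<phi>_trace: "a \<in> M \<Longrightarrow> b \<in> M \<Longrightarrow> \<phi> (a * b) = \<phi> (b * a)"
begin

lemma mem_simps [simp]:
  shows "0 \<in> M" "a \<in> M \<Longrightarrow> - a \<in> M" "a \<in> M \<Longrightarrow> b \<in> M \<Longrightarrow> a - b \<in> M" "a \<in> M \<Longrightarrow> a ^ n \<in> M"
proof -
  show "0 \<in> M" using scaleC_mem[OF one_mem, of 0] by simp
  show n: "a \<in> M \<Longrightarrow> - a \<in> M" for a using scaleC_mem[of a "-1"] by simp
  show "a \<in> M \<Longrightarrow> b \<in> M \<Longrightarrow> a - b \<in> M" using add_mem[of a "- b"] n by simp
  show "a \<in> M \<Longrightarrow> a ^ n \<in> M" by (induction n) auto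
qed

lemma \<phi>_simps [simp]:
  shows "\<phi> 0 = 0" "a \<in> M \<Longrightarrow> \<phi> (- a) = - \<phi> a" "a \<in> M \<Longrightarrow> b \<in> M \<Longrightarrow> \<phi> (a - b) = \<phi> a - \<phi> b"
proof -
  show "\<phi> 0 = 0" using \<phi>_scaleC[OF one_mem, of 0] by simp
  show n: "a \<in> M \<Longrightarrow> \<phi> (- a) = - \<phi> a" for a using \<phi>_scaleC[of a "-1"] by simp
  show "a \<in> M \<Longrightarrow> b \<in> M \<Longrightarrow> \<phi> (a - b) = \<phi> a - \<phi> b" using \<phi>_add[of a "- b"] n by simp
qed

lemma bd_ge_one: "1 \<le> bd"
  using \<phi>_bounded[OF one_mem] by simp

lemma sum_mem [simp]: "(\<And>i. i \<in> I \<Longrightarrow> x i \<in> M) \<Longrightarrow> sum x I \<in> M"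
  by (induction I rule: infinite_finite_induct) auto

lemma \<phi>_sum: "(\<And>i. i \<in> I \<Longrightarrow> x i \<in> M) \<Longrightarrow> \<phi> (sum x I) = (\<Sum>i\<in>I. \<phi> (x i))"
  by (induction I rule: infinite_finite_induct) auto

lemma sums_mem:
  assumes "x sums s" "\<And>n. x n \<in> M"
  shows "s \<in> M"
  using closed_sequentially[OF closed_M] assms unfolding sums_def by (metis sum_mem)

lemma \<phi>_sums:
  assumes "x sums s" "\<And>n. x n \<in> M"
  shows "(\<lambda>n. \<phi> (x n)) sums \<phi> s"
proof -
  have s: "s \<in> M" by (rule sums_mem[OF assms])
  have "(\<lambda>n. norm ((\<Sum>i<n. x i) - s)) \<longlonglongrightarrow> 0"
    using assms(1) by (simp add: sums_def tendsto_norm_zero_iff LIM_zero)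
  then have "(\<lambda>n. bd * norm ((\<Sum>i<n. x i) - s)) \<longlonglongrightarrow> 0"
    using tendsto_mult_right_zero by blast
  then have "(\<lambda>n. (\<Sum>i<n. \<phi> (x i)) - \<phi> s) \<longlonglongrightarrow> 0"
  proof (rule Lim_null_comparison[rotated], intro always_eventually allI)
    fix n
    have "(\<Sum>i<n. \<phi> (x i)) - \<phi> s = \<phi> ((\<Sum>i<n. x i) - s)"
      using assms(2) s by (simp add: \<phi>_sum)
    also have "norm \<dots> \<le> bd * norm ((\<Sum>i<n. x i) - s)"
      using assms(2) s by (intro \<phi>_bounded) auto
    finally show "norm ((\<Sum>i<n. \<phi> (x i)) - \<phi> s) \<le> bd * norm ((\<Sum>i<n. x i) - s)" .
  qed
  then show ?thesis by (simp add: sums_def LIM_zero_iff)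
qed

text \<open>The bipolar of the powers of \<open>X\<close> under the pairing \<open>(a, c) \<mapsto> \<phi> (a * c)\<close>: it replaces
  the von Neumann algebra generated by \<open>X\<close>, and freeness of polynomials extends to it without
  any approximation.\<close>

definition bipolar :: "'h bop \<Rightarrow> 'h bop set" where
  "bipolar X = {T\<in>M. \<forall>c\<in>M. (\<forall>k. \<phi> (X ^ k * c) = 0) \<longrightarrow> \<phi> (T * c) = 0}"

lemma bipolar_mem [simp]: "T \<in> bipolar X \<Longrightarrow> T \<in> M"
  by (simp add: bipolar_def)

lemma bipolarD:
  "T \<in> bipolar X \<Longrightarrow> c \<in> M \<Longrightarrow> (\<And>k. \<phi> (X ^ k * c) = 0) \<Longrightarrow> \<phi> (T * c) = 0"
  unfolding bipolar_def by blast

lemma bipolarI: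
  "T \<in> M \<Longrightarrow> (\<And>c. c \<in> M \<Longrightarrow> (\<And>k. \<phi> (X ^ k * c) = 0) \<Longrightarrow> \<phi> (T * c) = 0) \<Longrightarrow> T \<in> bipolar X"
  unfolding bipolar_def by blast

text \<open>The product is the case with content. If \<open>c\<close> is annihilated by all powers
  of \<open>X\<close>, then so is each \<open>X ^ k * c\<close>, hence
  \<open>\<phi> (S * (X ^ k * c)) = 0\<close>. The trace turns this into the statement that
  \<open>c * S\<close> is annihilated by all powers, and \<open>T\<close> can be applied to
  it.\<close>

lemma bipolar_closed:
  assumes "X \<in> M"
  shows "1 \<in> bipolar X" "X \<in> bipolar X"
    "S \<in> bipolar X \<Longrightarrow> T \<in> bipolar X \<Longrightarrow> S + T \<in> bipolar X"
    "S \<in> bipolar X \<Longrightarrow> c *\<^sub>C S \<in> bipolar X"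
    "S \<in> bipolar X \<Longrightarrow> T \<in> bipolar X \<Longrightarrow> S * T \<in> bipolar X"
proof -
  show "1 \<in> bipolar X"
  proof (rule bipolarI)
    show "\<phi> (1 * c) = 0" if "\<And>k. \<phi> (X ^ k * c) = 0" for c using that[of 0] by simp
  qed simp
  show "X \<in> bipolar X"
  proof (rule bipolarI)
    show "\<phi> (X * c) = 0" if "\<And>k. \<phi> (X ^ k * c) = 0" for c using that[of 1] by simp
  qed (rule assms)
  show "S \<in> bipolar X \<Longrightarrow> T \<in> bipolar X \<Longrightarrow> S + T \<in> bipolar X"
    by (rule bipolarI) (simp_all add: distrib_right bipolarD)
  show "S \<in> bipolar X \<Longrightarrow> c *\<^sub>C S \<in> bipolar X"
    by (rule bipolarI) (simp_all add: bipolarD)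
  assume S: "S \<in> bipolar X" and T: "T \<in> bipolar X"
  show "S * T \<in> bipolar X"
  proof (rule bipolarI)
    show "S * T \<in> M" using S T by simp
    fix c assume c: "c \<in> M" and 0: "\<And>k. \<phi> (X ^ k * c) = 0"
    have "\<phi> (X ^ k * (c * S)) = 0" for k
    proof -
      have "\<phi> (X ^ j * (X ^ k * c)) = 0" for j
        using 0[of "j + k"] by (simp add: power_add mult.assoc)
      then have "\<phi> (S * (X ^ k * c)) = 0" using S c assms by (simp add: bipolarD)
      then show ?thesis
        using \<phi>_trace[of S "X ^ k * c"] S c assms by (simp add: mult.assoc)
    qed
    then have "\<phi> (T * (c * S)) = 0" using T S c by (simp add: bipolarD)
    then show "\<phi> (S * T * c) = 0"
      using \<phi>_trace[of S "T * c"] S T c by (simp add: mult.assoc)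
  qed
qed

lemma bipolar_diff:
  assumes "X \<in> M" "S \<in> bipolar X" "T \<in> bipolar X"
  shows "S - T \<in> bipolar X"
  using bipolar_closed(3)[OF assms(1,2) bipolar_closed(4)[OF assms(1,3), of "-1"]] by simp

lemma bipolar_power: "X \<in> M \<Longrightarrow> S \<in> bipolar X \<Longrightarrow> S ^ n \<in> bipolar X"
  by (induction n) (auto intro: bipolar_closed)

lemma bipolar_sums:
  assumes "X \<in> M" "x sums s" "\<And>n. x n \<in> bipolar X"
  shows "s \<in> bipolar X"
proof (rule bipolarI)
  show "s \<in> M" by (rule sums_mem[OF assms(2) bipolar_mem[OF assms(3)]])
  fix c assume c: "c \<in> M" "\<And>k. \<phi> (X ^ k * c) = 0"
  have "(\<lambda>n. \<phi> (x n * c)) sums \<phi> (s * c)"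
    using assms(2) c bipolar_mem[OF assms(3)]
    by (intro \<phi>_sums bounded_linear.sums[OF bounded_linear_mult_left]) auto
  moreover have "\<phi> (x n * c) = 0" for n using assms(3)[of n] c by (rule bipolarD)
  ultimately show "\<phi> (s * c) = 0" by (simp add: sums_0 sums_unique2)
qed

end

text \<open>In the bound of \<open>\<phi> ((T - S) * c)\<close> the factor \<open>c\<close> moves
  into the vector, so a polynomial \<open>S\<close> close to \<open>T\<close> at the one vector
  \<open>ampl c \<xi>\<close> is enough; \<open>S\<close> may depend on \<open>c\<close> and its
  norm is not controlled.\<close>

theorem wstar_tracial_functional:
  fixes M :: "'h::complex_hilbert bop set"
  assumes "wstar_probability_space M \<phi>"
  shows "\<exists>bd. tracial_functional M \<phi> bd \<and>
    (\<forall>X\<in>M. adj X = X \<longrightarrow> commutant (commutant {X}) \<subseteq> tracial_functional.bipolar M \<phi> X)"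
proof -
  have M: "von_neumann_algebra M" and \<phi>: "state_on M \<phi>" "normal_on M \<phi>"
    and tr: "\<And>a b. a \<in> M \<Longrightarrow> b \<in> M \<Longrightarrow> \<phi> (a * b) = \<phi> (b * a)"
    using assms by (auto simp: wstar_probability_space_def finite_von_neumann_algebra_def)
  obtain \<xi> :: "'h ell2" where \<xi>: "\<And>T. T \<in> M \<Longrightarrow> cmod (\<phi> T) \<le> norm (ampl T \<xi>)"
    using normal_on_bound[OF M \<phi>] by blast
  have bd: "cmod (\<phi> T) \<le> norm \<xi> * norm T" if "T \<in> M" for T
    using \<xi>[OF that] norm_ampl_le[of T \<xi>] by (simp add: mult.commute)
  interpret tracial_functional M \<phi> "norm \<xi>"
    by unfold_locales (use M von_neumann_algebra_closed \<phi>(1) tr bd in \<open>auto simp: state_on_def\<close>)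
  have "T \<in> bipolar X" if X: "X \<in> M" "adj X = X" and T: "T \<in> commutant (commutant {X})" for X T
  proof (rule bipolarI)
    have "commutant M \<subseteq> commutant {X}" using X(1) by (auto simp: commutant_def)
    then show TM: "T \<in> M" using T M commutant_antimono unfolding von_neumann_algebra_def by blast
    fix c assume c: "c \<in> M" "\<And>k. \<phi> (X ^ k * c) = 0"
    have "cmod (\<phi> (T * c)) \<le> e" if e: "0 < e" for e
    proof -
      obtain S where S: "S \<in> unital_algebra_generated X" "norm (ampl (T - S) (ampl c \<xi>)) < e"
        using double_commutant_approximation[OF X(2) T e] by blast
      obtain n d where Sn: "S = (\<Sum>k\<le>n. d k *\<^sub>C X ^ k)"
        using S(1) unfolding unital_algebra_generated_def by blast
      have SM: "S \<in> M" unfolding Sn using X(1) by simp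
      have "\<phi> (S * c) = 0"
        unfolding Sn sum_distrib_right using X(1) c by (simp add: \<phi>_sum)
      then have "\<phi> (T * c) = \<phi> ((T - S) * c)" using TM SM c by (simp add: left_diff_distrib)
      also have "cmod \<dots> \<le> norm (ampl ((T - S) * c) \<xi>)" using TM SM c by (intro \<xi>) auto
      finally show ?thesis using S(2) by (simp add: ampl_simps(2))
    qed
    then show "\<phi> (T * c) = 0"
      by (metis dense_ge norm_le_zero_iff)
  qed
  then show ?thesis using tracial_functional_axioms by blast
qed

section \<open>Spectral theory: functions of \<open>X\<close> lie in the double commutant of
  \<open>X\<close>\<close>

section \<open>Projection-valued measures and functional calculus\<close>

locale pvm =
  fixes E :: "real set \<Rightarrow> 'h::complex_hilbert bop"
  assumes pvm: "projection_valued_measure E"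
begin

lemma adj_E: "B \<in> sets borel \<Longrightarrow> adj (E B) = E B"
  and E_idem: "B \<in> sets borel \<Longrightarrow> E B * E B = E B"
  and E_UNIV: "E UNIV = 1"
  and E_sums: "range A \<subseteq> sets borel \<Longrightarrow> disjoint_family A \<Longrightarrow>
    (\<lambda>n::nat. bop_apply (E (A n)) x) sums bop_apply (E (\<Union>n. A n)) x"
  using pvm by (auto simp: projection_valued_measure_def)

text \<open>Additivity for a sequence of empty sets makes a constant series convergent, so its terms
  are 0.\<close>

lemma E_empty: "E {} = 0"
proof (rule bop_eqI)
  fix x
  have "(\<lambda>n::nat. bop_apply (E {}) x) sums bop_apply (E {}) x"
    using E_sums[of "\<lambda>_. {}" x] by (simp add: disjoint_family_on_def)
  then have "(\<lambda>n::nat. bop_apply (E {}) x) \<longlonglongrightarrow> 0"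
    using summable_LIMSEQ_zero sums_summable by blast
  then show "bop_apply (E {}) x = bop_apply 0 x"
    using LIMSEQ_unique tendsto_const by fastforce
qed

lemma E_Un:
  assumes "A \<in> sets borel" "B \<in> sets borel" "A \<inter> B = {}"
  shows "E (A \<union> B) = E A + E B"
proof (rule bop_eqI)
  fix x
  have "(\<lambda>n. bop_apply (E (binaryset A B n)) x) sums bop_apply (E (\<Union>n. binaryset A B n)) x"
    by (rule E_sums) (use assms in \<open>auto simp: range_binaryset_eq disjoint_family_on_def binaryset_def\<close>)
  moreover have "(\<lambda>n. bop_apply (E (binaryset A B n)) x) sums (bop_apply (E A) x + bop_apply (E B) x)"
    by (rule binaryset_sums) (simp add: E_empty)
  ultimately show "bop_apply (E (A \<union> B)) x = bop_apply (E A + E B) x"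
    by (simp add: UN_binaryset_eq sums_unique2)
qed

lemma E_Compl: "B \<in> sets borel \<Longrightarrow> E (- B) = 1 - E B"
  using E_Un[of B "- B"] E_UNIV by (simp add: Compl_partition algebra_simps borel_comp)

text \<open>The sum of the two projections is again idempotent.\<close>

lemma E_disjoint:
  assumes "A \<in> sets borel" "B \<in> sets borel" "A \<inter> B = {}"
  shows "E A * E B = 0"
proof -
  have "(E A + E B) * (E A + E B) = E A + E B"
    using E_idem[of "A \<union> B"] assms by (simp add: E_Un)
  then have *: "E A * E B = - (E B * E A)"
    using assms by (simp add: distrib_left distrib_right E_idem eq_neg_iff_add_eq_0 add.commute)
  have "E A * (E A * E B) = - (E A * (E B * E A))" "(E A * E B) * E A = - ((E B * E A) * E A)"
    by (simp_all add: *)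
  then have "E A * E B = - (E A * E B * E A)" "E A * E B * E A = - (E B * E A)"
    using assms by (metis E_idem mult.assoc)+
  then have "E A * E B = - (E A * E B)" using * by (metis minus_minus)
  then have "2 *\<^sub>R (E A * E B) = 0" by (simp only: scaleR_2 eq_neg_iff_add_eq_0)
  then show ?thesis by simp
qed

lemma E_Int:
  assumes [measurable]: "A \<in> sets borel" "B \<in> sets borel"
  shows "E A * E B = E (A \<inter> B)"
proof -
  have "A \<inter> B \<union> (A - B) = A" "A \<inter> B \<union> (B - A) = B"
    "A \<inter> B \<inter> (A - B) = {}" "A \<inter> B \<inter> (B - A) = {}" by blast+
  then have "E A = E (A \<inter> B) + E (A - B)" "E B = E (A \<inter> B) + E (B - A)"
    using E_Un[of "A \<inter> B" "A - B"] E_Un[of "A \<inter> B" "B - A"] by simp_all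
  moreover have "E (A \<inter> B) * E (B - A) = 0" "E (A - B) * E (A \<inter> B) = 0" "E (A - B) * E (B - A) = 0"
    by (rule E_disjoint; auto)+
  ultimately show ?thesis by (simp add: distrib_left distrib_right E_idem)
qed

lemma cinner_E:
  assumes "B \<in> sets borel"
  shows "cinner (bop_apply (E B) x) x = complex_of_real ((norm (bop_apply (E B) x))\<^sup>2)"
  using cinner_adj'[of "E B" "bop_apply (E B) x" x] assms E_idem[OF assms]
  by (metis adj_E bop_apply_simps(6) cinner_same)

lemma sets_pvm_measure [simp, measurable_cong]: "sets (pvm_measure E x) = sets borel"
  and space_pvm_measure [simp]: "space (pvm_measure E x) = UNIV"
  using sets.sigma_sets_eq[of "borel :: real measure"] by (simp_all add: pvm_measure_def)

lemma emeasure_pvm_measure: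
  assumes "B \<in> sets borel"
  shows "emeasure (pvm_measure E x) B = ennreal ((norm (bop_apply (E B) x))\<^sup>2)"
proof -
  have "emeasure (pvm_measure E x) B = ennreal (Re (cinner (bop_apply (E B) x) x))"
  proof (rule emeasure_measure_of[OF pvm_measure_def])
    show "positive (sets (pvm_measure E x)) (\<lambda>B. ennreal (Re (cinner (bop_apply (E B) x) x)))"
      by (simp add: positive_def E_empty)
    show "countably_additive (sets (pvm_measure E x)) (\<lambda>B. ennreal (Re (cinner (bop_apply (E B) x) x)))"
      unfolding countably_additive_def
    proof (intro allI impI)
      fix A :: "nat \<Rightarrow> real set"
      assume A: "range A \<subseteq> sets (pvm_measure E x)" "disjoint_family A" "\<Union> (range A) \<in> sets (pvm_measure E x)"
      have "(\<lambda>n. inner (bop_apply (E (A n)) x) x) sums inner (bop_apply (E (\<Union>n. A n)) x) x"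
        using A by (intro bounded_linear.sums[OF bounded_linear_inner_left] E_sums) auto
      moreover have "0 \<le> inner (bop_apply (E (A n)) x) x" for n
      proof -
        have "A n \<in> sets borel" using A(1) by auto
        then show ?thesis unfolding Re_cinner[symmetric] by (simp only: cinner_E Re_complex_of_real zero_le_power2)
      qed
      ultimately show "(\<Sum>i. ennreal (Re (cinner (bop_apply (E (A i)) x) x))) =
          ennreal (Re (cinner (bop_apply (E (\<Union> (range A))) x) x))"
        unfolding Re_cinner by (intro suminf_ennreal_eq)
    qed
  qed (use assms in \<open>auto\<close>)
  then show ?thesis using assms by (simp add: cinner_E)
qed

lemma measure_pvm_measure:
  "B \<in> sets borel \<Longrightarrow> measure (pvm_measure E x) B = (norm (bop_apply (E B) x))\<^sup>2"
  by (simp add: measure_def emeasure_pvm_measure)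

sublocale finite_measure "pvm_measure E x" for x
  by (rule finite_measureI) (simp add: emeasure_pvm_measure)

lemma AE_bounded:
  assumes "f \<in> borel_measurable borel" "E {t. C < cmod (f t)} = 0"
  shows "AE t in pvm_measure E x. cmod (f t) \<le> C"
proof (rule AE_I[where N = "{t. C < cmod (f t)}"])
  have [measurable]: "f \<in> borel_measurable borel" by fact
  show m: "{t. C < cmod (f t)} \<in> sets (pvm_measure E x)" by simp
  show "emeasure (pvm_measure E x) {t. C < cmod (f t)} = 0"
    using m by (simp add: emeasure_pvm_measure assms(2))
qed auto

text \<open>Simple functions give finite combinations of spectral projections, which inherit
  commutation relations. Dominated convergence yields weak convergence on the diagonal, polarization
  elsewhere.\<close>

lemma pvm_integral_approximation:
  assumes "has_pvm_integral E f T"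
  obtains S where "\<And>n x y. (\<lambda>n. cinner (bop_apply (S n) x) y) \<longlonglongrightarrow> cinner (bop_apply T x) y"
    "\<And>n A. (\<And>B. B \<in> sets borel \<Longrightarrow> A * E B = E B * A) \<Longrightarrow> A * S n = S n * A"
proof -
  obtain C where f: "f \<in> borel_measurable borel" and C: "E {t. C < cmod (f t)} = 0"
    and q: "\<And>x. cinner (bop_apply T x) x = (\<integral>t. f t \<partial>pvm_measure E x)"
    using assms by (auto simp: has_pvm_integral_def)
  \<comment> \<open>The approximation by simple functions costs a factor 2, hence the dominating
    constant \<open>2 * C\<close> below.\<close>
  obtain s where s: "\<And>n. simple_function borel (s n)" "\<And>t. (\<lambda>n. s n t) \<longlonglongrightarrow> f t"
      "\<And>n t. cmod (s n t) \<le> 2 * cmod (f t)"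
    using borel_measurable_implies_sequence_metric[OF f, of 0] by auto
  define S where "S n = (\<Sum>z\<in>range (s n). z *\<^sub>C E (s n -` {z}))" for n
  have fin: "finite (range (s n))" and meas: "s n -` {z} \<in> sets borel" for n z
    using s(1)[of n] by (auto simp: simple_function_def) (metis (no_types) borel_singleton inf_top.right_neutral measurable_sets
        measurable_simple_function s(1) sets.empty_sets space_borel insert_absorb2 UNIV_I sets_UNIV sets_count_space Pow_UNIV)
  have quad: "(\<lambda>n. cinner (bop_apply (S n) x) x) \<longlonglongrightarrow> cinner (bop_apply T x) x" for x
  proof -
    have int: "(\<integral>t. s n t \<partial>pvm_measure E x) = cinner (bop_apply (S n) x) x" for n
    proof -
      have ind: "s n t = (\<Sum>z\<in>range (s n). indicator (s n -` {z}) t *\<^sub>R z)" for t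
        by (subst sum.remove[OF fin, of "s n t"]) (auto intro!: sum.neutral simp: indicator_def)
      have "(\<integral>t. s n t \<partial>pvm_measure E x) =
          (\<integral>t. (\<Sum>z\<in>range (s n). indicator (s n -` {z}) t *\<^sub>R z) \<partial>pvm_measure E x)"
        by (rule Bochner_Integration.integral_cong[OF refl ind])
      also have "\<dots> = (\<Sum>z\<in>range (s n). measure (pvm_measure E x) (s n -` {z}) *\<^sub>R z)"
        by (intro has_bochner_integral_integral_eq has_bochner_integral_sum has_bochner_integral_indicator)
          (auto simp: meas emeasure_pvm_measure)
      also have "\<dots> = (\<Sum>z\<in>range (s n). cinner (bop_apply (z *\<^sub>C E (s n -` {z})) x) x)"
        by (intro sum.cong) (simp_all add: measure_pvm_measure meas cinner_E scaleR_conv_of_real mult.commute)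
      also have "\<dots> = cinner (bop_apply (S n) x) x"
      proof -
        have "cinner (bop_apply (\<Sum>z\<in>I. F z) x) x = (\<Sum>z\<in>I. cinner (bop_apply (F z) x) x)"
          for I :: "complex set" and F :: "complex \<Rightarrow> 'h bop"
          by (induction I rule: infinite_finite_induct) auto
        then show ?thesis by (simp add: S_def)
      qed
      finally show ?thesis .
    qed
    have "(\<lambda>n. \<integral>t. s n t \<partial>pvm_measure E x) \<longlonglongrightarrow> (\<integral>t. f t \<partial>pvm_measure E x)"
    proof (rule integral_dominated_convergence)
      show "AE t in pvm_measure E x. norm (s n t) \<le> 2 * C" for n
        using AE_bounded[OF f C, of x]
      proof eventually_elim
        fix t assume "cmod (f t) \<le> C"
        then show "norm (s n t) \<le> 2 * C" using s(3)[of n t] by linarith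
      qed
      show "integrable (pvm_measure E x) (\<lambda>t. 2 * C)" by simp
    qed (use f s(1,2) borel_measurable_simple_function in \<open>auto simp: measurable_cong_sets[OF sets_pvm_measure refl]\<close>)
    then show ?thesis by (simp add: int q)
  qed
  show thesis
  proof
    fix x y
    have "(\<lambda>n. 4 * cinner (bop_apply (S n) x) y) \<longlonglongrightarrow> 4 * cinner (bop_apply T x) y"
      unfolding polarization by (intro tendsto_intros quad)
    from tendsto_divide[OF this tendsto_const[of 4]]
    show "(\<lambda>n. cinner (bop_apply (S n) x) y) \<longlonglongrightarrow> cinner (bop_apply T x) y" by simp
  next
    fix n A assume "\<And>B. B \<in> sets borel \<Longrightarrow> A * E B = E B * A"
    then show "A * S n = S n * A" by (simp add: S_def sum_distrib_left sum_distrib_right meas)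
  qed
qed

lemma pvm_integral_commute:
  assumes T: "has_pvm_integral E f T" and A: "\<And>B. B \<in> sets borel \<Longrightarrow> A * E B = E B * A"
  shows "A * T = T * A"
proof (rule bop_eqI, rule cinner_eqI)
  fix x y
  obtain S where S: "\<And>n x y. (\<lambda>n. cinner (bop_apply (S n) x) y) \<longlonglongrightarrow> cinner (bop_apply T x) y"
    and c: "\<And>n. A * S n = S n * A"
    using pvm_integral_approximation[OF T] A by metis
  have "(\<lambda>n. cinner (bop_apply (S n) x) (bop_apply (adj A) y)) \<longlonglongrightarrow> cinner (bop_apply (A * T) x) y"
    using S by (simp add: cinner_adj)
  moreover have "cinner (bop_apply (S n) x) (bop_apply (adj A) y) = cinner (bop_apply (S n) (bop_apply A x)) y" for n
    using c[of n] by (metis bop_apply_simps(6) cinner_adj)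
  ultimately show "cinner (bop_apply (A * T) x) y = cinner (bop_apply (T * A) x) y"
    using S[of "bop_apply A x" y] by (simp add: LIMSEQ_unique)
qed

lemma E_mono_zero:
  assumes "A \<in> sets borel" "B \<in> sets borel" "A \<subseteq> B" "E B = 0"
  shows "E A = 0"
  using E_Int[OF assms(1,2)] assms by (simp add: Int_absorb2)

text \<open>For \<open>x\<close> in the range of \<open>E B\<close> the measure
  \<open>pvm_measure E x\<close> is concentrated on \<open>B\<close> and has total mass
  \<open>(norm x)\<^sup>2\<close>, so the identity function is compared with a constant.\<close>

lemma pvm_bounds:
  assumes X: "has_pvm_integral E complex_of_real X" and x: "bop_apply (E B) x = x" and B: "B \<in> sets borel"
  shows "B \<subseteq> {a..} \<Longrightarrow> a * (norm x)\<^sup>2 \<le> inner (bop_apply X x) x"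
    and "B \<subseteq> {..a} \<Longrightarrow> inner (bop_apply X x) x \<le> a * (norm x)\<^sup>2"
proof -
  obtain C where C: "E {t. C < cmod (complex_of_real t)} = 0"
    and q: "cinner (bop_apply X x) x = (\<integral>t. complex_of_real t \<partial>pvm_measure E x)"
    using X by (auto simp: has_pvm_integral_def)
  have q': "inner (bop_apply X x) x = (\<integral>t. t \<partial>pvm_measure E x)"
    unfolding Re_cinner[symmetric] q by simp
  have "AE t in pvm_measure E x. norm (t::real) \<le> C"
    using AE_bounded[OF _ C, of x] by simp
  then have int: "integrable (pvm_measure E x) (\<lambda>t. t)"
    by (rule integrable_const_bound) (simp add: measurable_cong_sets[OF sets_pvm_measure refl])
  have inB: "AE t in pvm_measure E x. t \<in> B"
    by (rule AE_I[where N = "- B"]) (use B x in \<open>auto simp: emeasure_pvm_measure E_Compl borel_comp\<close>)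
  have const: "(\<integral>t. a \<partial>pvm_measure E x) = a * (norm x)\<^sup>2" for a
    by (simp add: measure_pvm_measure E_UNIV)
  { assume "B \<subseteq> {a..}"
    then have "(\<integral>t. a \<partial>pvm_measure E x) \<le> (\<integral>t. t \<partial>pvm_measure E x)"
      by (intro integral_mono_AE int) (use inB in \<open>auto elim: eventually_mono\<close>)
    then show "a * (norm x)\<^sup>2 \<le> inner (bop_apply X x) x" by (simp only: q' const) }
  { assume "B \<subseteq> {..a}"
    then have "(\<integral>t. t \<partial>pvm_measure E x) \<le> (\<integral>t. a \<partial>pvm_measure E x)"
      by (intro integral_mono_AE int) (use inB in \<open>auto elim: eventually_mono\<close>)
    then show "inner (bop_apply X x) x \<le> a * (norm x)\<^sup>2" by (simp only: q' const) }
qed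

text \<open>The range of \<open>E {..a}\<close> is described by \<open>X\<close> alone. This gives both the uniqueness of the spectral measure and
  its membership in the double commutant of \<open>X\<close>.\<close>

lemma range_E_atMost:
  assumes X: "has_pvm_integral E complex_of_real X" and sa: "adj X = X"
    and C: "E {t. C < \<bar>t\<bar>} = 0" and a: "0 < a + C + 1"
  shows "bop_apply (E {..a}) x = x \<longleftrightarrow>
    (\<exists>K. \<forall>n. norm (bop_apply ((X + complex_of_real (C + 1) *\<^sub>C 1) ^ n) x) \<le> K * (a + C + 1) ^ n)"
proof
  \<comment> \<open>The measure lives on [-C, C], so the shift makes \<open>Y\<close> at least 1. On
    the range of \<open>E {..a}\<close> the operator \<open>Y\<close> is at most \<open>b\<close>,
    and this range consists of the vectors whose powers under \<open>Y\<close> grow no faster than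
    \<open>b ^ n\<close>.\<close>
  define Y where "Y = X + complex_of_real (C + 1) *\<^sub>C 1"
  define b where "b = a + C + 1"
  have b: "0 < b" using a by (simp add: b_def)
  have XE: "E B * X = X * E B" if "B \<in> sets borel" for B
    by (rule pvm_integral_commute[OF X]) (use that in \<open>simp add: E_Int Int_commute\<close>)
  have YE: "E B * Y = Y * E B" if "B \<in> sets borel" for B
    using XE[OF that] by (simp add: Y_def distrib_left distrib_right)
  have YnE: "E B * Y ^ n = Y ^ n * E B" if "B \<in> sets borel" for B n
    by (rule power_commuting_commutes[OF YE[OF that, symmetric], symmetric])
  have Y_apply: "bop_apply Y x = bop_apply X x + (C + 1) *\<^sub>R x" for x
    by (simp add: Y_def scaleC_of_real del: of_real_add)
  have Y_inner: "inner (bop_apply Y x) x = inner (bop_apply X x) x + (C + 1) * (norm x)\<^sup>2" for x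
    by (simp add: Y_apply inner_add_left power2_norm_eq_inner)
  have Ysym: "inner (bop_apply Y x) y = inner x (bop_apply Y y)" for x y
    using sa by (simp add: Y_apply inner_add_left inner_add_right)
      (metis Re_cinner cinner_adj)
  have support: "bop_apply (E (B \<inter> {-C..})) x = x" if "bop_apply (E B) x = x" "B \<in> sets borel" for B x
  proof -
    have "E (- {-C..}) = 0" by (rule E_mono_zero[OF _ _ _ C]) auto
    then have "E {-C..} = 1" using E_Compl[of "- {-C..}"] by (simp add: borel_comp)
    then show ?thesis using E_Int[of B "{-C..}"] that by simp
  qed
  have pos: "(norm x)\<^sup>2 \<le> inner (bop_apply Y x) x" for x
    using pvm_bounds(1)[OF X support[of UNIV x], of "-C"] by (simp add: Y_inner E_UNIV algebra_simps)
  have invar: "bop_apply (E B) (bop_apply Y x) = bop_apply Y x" if "bop_apply (E B) x = x" "B \<in> sets borel" for B x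
    using YE[OF that(2)] that(1) by (metis bop_apply_simps(6))
  have up: "norm (bop_apply Y x) \<le> b * norm x" if x: "bop_apply (E {..a}) x = x" for x
  proof -
    let ?y = "bop_apply Y x"
    have form: "inner (bop_apply Y z) z \<le> b * (norm z)\<^sup>2" if "bop_apply (E {..a}) z = z" for z
      using pvm_bounds(2)[OF X that, of a] by (simp add: Y_inner b_def algebra_simps)
    \<comment> \<open>A bound on the form of \<open>Y\<close> becomes a bound on
      \<open>norm ?y\<close>: positivity at \<open>b *\<^sub>R x - ?y\<close> says that
      \<open>b\<^sup>2 Y - 2 b Y\<^sup>2 + Y\<^sup>3\<close> is nonnegative at \<open>x\<close>, and
      the upper bound is used at \<open>x\<close> and at \<open>?y\<close>.\<close>
    have "0 \<le> inner (bop_apply Y (b *\<^sub>R x - ?y)) (b *\<^sub>R x - ?y)"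
      using pos[of "b *\<^sub>R x - ?y"] zero_le_power2 order_trans by blast
    also have "\<dots> = b * (b * inner ?y x) - b * inner ?y ?y - (b * inner (bop_apply Y ?y) x - inner (bop_apply Y ?y) ?y)"
      by (simp add: inner_diff_left inner_diff_right algebra_simps)
    also have "\<dots> = b\<^sup>2 * inner ?y x - 2 * b * (norm ?y)\<^sup>2 + inner (bop_apply Y ?y) ?y"
      unfolding Ysym[of ?y x] power2_norm_eq_inner by (simp add: power2_eq_square[of b])
    also have "\<dots> \<le> b\<^sup>2 * (b * (norm x)\<^sup>2) - 2 * b * (norm ?y)\<^sup>2 + b * (norm ?y)\<^sup>2"
      using b form[OF x] form[OF invar[OF x]] by (intro add_mono diff_mono mult_left_mono) auto
    finally have "b * (norm ?y)\<^sup>2 \<le> b * (b * norm x)\<^sup>2" by (simp add: power_mult_distrib algebra_simps)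
    then have "(norm ?y)\<^sup>2 \<le> (b * norm x)\<^sup>2" using b by simp
    then show ?thesis using b by (simp add: power2_le_iff_abs_le)
  qed
  have low: "c * norm x \<le> norm (bop_apply Y x)"
    if x: "bop_apply (E {c - C - 1..}) x = x" and c: "0 < c" for c x
  proof -
    have "c * (norm x)\<^sup>2 \<le> inner (bop_apply Y x) x"
      using pvm_bounds(1)[OF X x, of "c - C - 1"] by (simp add: Y_inner algebra_simps)
    also have "\<dots> \<le> norm (bop_apply Y x) * norm x" by (rule norm_cauchy_schwarz)
    finally have "norm x * (c * norm x) \<le> norm x * norm (bop_apply Y x)" by (simp add: power2_eq_square mult_ac)
    then show ?thesis by (cases "x = 0") auto
  qed
  have Yn: "bop_apply (Y ^ Suc n) x = bop_apply Y (bop_apply (Y ^ n) x)" for n x by simp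
  have invar_n: "bop_apply (E B) (bop_apply (Y ^ n) x) = bop_apply (Y ^ n) x"
    if "bop_apply (E B) x = x" "B \<in> sets borel" for B x n
    by (induction n) (use that invar in auto)
  { assume x: "bop_apply (E {..a}) x = x"
    have "norm (bop_apply (Y ^ n) x) \<le> norm x * b ^ n" for n
    proof (induction n)
      case (Suc n)
      have "norm (bop_apply (Y ^ Suc n) x) \<le> b * norm (bop_apply (Y ^ n) x)"
        unfolding Yn by (rule up[OF invar_n[OF x]]) simp
      also have "\<dots> \<le> b * (norm x * b ^ n)" using Suc b by (intro mult_left_mono) auto
      finally show ?case by (simp add: mult_ac)
    qed simp
    then show "\<exists>K. \<forall>n. norm (bop_apply ((X + complex_of_real (C + 1) *\<^sub>C 1) ^ n) x) \<le> K * (a + C + 1) ^ n"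
      unfolding Y_def b_def by blast }
  { assume "\<exists>K. \<forall>n. norm (bop_apply ((X + complex_of_real (C + 1) *\<^sub>C 1) ^ n) x) \<le> K * (a + C + 1) ^ n"
    then obtain K where K: "\<And>n. norm (bop_apply (Y ^ n) x) \<le> K * b ^ n"
      unfolding Y_def b_def by blast
    \<comment> \<open>A nonzero component of \<open>x\<close> at or above \<open>a + d\<close> would
      grow at least like \<open>(b + d) ^ n\<close>, whereas a spectral projection of
      \<open>bop_apply (Y ^ n) x\<close> is bounded by \<open>K * b ^ n\<close>.\<close>
    have zero: "bop_apply (E {a + d..}) x = 0" if d: "0 < d" for d
    proof (rule ccontr)
      define z where "z = bop_apply (E {a + d..}) x"
      assume "bop_apply (E {a + d..}) x \<noteq> 0"
      then have z: "0 < norm z" by (simp add: z_def)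
      have Ez: "bop_apply (E {(b + d) - C - 1..}) z = z"
        using E_idem[of "{a + d..}"] by (metis (no_types, opaque_lifting) atLeast_borel b_def bop_apply_simps(6) z_def
            add.commute add_diff_cancel_right' diff_diff_eq add.assoc add_diff_cancel_left')
      have grow: "(b + d) ^ n * norm z \<le> norm (bop_apply (Y ^ n) z)" for n
      proof (induction n)
        case (Suc n)
        have "(b + d) ^ Suc n * norm z = (b + d) * ((b + d) ^ n * norm z)" by simp
        also have "\<dots> \<le> (b + d) * norm (bop_apply (Y ^ n) z)"
          using Suc b d by (intro mult_left_mono) auto
        also have "\<dots> \<le> norm (bop_apply (Y ^ Suc n) z)"
          unfolding Yn by (rule low[OF invar_n[OF Ez]]) (use b d in auto)
        finally show ?case .
      qed simp
      have contr: "norm (bop_apply (E B) y) \<le> norm y" if "B \<in> sets borel" for B y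
      proof -
        have "(norm (bop_apply (E B) y))\<^sup>2 = Re (cinner (bop_apply (E B) y) y)"
          by (simp only: cinner_E[OF that] Re_complex_of_real)
        also have "\<dots> \<le> norm (bop_apply (E B) y) * norm y"
          unfolding Re_cinner by (rule norm_cauchy_schwarz)
        finally show ?thesis by (cases "bop_apply (E B) y = 0") (auto simp: power2_eq_square)
      qed
      have "bop_apply (Y ^ n) z = bop_apply (E {a + d..}) (bop_apply (Y ^ n) x)" for n
        using YnE[of "{a + d..}" n] unfolding z_def by (metis atLeast_borel bop_apply_simps(6))
      then have "norm (bop_apply (Y ^ n) z) \<le> K * b ^ n" for n
        using contr[of "{a + d..}"] K[of n] order_trans by fastforce
      then have "(b + d) ^ n * norm z \<le> K * b ^ n" for n using grow order_trans by blast
      then have bdd: "((b + d) / b) ^ n \<le> K / norm z" for n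
        using b z by (simp add: power_divide field_simps)
      have "1 < (b + d) / b" using b d by simp
      from real_arch_pow[OF this] obtain n where "K / norm z < ((b + d) / b) ^ n" by blast
      then show False using bdd[of n] by simp
    qed
    have "emeasure (pvm_measure E x) (\<Union>n. {a + inverse (real (Suc n))..}) = 0"
      by (rule emeasure_UN_eq_0) (auto simp: emeasure_pvm_measure zero)
    moreover have "(\<Union>n. {a + inverse (real (Suc n))..}) = {a<..}"
    proof (intro equalityI subsetI)
      fix t assume "t \<in> {a<..}"
      then obtain n where "inverse (real (Suc n)) < t - a" using reals_Archimedean[of "t - a"] by auto
      then show "t \<in> (\<Union>n. {a + inverse (real (Suc n))..})" by (auto intro!: exI[of _ n])
    next
      fix t assume "t \<in> (\<Union>n. {a + inverse (real (Suc n))..})"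
      then obtain n where "a + inverse (real (Suc n)) \<le> t" by auto
      moreover have "0 < inverse (real (Suc n))" by simp
      ultimately show "t \<in> {a<..}" unfolding greaterThan_iff by linarith
    qed
    ultimately have "bop_apply (E (- {..a})) x = 0"
      by (simp add: emeasure_pvm_measure Compl_atMost)
    then show "bop_apply (E {..a}) x = x"
      using E_Compl[of "{..a}"] by (simp del: Compl_atMost) }
qed

text \<open>Dynkin's theorem for the half-lines, which are stable under intersection: only
  complements and disjoint unions remain to be checked, and on these a projection-valued measure is
  explicit.\<close>

lemma borel_induct_atMost [consumes 1, case_names atMost empty compl union]:
  assumes "B \<in> sets (borel :: real measure)"
    and "\<And>a::real. P {..a}" "P {}" "\<And>A. A \<in> sets borel \<Longrightarrow> P A \<Longrightarrow> P (- A)"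
    "\<And>A. disjoint_family A \<Longrightarrow> range A \<subseteq> sets borel \<Longrightarrow> (\<And>i::nat. P (A i)) \<Longrightarrow> P (\<Union>i. A i)"
  shows "P B"
proof -
  have b: "sets borel = sigma_sets UNIV (range (\<lambda>a::real. {..a}))"
    by (subst borel_eq_atMost) simp
  have "Int_stable (range (\<lambda>a::real. {..a}))" by (auto simp: Int_stable_def)
  then show ?thesis
  proof (rule sigma_sets_induct_disjoint[where \<Omega> = UNIV])
    show "B \<in> sigma_sets UNIV (range (\<lambda>a::real. {..a}))" using assms(1) b by simp
  qed (use assms(2-) b in \<open>auto simp: Compl_eq_Diff_UNIV[symmetric]\<close>)
qed

text \<open>All larger constants are included so that two spectral measures can share one.\<close>

lemma spectral_bound:
  assumes "has_pvm_integral E complex_of_real X"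
  obtains C where "0 \<le> C" "\<And>C'. C \<le> C' \<Longrightarrow> E {t. C' < \<bar>t\<bar>} = 0"
proof -
  obtain C where C: "E {t. C < \<bar>t\<bar>} = 0" using assms by (auto simp: has_pvm_integral_def)
  show thesis
    by (rule that[of "max 0 C"]) (auto intro: E_mono_zero[OF _ _ _ C])
qed

lemma E_double_commutant:
  assumes X: "has_pvm_integral E complex_of_real X" and sa: "adj X = X" and B: "B \<in> sets borel"
  shows "E B \<in> commutant (commutant {X})"
proof -
  obtain C where C: "E {t. C < \<bar>t\<bar>} = 0" using spectral_bound[OF X] by (metis order_refl)
  have "S * E B = E B * S" if S: "S * X = X * S" for S
    using B
  proof (induction rule: borel_induct_atMost)
    case (atMost a)
    show ?case
    proof (cases "0 < a + C + 1")
      case False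
      \<comment> \<open>The half-line lies below \<open>- C\<close>, outside the support.\<close>
      have "E {..a} = 0" by (rule E_mono_zero[OF _ _ _ C]) (use False in auto)
      then show ?thesis by simp
    next
      case True
      \<comment> \<open>\<open>R\<close> commutes with the powers of the shifted operator, so it
        preserves the growth condition describing the range of \<open>E {..a}\<close>, up to the
        factor \<open>norm R\<close>.\<close>
      have inv: "E {..a} * R * E {..a} = R * E {..a}" if R: "R * X = X * R" for R
      proof (rule bop_eqI)
        fix x
        let ?Y = "X + complex_of_real (C + 1) *\<^sub>C 1"
        have RY: "R * ?Y = ?Y * R" using R by (simp add: distrib_left distrib_right)
        have RYn: "?Y ^ n * R = R * ?Y ^ n" for n
          by (rule power_commuting_commutes[OF RY[symmetric]])
        let ?x = "bop_apply (E {..a}) x"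
        have "bop_apply (E {..a}) ?x = ?x" using E_idem[of "{..a}"] by (metis atMost_borel bop_apply_simps(6))
        then obtain K where K: "\<And>n. norm (bop_apply (?Y ^ n) ?x) \<le> K * (a + C + 1) ^ n"
          unfolding range_E_atMost[OF X sa C True] by blast
        have "norm (bop_apply (?Y ^ n) (bop_apply R ?x)) \<le> norm R * K * (a + C + 1) ^ n" for n
        proof -
          have "bop_apply (?Y ^ n) (bop_apply R ?x) = bop_apply R (bop_apply (?Y ^ n) ?x)"
            using RYn[of n] by (metis bop_apply_simps(6))
          also have "norm \<dots> \<le> norm R * norm (bop_apply (?Y ^ n) ?x)" by (rule bop_apply_bounded)
          also have "\<dots> \<le> norm R * (K * (a + C + 1) ^ n)" by (intro mult_left_mono K) simp
          finally show ?thesis by simp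
        qed
        then have "bop_apply (E {..a}) (bop_apply R ?x) = bop_apply R ?x"
          unfolding range_E_atMost[OF X sa C True] by blast
        then show "bop_apply (E {..a} * R * E {..a}) x = bop_apply (R * E {..a}) x" by simp
      qed
      \<comment> \<open>Invariance under \<open>adj S\<close> gives, after taking adjoints, the
        other half of the commutation of \<open>S\<close> with the projection.\<close>
      have "adj S * X = X * adj S" using S sa by (metis adj_mult)
      then have "adj (E {..a} * adj S * E {..a}) = adj (adj S * E {..a})" using inv by metis
      then have "E {..a} * S * E {..a} = E {..a} * S" by (simp add: adj_mult adj_E mult.assoc)
      then show ?thesis using inv[OF S] by simp
    qed
  next
    case empty
    then show ?case by (simp add: E_empty)
  next
    case (compl A)
    then show ?case by (simp add: E_Compl left_diff_distrib right_diff_distrib)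
  next
    case (union A)
    show ?case
    proof (rule bop_eqI)
      fix x
      have "(\<lambda>n. bop_apply S (bop_apply (E (A n)) x)) sums bop_apply S (bop_apply (E (\<Union>n. A n)) x)"
        by (intro bounded_linear.sums[OF bounded_linear_bop_apply] E_sums union)
      moreover have "bop_apply S (bop_apply (E (A n)) x) = bop_apply (E (A n)) (bop_apply S x)" for n
        using union(3)[of n] by (metis bop_apply_simps(6))
      ultimately show "bop_apply (S * E (\<Union>n. A n)) x = bop_apply (E (\<Union>n. A n) * S) x"
        using E_sums[OF union(2,1), of "bop_apply S x"] by (simp add: sums_unique2)
    qed
  qed
  then show ?thesis by (auto simp: commutant_def)
qed

end

lemma spectral_measure_unique:
  assumes E: "projection_valued_measure E" "has_pvm_integral E complex_of_real X"
    and F: "projection_valued_measure F" "has_pvm_integral F complex_of_real X"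
    and sa: "adj X = X" and "B \<in> sets borel"
  shows "E B = F B"
proof -
  interpret E: pvm E by unfold_locales fact
  interpret F: pvm F by unfold_locales fact
  obtain C1 C2 where "\<And>C. C1 \<le> C \<Longrightarrow> E {t. C < \<bar>t\<bar>} = 0" "\<And>C. C2 \<le> C \<Longrightarrow> F {t. C < \<bar>t\<bar>} = 0"
    using E.spectral_bound[OF E(2)] F.spectral_bound[OF F(2)] by metis
  then obtain C where C: "E {t. C < \<bar>t\<bar>} = 0" "F {t. C < \<bar>t\<bar>} = 0"
    by (meson max.cobounded1 max.cobounded2)
  show ?thesis
    using \<open>B \<in> sets borel\<close>
  proof (induction rule: E.borel_induct_atMost)
    case (atMost a)
    show ?case
    proof (cases "0 < a + C + 1")
      case False
      have "E {..a} = 0" by (rule E.E_mono_zero[OF _ _ _ C(1)]) (use False in auto)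
      moreover have "F {..a} = 0" by (rule F.E_mono_zero[OF _ _ _ C(2)]) (use False in auto)
      ultimately show ?thesis by simp
    next
      case True
      have iff: "bop_apply (E {..a}) x = x \<longleftrightarrow> bop_apply (F {..a}) x = x" for x
        unfolding E.range_E_atMost[OF E(2) sa C(1) True] F.range_E_atMost[OF F(2) sa C(2) True] ..
      \<comment> \<open>Two self-adjoint idempotents with equal ranges: each absorbs the other, and
        taking adjoints identifies them.\<close>
      have "E {..a} * F {..a} = F {..a}"
      proof (rule bop_eqI)
        fix x
        have "bop_apply (F {..a}) (bop_apply (F {..a}) x) = bop_apply (F {..a}) x"
          using F.E_idem[of "{..a}"] by (metis atMost_borel bop_apply_simps(6))
        then show "bop_apply (E {..a} * F {..a}) x = bop_apply (F {..a}) x" using iff by simp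
      qed
      moreover have "F {..a} * E {..a} = E {..a}"
      proof (rule bop_eqI)
        fix x
        have "bop_apply (E {..a}) (bop_apply (E {..a}) x) = bop_apply (E {..a}) x"
          using E.E_idem[of "{..a}"] by (metis atMost_borel bop_apply_simps(6))
        then show "bop_apply (F {..a} * E {..a}) x = bop_apply (E {..a}) x" using iff by simp
      qed
      moreover have "adj (F {..a} * E {..a}) = E {..a} * F {..a}"
        by (simp add: adj_mult E.adj_E F.adj_E)
      ultimately show ?thesis by (metis E.adj_E atMost_borel)
    qed
  next
    case empty
    then show ?case by (simp add: E.E_empty F.E_empty)
  next
    case (compl A)
    then show ?case by (simp add: E.E_Compl F.E_Compl)
  next
    case (union A)
    show ?case
    proof (rule bop_eqI)
      fix x
      show "bop_apply (E (\<Union>n. A n)) x = bop_apply (F (\<Union>n. A n)) x"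
        using E.E_sums[OF union(2,1), of x] F.E_sums[OF union(2,1), of x] by (simp add: union(3) sums_unique2)
    qed
  qed
qed

text \<open>Justifies the definite description in \<open>fun_calc\<close>.\<close>

lemma has_fun_calc_unique:
  assumes "has_fun_calc X f S" "has_fun_calc X f T" "adj X = X"
  shows "S = T"
proof -
  obtain E F where E: "projection_valued_measure E" "has_pvm_integral E complex_of_real X" "has_pvm_integral E f S"
    and F: "projection_valued_measure F" "has_pvm_integral F complex_of_real X" "has_pvm_integral F f T"
    using assms(1,2) by (auto simp: has_fun_calc_def)
  have "pvm_measure E x = pvm_measure F x" for x
    unfolding pvm_measure_def
    by (rule measure_of_eq)
      (use spectral_measure_unique[OF E(1,2) F(1,2) assms(3)] sets.sigma_sets_eq[of "borel :: real measure"] in auto)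
  then show ?thesis
    using E(3) F(3) by (intro bop_eqI_quadratic) (simp add: has_pvm_integral_def)
qed

theorem fun_calc_double_commutant:
  assumes "fun_calc_bounded X f" "adj X = X"
  shows "fun_calc X f \<in> commutant (commutant {X})"
proof -
  obtain T where T: "has_fun_calc X f T" using assms(1) by (auto simp: fun_calc_bounded_def)
  then have "fun_calc X f = T"
    unfolding fun_calc_def using has_fun_calc_unique[OF _ T assms(2)] by blast
  moreover obtain E where E: "projection_valued_measure E" "has_pvm_integral E complex_of_real X" "has_pvm_integral E f T"
    using T by (auto simp: has_fun_calc_def)
  interpret pvm E by unfold_locales fact
  have "A * T = T * A" if "A \<in> commutant {X}" for A
    by (rule pvm_integral_commute[OF E(3)])
      (use E_double_commutant[OF E(2) assms(2)] that in \<open>auto simp: commutant_def\<close>)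
  ultimately show ?thesis by (auto simp: commutant_def)
qed

section \<open>From interval partitions to resolvents\<close>

section \<open>Boolean cumulants as iterated centred products\<close>

text \<open>Encodes an interval partition by the size \<open>k\<close> of the block containing 0 and
  a partition \<rho> of the remaining points, shifted by \<open>k\<close>.\<close>

definition cons_block :: "nat \<Rightarrow> nat set set \<Rightarrow> nat set set" where
  "cons_block k \<rho> = insert {..<k} ((`) ((+) k) ` \<rho>)"

lemma disjnt_shifted_blocks: "disjnt {..<k} (\<Union>((`) ((+) k) ` \<rho>))" for k :: nat
  by (auto simp: disjnt_iff)

lemma cons_block_interval_partition:
  assumes \<rho>: "\<rho> \<in> interval_partitions (m - k)" and k: "k \<in> {1..m}"
  shows "cons_block k \<rho> \<in> interval_partitions m" "{..<k} \<notin> (`) ((+) k) ` \<rho>"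
proof -
  have P: "partition_on {..<m - k} \<rho>" and I: "\<And>B. B \<in> \<rho> \<Longrightarrow> \<exists>a b. B = {a..<b}"
    using \<rho> by (auto simp: interval_partitions_def)
  have "partition_on ((+) k ` {..<m - k}) ((`) ((+) k) ` \<rho> - {{}})"
    by (rule partition_on_inj_image[OF P]) auto
  moreover have "(`) ((+) k) ` \<rho> - {{}} = (`) ((+) k) ` \<rho>" using partition_onD3[OF P] by auto
  moreover have "(+) k ` {..<m - k} = {..<m} - {..<k}"
    using k by (auto simp: lessThan_atLeast0 image_add_atLeastLessThan)
  ultimately have "partition_on {..<m} (cons_block k \<rho>)"
    using k unfolding cons_block_def partition_on_insert[OF disjnt_shifted_blocks]
    by (auto simp: lessThan_empty_iff)
  moreover have "\<exists>a b. B = {a..<b}" if B: "B \<in> cons_block k \<rho>" for B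
  proof (cases "B = {..<k}")
    case True
    then show ?thesis by (auto simp: lessThan_atLeast0)
  next
    case False
    then obtain C where C: "C \<in> \<rho>" "B = (+) k ` C" using B unfolding cons_block_def by blast
    then obtain a b where "C = {a..<b}" using I by blast
    then show ?thesis using C(2) image_add_atLeastLessThan by blast
  qed
  ultimately show "cons_block k \<rho> \<in> interval_partitions m" by (simp add: interval_partitions_def)
  show "{..<k} \<notin> (`) ((+) k) ` \<rho>"
  proof
    assume "{..<k} \<in> (`) ((+) k) ` \<rho>"
    moreover have "0 \<in> {..<k}" using k by simp
    ultimately have "0 \<in> \<Union> ((`) ((+) k) ` \<rho>)" by blast
    then show False using k by auto
  qed
qed

lemma interval_partition_cases:
  assumes \<pi>: "\<pi> \<in> interval_partitions m" and m: "0 < m"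
  obtains k \<rho> where "k \<in> {1..m}" "\<rho> \<in> interval_partitions (m - k)" "\<pi> = cons_block k \<rho>"
proof -
  have P: "partition_on {..<m} \<pi>" and I: "\<And>B. B \<in> \<pi> \<Longrightarrow> \<exists>a b. B = {a..<b}"
    using \<pi> by (auto simp: interval_partitions_def)
  have "0 \<in> \<Union>\<pi>" using m partition_onD1[OF P] by auto
  then obtain B0 where B0: "B0 \<in> \<pi>" "0 \<in> B0" by blast
  then obtain k where k: "B0 = {..<k}" using I[OF B0(1)] by (auto simp: lessThan_atLeast0)
  have "B0 \<subseteq> {..<m}" using partition_onD1[OF P] B0(1) by blast
  then have km: "k \<in> {1..m}" using B0(2) k by (auto simp: lessThan_subset_iff)
  define Q where "Q = \<pi> - {{..<k}}"
  have \<pi>Q: "\<pi> = insert {..<k} Q" using B0(1) k by (auto simp: Q_def)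
  have "{..<k} \<inter> C = {}" if "C \<in> Q" for C
    using disjointD[OF partition_onD2[OF P], of "{..<k}" C] that B0(1) k by (auto simp: Q_def)
  then have "disjnt {..<k} (\<Union>Q)" by (auto simp: disjnt_def)
  then have Q: "partition_on ({..<m} - {..<k}) Q"
    using P unfolding \<pi>Q by (simp add: partition_on_insert)
  moreover have km': "{..<m} - {..<k} = {k..<m}" by auto
  ultimately have Q': "partition_on {k..<m} Q" by simp
  have sub: "B \<subseteq> {k..<m}" if "B \<in> Q" for B using partition_onD1[OF Q'] that by blast
  define \<rho> where "\<rho> = (`) (\<lambda>x. x - k) ` Q"
  have "partition_on ((\<lambda>x. x - k) ` {k..<m}) (\<rho> - {{}})"
    unfolding \<rho>_def by (rule partition_on_inj_image[OF Q']) (auto simp: inj_on_def)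
  moreover have "\<rho> - {{}} = \<rho>" using partition_onD3[OF Q'] by (auto simp: \<rho>_def)
  moreover have shift: "(\<lambda>x. x - k) ` {a..<b} = {a - k..<b - k}" if "k \<le> a" for a b
  proof (intro equalityI subsetI)
    fix x assume "x \<in> {a - k..<b - k}"
    then have "x = (x + k) - k" "x + k \<in> {a..<b}" using that by auto
    then show "x \<in> (\<lambda>x. x - k) ` {a..<b}" by blast
  qed (use that in auto)
  ultimately have P\<rho>: "partition_on {..<m - k} \<rho>" by (simp add: lessThan_atLeast0)
  have "\<exists>a b. B = {a..<b}" if "B \<in> \<rho>" for B
  proof -
    from that obtain C where C: "C \<in> Q" "B = (\<lambda>x. x - k) ` C" by (auto simp: \<rho>_def)
    then obtain a b where ab: "C = {a..<b}" using I[of C] by (auto simp: \<pi>Q)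
    moreover have "C \<noteq> {}" using C(1) partition_onD3[OF Q'] by auto
    ultimately have "k \<le> a" using sub[OF C(1)] by auto
    then show ?thesis using shift C(2) ab by blast
  qed
  then have \<rho>: "\<rho> \<in> interval_partitions (m - k)" using P\<rho> by (simp add: interval_partitions_def)
  have "(+) k ` (\<lambda>x. x - k) ` B = B" if "B \<in> Q" for B
    using sub[OF that] by (force simp: image_image)
  then have "(`) ((+) k) ` \<rho> = Q" by (simp add: \<rho>_def image_image)
  then have "\<pi> = cons_block k \<rho>" by (simp add: cons_block_def \<pi>Q)
  then show thesis using that km \<rho> by blast
qed

lemma cons_block_inj:
  assumes "\<rho> \<in> interval_partitions (m - k)" "k \<in> {1..m}"
    and "\<rho>' \<in> interval_partitions (m - k')" "k' \<in> {1..m}"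
    and eq: "cons_block k \<rho> = cons_block k' \<rho>'"
  shows "k = k' \<and> \<rho> = \<rho>'"
proof -
  have "{..<k} \<in> cons_block k' \<rho>'" unfolding eq[symmetric] by (simp add: cons_block_def)
  moreover have "{..<k} \<noteq> (+) k' ` B" for B
  proof
    assume "{..<k} = (+) k' ` B"
    moreover have "0 \<in> {..<k}" using assms(2) by simp
    ultimately show False using assms(4) by auto
  qed
  ultimately have "{..<k} = {..<k'}" by (auto simp: cons_block_def)
  then have k: "k = k'" by simp
  have "(`) ((+) k) ` \<rho> = cons_block k \<rho> - {{..<k}}" "(`) ((+) k) ` \<rho>' = cons_block k \<rho>' - {{..<k}}"
    using cons_block_interval_partition(2)[OF assms(1,2)] cons_block_interval_partition(2)[OF assms(3,4)]
    by (auto simp: cons_block_def k)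
  then have "(`) ((+) k) ` \<rho> = (`) ((+) k) ` \<rho>'" using eq k by simp
  moreover have "inj ((`) ((+) k))" by (simp add: inj_def inj_image_eq_iff)
  ultimately show ?thesis using k by (simp add: inj_image_eq_iff)
qed

lemma sum_interval_partitions:
  assumes "0 < m"
  shows "(\<Sum>\<pi>\<in>interval_partitions m. F \<pi>) =
    (\<Sum>k=1..m. \<Sum>\<rho>\<in>interval_partitions (m - k). F (cons_block k \<rho>))"
proof -
  let ?S = "Sigma {1..m} (\<lambda>k. interval_partitions (m - k))" and ?g = "\<lambda>(k, \<rho>). cons_block k \<rho>"
  have "bij_betw ?g ?S (interval_partitions m)"
    unfolding bij_betw_def
  proof (intro conjI equalityI subsetI)
    show "inj_on ?g ?S"
    proof (rule inj_onI)
      fix p q assume "p \<in> ?S" "q \<in> ?S" "?g p = ?g q"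
      then show "p = q"
        using cons_block_inj[of "snd p" m "fst p" "snd q" "fst q"] by (auto simp: case_prod_beta prod_eq_iff)
    qed
    show "\<pi> \<in> interval_partitions m" if "\<pi> \<in> ?g ` ?S" for \<pi>
      using that cons_block_interval_partition(1) by auto
    show "\<pi> \<in> ?g ` ?S" if \<pi>: "\<pi> \<in> interval_partitions m" for \<pi>
      by (rule interval_partition_cases[OF \<pi> assms]) (force simp: image_iff)
  qed
  then have "(\<Sum>\<pi>\<in>interval_partitions m. F \<pi>) = (\<Sum>p\<in>?S. F (?g p))"
    by (simp add: sum.reindex_bij_betw)
  also have "\<dots> = (\<Sum>k=1..m. \<Sum>\<rho>\<in>interval_partitions (m - k). F (cons_block k \<rho>))"
    by (subst sum.Sigma) (auto simp: finite_interval_partitions case_prod_unfold)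
  finally show ?thesis .
qed

text \<open>Partitions are sorted by their first block; summing over the rest reassembles a moment.
  The term with a single block carries the factor \<open>\<phi> 1\<close>, whence the
  normalisation.\<close>

lemma moment_boolean_cumulant_rec:
  assumes "xs \<noteq> []" "\<phi> 1 = 1"
  shows "\<phi> (prod_list xs) =
    (\<Sum>k=1..length xs. boolean_cumulant \<phi> (take k xs) * \<phi> (prod_list (drop k xs)))"
proof -
  let ?w = "\<lambda>xs \<pi>. \<Prod>B\<in>\<pi>. boolean_cumulant \<phi> (nths xs B)"
  \<comment> \<open>Extended to the empty list, whose only partition is the empty one.\<close>
  have moment: "\<phi> (prod_list ys) = (\<Sum>\<pi>\<in>interval_partitions (length ys). ?w ys \<pi>)" for ys
  proof (cases "ys = []")
    case True
    have "interval_partitions 0 = {{}}" by (auto simp: interval_partitions_def partition_on_empty)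
    then show ?thesis using True assms(2) by simp
  qed (rule moment_boolean_cumulant)
  have "\<phi> (prod_list xs) =
      (\<Sum>k=1..length xs. \<Sum>\<rho>\<in>interval_partitions (length xs - k). ?w xs (cons_block k \<rho>))"
    using assms(1) by (simp add: moment sum_interval_partitions)
  also have "\<dots> = (\<Sum>k=1..length xs. \<Sum>\<rho>\<in>interval_partitions (length xs - k).
      boolean_cumulant \<phi> (take k xs) * ?w (drop k xs) \<rho>)"
  proof (intro sum.cong refl)
    fix k \<rho> assume k: "k \<in> {1..length xs}" and \<rho>: "\<rho> \<in> interval_partitions (length xs - k)"
    have "finite \<rho>"
      using \<rho> by (auto simp: interval_partitions_def intro: finite_UnionD dest: partition_onD1)
        (metis finite_UnionD finite_lessThan partition_onD1)
    moreover have "inj_on ((`) ((+) k)) \<rho>" by (simp add: inj_on_def inj_image_eq_iff)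
    ultimately show "?w xs (cons_block k \<rho>) = boolean_cumulant \<phi> (take k xs) * ?w (drop k xs) \<rho>"
      using cons_block_interval_partition(2)[OF \<rho> k]
      by (simp add: cons_block_def prod.reindex nths_drop)
  qed
  also have "\<dots> = (\<Sum>k=1..length xs. boolean_cumulant \<phi> (take k xs) * \<phi> (prod_list (drop k xs)))"
    by (simp add: moment sum_distrib_left)
  finally show ?thesis .
qed

context tracial_functional
begin

definition centre :: "'h bop \<Rightarrow> 'h bop" where
  "centre a = a - \<phi> a *\<^sub>C 1"

text \<open>The start value is \<open>1\<close>, so \<open>\<phi> (x * iter [])\<close> is the first
  cumulant \<open>\<phi> x\<close>, and \<open>iter [x]\<close> is already centred.\<close>

definition iter :: "'h bop list \<Rightarrow> 'h bop" where
  "iter xs = foldr (\<lambda>x y. centre (x * y)) xs 1"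

lemma iter_simps [simp]: "iter [] = 1" "iter (x # xs) = centre (x * iter xs)"
  by (simp_all add: iter_def)

lemma centre_mem [simp]: "a \<in> M \<Longrightarrow> centre a \<in> M"
  by (simp add: centre_def)

lemma \<phi>_centre [simp]: "a \<in> M \<Longrightarrow> \<phi> (centre a) = 0"
  by (simp add: centre_def)

lemma centre_add: "a \<in> M \<Longrightarrow> b \<in> M \<Longrightarrow> centre (a + b) = centre a + centre b"
  by (simp add: centre_def)

lemma centre_scaleC: "a \<in> M \<Longrightarrow> centre (c *\<^sub>C a) = c *\<^sub>C centre a"
  by (simp add: centre_def)

lemma centre_sum: "(\<And>i. i \<in> I \<Longrightarrow> x i \<in> M) \<Longrightarrow> centre (sum x I) = (\<Sum>i\<in>I. centre (x i))"
  by (induction I rule: infinite_finite_induct) (auto simp: centre_add centre_def[of 0])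

lemma norm_centre: "a \<in> M \<Longrightarrow> norm (centre a) \<le> (1 + bd) * norm a"
  using norm_triangle_ineq4[of a "\<phi> a *\<^sub>C 1"] \<phi>_bounded[of a]
  by (simp add: centre_def norm_scaleC_bop algebra_simps)

lemma iter_mem [simp]: "set xs \<subseteq> M \<Longrightarrow> iter xs \<in> M"
  by (induction xs) auto

lemma prod_list_mem [simp]: "set xs \<subseteq> M \<Longrightarrow> prod_list xs \<in> M"
  by (induction xs) auto

text \<open>Splitting each suffix product into its scalar and its centred part, the scalars being
  the moments of the suffixes.\<close>

lemma prod_list_eq_sum_iter:
  assumes "set xs \<subseteq> M"
  shows "prod_list xs = (\<Sum>k\<le>length xs. \<phi> (prod_list (drop k xs)) *\<^sub>C iter (take k xs))"
  using assms
proof (induction xs)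
  case (Cons x xs)
  have d: "set (drop k xs) \<subseteq> M" "set (take k xs) \<subseteq> M" for k
    using Cons.prems set_drop_subset[of k xs] set_take_subset[of k xs] by auto
  have x: "x \<in> M" using Cons.prems by simp
  have "prod_list (x # xs) = \<phi> (prod_list (x # xs)) *\<^sub>C 1 + centre (x * prod_list xs)"
    by (simp add: centre_def)
  also have "centre (x * prod_list xs) =
      (\<Sum>k\<le>length xs. \<phi> (prod_list (drop k xs)) *\<^sub>C centre (x * iter (take k xs)))"
    using d x by (subst Cons.IH) (use Cons.prems in \<open>auto simp: sum_distrib_left centre_sum centre_scaleC\<close>)
  finally show ?case by (simp add: sum.atMost_Suc_shift del: sum.atMost_Suc)
qed simp

text \<open>Both sides satisfy the same recursion for \<open>\<phi> (x * prod_list xs)\<close>.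
  Terms for proper prefixes of \<open>xs\<close> agree by induction, and the remaining term has
  coefficient \<open>\<phi> 1 = 1\<close>, so it agrees as well.\<close>

theorem boolean_cumulant_eq_iter:
  assumes "x \<in> M" "set xs \<subseteq> M"
  shows "boolean_cumulant \<phi> (x # xs) = \<phi> (x * iter xs)"
  using assms(2)
proof (induction "length xs" arbitrary: xs rule: less_induct)
  case less
  have d: "set (drop k xs) \<subseteq> M" "set (take k xs) \<subseteq> M" for k
    using less.prems set_drop_subset[of k xs] set_take_subset[of k xs] by auto
  let ?m = "\<lambda>k. \<phi> (prod_list (drop k xs))"
  have "\<phi> (x * prod_list xs) = (\<Sum>k\<le>length xs. ?m k * \<phi> (x * iter (take k xs)))"
    using d assms(1) by (subst prod_list_eq_sum_iter) (use less.prems in \<open>auto simp: sum_distrib_left \<phi>_sum\<close>)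
  moreover have "\<phi> (x * prod_list xs) =
      (\<Sum>k=1..length (x # xs). boolean_cumulant \<phi> (take k (x # xs)) * \<phi> (prod_list (drop k (x # xs))))"
    using moment_boolean_cumulant_rec[of "x # xs" \<phi>] by simp
  \<comment> \<open>The index drops by one because the first block always contains
    \<open>x\<close>.\<close>
  moreover have "\<dots> = (\<Sum>k\<le>length xs. boolean_cumulant \<phi> (x # take k xs) * ?m k)"
    by (rule sum.reindex_bij_witness[of _ Suc "\<lambda>k. k - 1"]) (auto simp: take_Cons' drop_Cons')
  moreover have "(\<Sum>k<length xs. boolean_cumulant \<phi> (x # take k xs) * ?m k) =
      (\<Sum>k<length xs. ?m k * \<phi> (x * iter (take k xs)))"
    by (intro sum.cong refl) (simp add: less.hyps d(2))
  ultimately show ?case by (simp add: lessThan_Suc_atMost[symmetric])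
qed

end

section \<open>Neumann series\<close>

definition neumann :: "'a::{real_normed_algebra_1, banach} \<Rightarrow> 'a" where
  "neumann a = (\<Sum>n. a ^ n)"

lemma neumann_sums:
  fixes a :: "'a::{real_normed_algebra_1, banach}"
  assumes "norm a < 1"
  shows "(\<lambda>n. a ^ n) sums neumann a"
proof -
  have "summable (\<lambda>n. norm a ^ n)" using assms by (simp add: summable_geometric)
  then have "summable (\<lambda>n. a ^ n)"
    by (rule summable_comparison_test'[where N = 0]) (simp add: norm_power_ineq)
  then show ?thesis unfolding neumann_def by (rule summable_sums)
qed

lemma neumann_inverse:
  fixes a :: "'a::{real_normed_algebra_1, banach}"
  assumes "norm a < 1"
  shows "a * neumann a = neumann a - 1" "neumann a * a = neumann a - 1"
    "(1 - a) * neumann a = 1" "neumann a * (1 - a) = 1"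
proof -
  note s = neumann_sums[OF assms]
  have "(\<lambda>n. a ^ Suc n) sums (neumann a - 1)"
    using s by (subst sums_Suc_iff) simp
  moreover have "(\<lambda>n. a ^ Suc n) sums (a * neumann a)"
    using bounded_linear.sums[OF bounded_linear_mult_right s] by simp
  moreover have "(\<lambda>n. a ^ Suc n) sums (neumann a * a)"
    using bounded_linear.sums[OF bounded_linear_mult_left s, of a] by (simp only: power_Suc2)
  ultimately show "a * neumann a = neumann a - 1" "neumann a * a = neumann a - 1"
    using sums_unique2 by blast+
  then show "(1 - a) * neumann a = 1" "neumann a * (1 - a) = 1"
    by (simp_all add: left_diff_distrib right_diff_distrib)
qed

lemma norm_neumann:
  fixes a :: "'a::{real_normed_algebra_1, banach}"
  assumes "norm a \<le> 1 / 2"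
  shows "norm (neumann a) \<le> 2"
proof -
  have "norm (neumann a) = norm (1 + a * neumann a)" using assms by (simp add: neumann_inverse)
  also have "\<dots> \<le> 1 + norm a * norm (neumann a)"
    by (rule order_trans[OF norm_triangle_ineq]) (simp add: norm_mult_ineq)
  also have "\<dots> \<le> 1 + 1 / 2 * norm (neumann a)" using assms by (intro add_left_mono mult_right_mono) auto
  finally show ?thesis by simp
qed

lemma op_inverse_eqI:
  assumes "S * T = 1" "T * S = 1"
  shows "op_inverse T = S"
  unfolding op_inverse_def
proof (rule the_equality)
  fix S' assume "S' * T = 1 \<and> T * S' = 1"
  then show "S' = S" using assms by (metis mult.assoc mult_1_left mult_1_right)
qed (use assms in simp)

context tracial_functional
begin

lemma neumann_bipolar:
  assumes "X \<in> M" "a \<in> bipolar X" "norm a < 1"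
  shows "neumann a \<in> bipolar X"
  by (rule bipolar_sums[OF assms(1) neumann_sums[OF assms(3)]]) (rule bipolar_power[OF assms(1,2)])

lemma neumann_mem: "a \<in> M \<Longrightarrow> norm a < 1 \<Longrightarrow> neumann a \<in> M"
  by (rule sums_mem[OF neumann_sums]) auto

section \<open>Generating series of Boolean cumulants\<close>

text \<open>A Neumann series for a map that is linear and bounded on \<open>M\<close> only; the
  fixed-point equation is obtained by passing \<open>L\<close> through the partial sums with the
  bound \<open>l\<close>. The last conclusion sums generating series of cumulants.\<close>

lemma linear_fixed_point:
  fixes L :: "'h bop \<Rightarrow> 'h bop"
  assumes mem: "\<And>a. a \<in> M \<Longrightarrow> L a \<in> M" and add: "\<And>a b. a \<in> M \<Longrightarrow> b \<in> M \<Longrightarrow> L (a + b) = L a + L b"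
    and sc: "\<And>a c. a \<in> M \<Longrightarrow> L (c *\<^sub>C a) = c *\<^sub>C L a"
    and bound: "\<And>a. a \<in> M \<Longrightarrow> norm (L a) \<le> l * norm a" and small: "cmod w * l < 1" "0 \<le> l"
    and c: "c \<in> M"
  obtains y where "y \<in> M" "y = c + w *\<^sub>C L y"
    "\<And>F. F \<in> M \<Longrightarrow> (\<lambda>n. \<phi> (F * (L ^^ n) c) * w ^ n) sums \<phi> (F * y)"
proof -
  define x where "x n = w ^ n *\<^sub>C (L ^^ n) c" for n
  have itM: "(L ^^ n) c \<in> M" for n by (induction n) (auto simp: c mem)
  have xM: "x n \<in> M" for n by (simp add: x_def itM)
  have it_norm: "norm ((L ^^ n) c) \<le> l ^ n * norm c" for n
  proof (induction n)
    case (Suc n)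
    have "norm ((L ^^ Suc n) c) \<le> l * norm ((L ^^ n) c)" by (simp add: bound itM)
    also have "\<dots> \<le> l * (l ^ n * norm c)" using Suc small by (intro mult_left_mono) auto
    finally show ?case by (simp add: mult_ac)
  qed simp
  have x_norm: "norm (x n) \<le> (cmod w * l) ^ n * norm c" for n
    using mult_left_mono[OF it_norm[of n], of "cmod w ^ n"]
    by (simp add: x_def norm_scaleC_bop norm_power power_mult_distrib mult_ac)
  have "summable (\<lambda>n. (cmod w * l) ^ n * norm c)"
    using small by (intro summable_mult2 summable_geometric) simp
  then have "summable x"
    by (rule summable_comparison_test'[where N = 0]) (rule x_norm)
  then have sums: "x sums suminf x" by (rule summable_sums)
  define y where "y = suminf x"
  have yM: "y \<in> M" unfolding y_def by (rule sums_mem[OF sums xM])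
  have L_sum: "L (sum x {..<N}) = (\<Sum>n<N. L (x n))" for N
  proof (induction N)
    case 0
    show ?case using sc[OF one_mem, of 0] by simp
  qed (simp add: add xM)
  have "(\<lambda>N. sum x {..<N} - y) \<longlonglongrightarrow> 0" using sums by (simp add: sums_def y_def LIM_zero)
  then have "(\<lambda>N. l * norm (sum x {..<N} - y)) \<longlonglongrightarrow> 0"
    using tendsto_mult_right_zero tendsto_norm_zero by blast
  then have "(\<lambda>N. (\<Sum>n<N. L (x n)) - L y) \<longlonglongrightarrow> 0"
  proof (rule Lim_null_comparison[rotated], intro always_eventually allI)
    fix N
    have "L (sum x {..<N} - y) = L (sum x {..<N}) - L y"
      using add[of "sum x {..<N}" "(-1) *\<^sub>C y"] sc[OF yM, of "-1"] xM yM by simp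
    then show "norm ((\<Sum>n<N. L (x n)) - L y) \<le> l * norm (sum x {..<N} - y)"
      using bound[of "sum x {..<N} - y"] xM yM by (simp add: L_sum)
  qed
  then have "(\<lambda>n. L (x n)) sums L y" by (simp add: sums_def LIM_zero_iff)
  then have "(\<lambda>n. w *\<^sub>C L (x n)) sums (w *\<^sub>C L y)"
    by (rule bounded_linear.sums[OF bounded_linear_scaleC_bop])
  moreover have "w *\<^sub>C L (x n) = x (Suc n)" for n by (simp add: x_def sc itM)
  ultimately have "(\<lambda>n. x (Suc n)) sums (w *\<^sub>C L y)" by simp
  then have "x sums (w *\<^sub>C L y + x 0)" by (rule sums_Suc)
  then have "y = w *\<^sub>C L y + x 0" using sums sums_unique2 unfolding y_def by blast
  then have yc: "y = c + w *\<^sub>C L y" by (simp add: x_def add.commute)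
  have "(\<lambda>n. \<phi> (F * (L ^^ n) c) * w ^ n) sums \<phi> (F * y)" if F: "F \<in> M" for F
  proof -
    have "(\<lambda>n. \<phi> (F * x n)) sums \<phi> (F * y)"
      unfolding y_def using F xM by (intro \<phi>_sums bounded_linear.sums[OF bounded_linear_mult_right sums]) auto
    then show ?thesis using F itM by (simp add: x_def mult.commute)
  qed
  then show thesis using that yM yc by blast
qed

lemma centre_mult_bound:
  assumes "X \<in> M" "a \<in> M"
  shows "norm (centre (X * a)) \<le> (1 + bd) * norm X * norm a"
proof -
  have "norm (centre (X * a)) \<le> (1 + bd) * norm (X * a)" using assms by (intro norm_centre) simp
  also have "\<dots> \<le> (1 + bd) * (norm X * norm a)"
    using bd_ge_one by (intro mult_left_mono norm_mult_ineq) simp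
  finally show ?thesis by simp
qed

text \<open>The fixed point \<open>y\<close> of \<open>y = c + w centre (X y)\<close> satisfies \<open>(1 - w X) y = c - \<kappa>\<close> with a scalar \<open>\<kappa>\<close>
  which is determined by \<open>\<phi> y = \<phi> c\<close>.\<close>

lemma resolvent_fixed_point:
  assumes X: "X \<in> M" and c: "c \<in> M" and small: "cmod w * ((1 + bd) * norm X) < 1"
    and R: "R \<in> M" "R * (1 - w *\<^sub>C X) = 1" and \<alpha>: "\<alpha> * \<phi> R = 1" and F: "F \<in> M"
  shows "(\<lambda>n. \<phi> (F * ((\<lambda>y. centre (X * y)) ^^ n) c) * w ^ n) sums
    (\<phi> (F * (R * c)) - \<alpha> * (\<phi> (R * c) - \<phi> c) * \<phi> (F * R))"
proof -
  let ?L = "\<lambda>y. centre (X * y)"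
  obtain y where y: "y \<in> M" "y = c + w *\<^sub>C ?L y"
    and sums: "\<And>F. F \<in> M \<Longrightarrow> (\<lambda>n. \<phi> (F * (?L ^^ n) c) * w ^ n) sums \<phi> (F * y)"
    by (rule linear_fixed_point[of ?L "(1 + bd) * norm X" w c])
      (use X c small bd_ge_one in \<open>auto simp: distrib_left centre_add centre_scaleC centre_mult_bound\<close>)
  define \<kappa> where "\<kappa> = w * \<phi> (X * y)"
  have "(1 - w *\<^sub>C X) * y = c - \<kappa> *\<^sub>C 1"
    using y(2) by (simp add: left_diff_distrib centre_def \<kappa>_def) (metis add_diff_cancel diff_add_eq diff_diff_eq2)
  then have "R * ((1 - w *\<^sub>C X) * y) = R * (c - \<kappa> *\<^sub>C 1)" by simp
  moreover have "R * ((1 - w *\<^sub>C X) * y) = y" by (simp only: mult.assoc[symmetric] R(2) mult_1_left)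
  ultimately have yR: "y = R * c - \<kappa> *\<^sub>C R" by (simp add: right_diff_distrib)
  have "\<phi> y = \<phi> (c + w *\<^sub>C ?L y)" by (rule arg_cong[OF y(2)])
  then have "\<phi> y = \<phi> c" using y(1) X c by simp
  then have "\<kappa> * \<phi> R = \<phi> (R * c) - \<phi> c" using R(1) c by (simp add: yR algebra_simps)
  then have "\<kappa> = \<alpha> * (\<phi> (R * c) - \<phi> c)" using \<alpha> by (metis mult.assoc mult.commute mult.right_neutral)
  then have "\<phi> (F * y) = \<phi> (F * (R * c)) - \<alpha> * (\<phi> (R * c) - \<phi> c) * \<phi> (F * R)"
    unfolding yR using F R(1) c by (simp add: right_diff_distrib left_diff_distrib mult.assoc)
  then show ?thesis using sums[OF F] by simp
qed

text \<open>The case \<open>c = 1\<close> of \<open>resolvent_fixed_point\<close>, simplified by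
  \<open>\<alpha> * \<phi> R = 1\<close>.\<close>

lemma eta1_eq:
  assumes "X \<in> M" "F \<in> M" "cmod w * ((1 + bd) * norm X) < 1"
    and "R \<in> M" "R * (1 - w *\<^sub>C X) = 1" "\<alpha> * \<phi> R = 1"
  shows "eta1 \<phi> X F w = \<alpha> * \<phi> (F * R)"
proof -
  have it: "iter (replicate n X) = ((\<lambda>y. centre (X * y)) ^^ n) 1" for n
    by (induction n) auto
  have cum: "boolean_cumulant \<phi> (F # replicate n X) = \<phi> (F * ((\<lambda>y. centre (X * y)) ^^ n) 1)" for n
    unfolding it[symmetric] using assms by (intro boolean_cumulant_eq_iter) auto
  have "(\<lambda>n. boolean_cumulant \<phi> (F # replicate n X) * w ^ n) sums
      (\<phi> (F * (R * 1)) - \<alpha> * (\<phi> (R * 1) - \<phi> 1) * \<phi> (F * R))"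
    using resolvent_fixed_point[OF assms(1) one_mem assms(3-6,2)] by (simp only: cum)
  moreover have "\<phi> (F * (R * 1)) - \<alpha> * (\<phi> (R * 1) - \<phi> 1) * \<phi> (F * R) = \<alpha> * \<phi> (F * R)"
    using assms(6) by (simp add: algebra_simps)
  ultimately show ?thesis unfolding eta1_def by (simp only: sums_unique[symmetric])
qed

text \<open>Here the iteration starts from \<open>centre G\<close>. The normalisation
  \<open>\<alpha> * \<phi> R = 1\<close> cancels the contribution of the scalar
  \<open>\<phi> G\<close>, so \<open>G\<close> itself may be written in the result.\<close>

lemma eta2_eq:
  assumes "X \<in> M" "F \<in> M" "G \<in> M" "cmod w * ((1 + bd) * norm X) < 1"
    and "R \<in> M" "R * (1 - w *\<^sub>C X) = 1" "\<alpha> * \<phi> R = 1"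
  shows "eta2 \<phi> X F G w = \<phi> (F * (R * G)) - \<alpha> * \<phi> (R * G) * \<phi> (F * R)"
proof -
  have it: "iter (replicate n X @ [G]) = ((\<lambda>y. centre (X * y)) ^^ n) (centre G)" for n
    by (induction n) auto
  have cum: "boolean_cumulant \<phi> (F # replicate n X @ [G]) = \<phi> (F * ((\<lambda>y. centre (X * y)) ^^ n) (centre G))" for n
    unfolding it[symmetric] using assms by (intro boolean_cumulant_eq_iter) auto
  have "(\<lambda>n. boolean_cumulant \<phi> (F # replicate n X @ [G]) * w ^ n) sums
      (\<phi> (F * (R * centre G)) - \<alpha> * (\<phi> (R * centre G) - \<phi> (centre G)) * \<phi> (F * R))"
    using resolvent_fixed_point[OF assms(1) centre_mem[OF assms(3)] assms(4-7,2)] by (simp only: cum)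
  moreover have "\<phi> (F * (R * centre G)) - \<alpha> * (\<phi> (R * centre G) - \<phi> (centre G)) * \<phi> (F * R) =
      \<phi> (F * (R * G)) - \<alpha> * \<phi> (R * G) * \<phi> (F * R)"
  proof -
    have "\<phi> (F * (R * centre G)) - \<alpha> * (\<phi> (R * centre G) - \<phi> (centre G)) * \<phi> (F * R) =
      \<phi> (F * (R * G)) - \<alpha> * \<phi> (R * G) * \<phi> (F * R) - (1 - \<alpha> * \<phi> R) * \<phi> G * \<phi> (F * R)"
      using assms by (simp add: centre_def right_diff_distrib algebra_simps)
    then show ?thesis using assms(7) by simp
  qed
  ultimately show ?thesis unfolding eta2_def by (simp only: sums_unique[symmetric])
qed

text \<open>Centring twice per period leaves two unknown scalars:
  \<open>y = \<kappa> *\<^sub>C S - \<omega> *\<^sub>C (S * Y)\<close>. They are tied together by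
  \<open>\<phi> y = 1\<close> and \<open>\<omega> = z * \<phi> (X * y)\<close>, and eliminating
  \<kappa> leaves an equation for \<omega> in moments of \<open>S\<close>.\<close>

lemma alternating_cumulant_series:
  assumes X: "X \<in> M" and Y: "Y \<in> M" and small: "cmod z * ((1 + bd) * norm Y * ((1 + bd) * norm X)) < 1"
    "norm (z *\<^sub>C (Y * X)) < 1"
    and sums: "(\<lambda>k. boolean_cumulant \<phi> (alternating X Y k) * z ^ Suc k) sums \<omega>"
  defines "S \<equiv> neumann (z *\<^sub>C (Y * X))"
  shows "\<omega> * ((\<phi> S)\<^sup>2 - z * \<phi> (X * S) * \<phi> (S * Y)) = z * \<phi> (X * S)"
proof -
  let ?L = "\<lambda>y. centre (Y * centre (X * y))"
  have bound: "norm (?L a) \<le> (1 + bd) * norm Y * ((1 + bd) * norm X) * norm a" if "a \<in> M" for a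
  proof -
    have "norm (?L a) \<le> (1 + bd) * norm Y * norm (centre (X * a))"
      using X Y that by (intro centre_mult_bound) auto
    also have "\<dots> \<le> (1 + bd) * norm Y * ((1 + bd) * norm X * norm a)"
      using X that bd_ge_one by (intro mult_left_mono centre_mult_bound) auto
    finally show ?thesis by (simp add: mult_ac)
  qed
  obtain y where y: "y \<in> M" "y = 1 + z *\<^sub>C ?L y"
    and s: "\<And>F. F \<in> M \<Longrightarrow> (\<lambda>n. \<phi> (F * (?L ^^ n) 1) * z ^ n) sums \<phi> (F * y)"
    by (rule linear_fixed_point[of ?L "(1 + bd) * norm Y * ((1 + bd) * norm X)" z 1])
      (use X Y small(1) bd_ge_one bound in \<open>auto simp: distrib_left centre_add centre_scaleC\<close>)
  have it: "iter (concat (replicate n [Y, X])) = (?L ^^ n) 1" for n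
    by (induction n) auto
  have mem: "set (concat (replicate n [Y, X])) \<subseteq> M" for n using X Y by (induction n) auto
  have "(\<lambda>k. z * (boolean_cumulant \<phi> (alternating X Y k) * z ^ k)) sums (z * \<phi> (X * y))"
    using s[OF X] by (intro sums_mult) (simp only: alternating_def boolean_cumulant_eq_iter[OF X mem] it)
  then have \<omega>: "\<omega> = z * \<phi> (X * y)"
    using sums sums_unique2 by (simp add: mult_ac)
  define \<kappa> where "\<kappa> = 1 - z * \<phi> (Y * centre (X * y))"
  have SM: "S \<in> M" unfolding S_def using X Y small(2) by (intro neumann_mem) auto
  have Sinv: "S * (1 - z *\<^sub>C (Y * X)) = 1" "(1 - z *\<^sub>C (Y * X)) * S = 1"
    unfolding S_def using small(2) by (simp_all add: neumann_inverse)
  have zL: "z *\<^sub>C ?L y = z *\<^sub>C (Y * X * y) - \<omega> *\<^sub>C Y - (1 - \<kappa>) *\<^sub>C 1"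
    unfolding centre_def[of "Y * _"] by (simp add: centre_def \<kappa>_def \<omega> right_diff_distrib mult.assoc)
  have "(1 - z *\<^sub>C (Y * X)) * y = y - z *\<^sub>C (Y * X * y)" by (simp add: left_diff_distrib)
  also have "\<dots> = 1 + z *\<^sub>C ?L y - z *\<^sub>C (Y * X * y)" using y(2) by simp
  also have "\<dots> = \<kappa> *\<^sub>C 1 - \<omega> *\<^sub>C Y" unfolding zL by simp
  finally have "S * ((1 - z *\<^sub>C (Y * X)) * y) = S * (\<kappa> *\<^sub>C 1 - \<omega> *\<^sub>C Y)" by simp
  moreover have "S * ((1 - z *\<^sub>C (Y * X)) * y) = y" by (simp only: mult.assoc[symmetric] Sinv mult_1_left)
  ultimately have yS: "y = \<kappa> *\<^sub>C S - \<omega> *\<^sub>C (S * Y)" by (simp add: right_diff_distrib)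
  have "\<phi> y = \<phi> (1 + z *\<^sub>C ?L y)" by (rule arg_cong[OF y(2)])
  then have "\<phi> y = 1" using y(1) X Y by simp
  then have 1: "\<kappa> * \<phi> S - \<omega> * \<phi> (S * Y) = 1" using SM Y by (simp add: yS)
  \<comment> \<open>The trace brings \<open>Y\<close> and \<open>X\<close> together, so that the
    resolvent identity for \<open>S\<close> applies.\<close>
  have "z * \<phi> (X * (S * Y)) = \<phi> (S * (z *\<^sub>C (Y * X)))"
    using \<phi>_trace[of X "S * Y"] X Y SM by (simp add: mult.assoc)
  also have "S * (z *\<^sub>C (Y * X)) = S - 1"
    using Sinv(1) by (simp add: right_diff_distrib) (metis add_diff_cancel_left' diff_add_cancel)
  finally have A: "z * \<phi> (X * (S * Y)) = \<phi> S - 1" using SM by simp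
  have B: "\<omega> = \<kappa> * (z * \<phi> (X * S)) - \<omega> * (z * \<phi> (X * (S * Y)))"
  proof -
    have "\<phi> (X * y) = \<kappa> * \<phi> (X * S) - \<omega> * \<phi> (X * (S * Y))"
      unfolding yS using X Y SM by (simp add: right_diff_distrib)
    from trans[OF \<omega> arg_cong[OF this, of "(*) z"]] show ?thesis
      by (simp only: right_diff_distrib mult.left_commute)
  qed
  have 2: "\<omega> * \<phi> S = \<kappa> * (z * \<phi> (X * S))" using B[unfolded A] by (simp add: algebra_simps)
  have "\<omega> * (\<phi> S)\<^sup>2 = (\<kappa> * \<phi> S) * (z * \<phi> (X * S))"
    using 2 by (simp add: power2_eq_square mult.assoc[symmetric])
  also have "\<kappa> * \<phi> S = 1 + \<omega> * \<phi> (S * Y)" using 1 by (simp add: algebra_simps)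
  finally show ?thesis by (simp add: algebra_simps)
qed

end

section \<open>Free independence and the subordination identities\<close>

section \<open>Freeness\<close>

locale free_pair = tracial_functional M \<phi> bd
  for M :: "'h::complex_hilbert bop set" and \<phi> bd +
  fixes U V :: "'h bop"
  assumes U_mem [simp]: "U \<in> M" and V_mem [simp]: "V \<in> M" and free: "free_elements \<phi> U V"
begin

abbreviation "gen i \<equiv> if i then U else V"

lemma gen_mem [simp]: "gen i \<in> M"
  by simp

lemma unital_algebra_generated_mem:
  assumes "X \<in> M" "T \<in> unital_algebra_generated X"
  shows "T \<in> M"
  using assms by (auto simp: unital_algebra_generated_def)

text \<open>Polynomials are replaced by elements of the bipolar one position at a time, moving the remaining
  factors to the other side by the trace property.\<close>

lemma free_word_mixed:
  assumes "ys @ zs \<noteq> []" "distinct_adj (map fst (ys @ zs))"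
    and "\<And>i a. (i, a) \<in> set ys \<Longrightarrow> a \<in> bipolar (gen i) \<and> \<phi> a = 0"
    and "\<And>i a. (i, a) \<in> set zs \<Longrightarrow> a \<in> unital_algebra_generated (gen i) \<and> \<phi> a = 0"
  shows "\<phi> (prod_list (map snd (ys @ zs))) = 0"
  using assms
\<comment> \<open>The last bipolar letter is replaced by centred powers, which join the polynomial
  letters \<open>zs\<close>; this is why \<open>zs\<close> is arbitrary.\<close>
proof (induction ys arbitrary: zs rule: rev_induct)
  case Nil
  have "\<forall>(i, a)\<in>set zs. a \<in> unital_algebra_generated (gen i) \<and> \<phi> a = 0" using Nil.prems(4) by blast
  then show ?case
    using free Nil.prems(1,2) unfolding free_elements_def free_subalgebras_def append_Nil by blast
next
  case (snoc p ys)
  obtain i T where p: "p = (i, T)" by (cases p)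
  let ?X = "gen i"
  have T: "T \<in> bipolar ?X" "\<phi> T = 0" using snoc.prems(3)[of i T] by (auto simp: p)
  have TM: "T \<in> M" using T(1) by (rule bipolar_mem)
  have ysM: "prod_list (map snd ys) \<in> M"
    using snoc.prems(3) bipolar_mem by (intro prod_list_mem) (force simp: subset_iff)
  have zsM: "prod_list (map snd zs) \<in> M"
    using snoc.prems(4) unital_algebra_generated_mem[OF gen_mem] by (intro prod_list_mem) (force simp: subset_iff)
  define c where "c = prod_list (map snd zs) * prod_list (map snd ys)"
  have cM: "c \<in> M" using ysM zsM by (simp add: c_def)
  have tr: "\<phi> (prod_list (map snd ys) * (a * prod_list (map snd zs))) = \<phi> (a * c)" if "a \<in> M" for a
    using \<phi>_trace[of "prod_list (map snd ys)" "a * prod_list (map snd zs)"] ysM zsM that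
    by (simp add: c_def mult.assoc)
  \<comment> \<open>The induction hypothesis concerns centred powers; subtracting
    \<open>\<phi> c\<close> from \<open>c\<close> instead makes it a statement about the powers
    themselves, as \<open>bipolarD\<close> demands.\<close>
  have "\<phi> (?X ^ k * (c - \<phi> c *\<^sub>C 1)) = 0" for k
  proof -
    have P: "?X ^ k - \<phi> (?X ^ k) *\<^sub>C 1 \<in> unital_algebra_generated ?X"
      using unital_algebra_generated_closed(3)[OF unital_algebra_generated_closed(2)
          unital_algebra_generated_closed(4)[OF unital_algebra_generated_closed(1)], of ?X k "- \<phi> (?X ^ k)"]
      by simp
    have "\<phi> (prod_list (map snd (ys @ (i, ?X ^ k - \<phi> (?X ^ k) *\<^sub>C 1) # zs))) = 0"
    proof (rule snoc.IH)
      show "distinct_adj (map fst (ys @ (i, ?X ^ k - \<phi> (?X ^ k) *\<^sub>C 1) # zs))"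
        using snoc.prems(2) by (simp add: p)
      show "a \<in> bipolar (gen j) \<and> \<phi> a = 0" if "(j, a) \<in> set ys" for j a
        using snoc.prems(3) that by auto
      show "a \<in> unital_algebra_generated (gen j) \<and> \<phi> a = 0"
        if "(j, a) \<in> set ((i, ?X ^ k - \<phi> (?X ^ k) *\<^sub>C 1) # zs)" for j a
      proof -
        have z: "\<phi> (?X ^ k - \<phi> (?X ^ k) *\<^sub>C 1) = 0" by simp
        from that consider "j = i" "a = ?X ^ k - \<phi> (?X ^ k) *\<^sub>C 1" | "(j, a) \<in> set zs"
          unfolding list.set insert_iff prod.inject by blast
        then show ?thesis
        proof cases
          case 1
          show ?thesis unfolding 1 using P z by (rule conjI)
        next
          case 2
          then show ?thesis by (rule snoc.prems(4))
        qed
      qed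
    qed simp
    then have "\<phi> ((?X ^ k - \<phi> (?X ^ k) *\<^sub>C 1) * c) = 0" using tr[of "?X ^ k - \<phi> (?X ^ k) *\<^sub>C 1"] by simp
    then show ?thesis using cM by (simp add: left_diff_distrib right_diff_distrib mult.commute)
  qed
  from bipolarD[OF T(1) _ this] have "\<phi> (T * (c - \<phi> c *\<^sub>C 1)) = 0" using cM by simp
  then have "\<phi> (T * c) = 0" using T(2) TM cM by (simp add: right_diff_distrib)
  then show ?case using tr[OF TM] by (simp add: p)
qed

lemma free_word:
  assumes "xs \<noteq> []" "distinct_adj (map fst xs)"
    and "\<And>i a. (i, a) \<in> set xs \<Longrightarrow> a \<in> bipolar (gen i) \<and> \<phi> a = 0"
  shows "\<phi> (prod_list (map snd xs)) = 0"
  using free_word_mixed[of xs "[]"] assms by simp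

text \<open>Symmetry of freeness, by flipping the tags of words; it carries results about
  \<open>w2\<close> over to \<open>w1\<close>.\<close>

lemma swap_free_pair: "free_pair M \<phi> bd V U"
proof
  show "free_elements \<phi> V U"
    unfolding free_elements_def free_subalgebras_def
  proof (intro allI impI)
    fix xs :: "(bool \<times> 'h bop) list"
    assume xs: "xs \<noteq> []" "distinct_adj (map fst xs)"
      and mem: "\<forall>(i, a)\<in>set xs. a \<in> unital_algebra_generated (if i then V else U) \<and> \<phi> a = 0"
    define ys where "ys = map (map_prod Not id) xs"
    have f: "map fst ys = map Not (map fst xs)" and s: "map snd ys = map snd xs" by (simp_all add: ys_def)
    have "distinct_adj (map fst ys)" unfolding f by (rule distinct_adj_mapI[OF xs(2)]) (simp add: inj_on_def)
    moreover have "ys \<noteq> []" using xs(1) by (simp add: ys_def)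
    moreover have "\<forall>(i, a)\<in>set ys. a \<in> unital_algebra_generated (if i then U else V) \<and> \<phi> a = 0"
    proof (rule ballI, rule case_prodI2)
      fix p i c assume "p \<in> set ys" "p = (i, c)"
      then have "(\<not> i, c) \<in> set xs" by (auto simp: ys_def)
      then have "c \<in> unital_algebra_generated (if \<not> i then V else U) \<and> \<phi> c = 0" using mem by blast
      then show "c \<in> unital_algebra_generated (if i then U else V) \<and> \<phi> c = 0" by (cases i) simp_all
    qed
    ultimately have "\<phi> (prod_list (map snd ys)) = 0"
      using free unfolding free_elements_def free_subalgebras_def by blast
    then show "\<phi> (prod_list (map snd xs)) = 0" by (simp add: s)
  qed
qed simp_all

lemma U_bipolar: "a \<in> bipolar U \<Longrightarrow> centre a \<in> bipolar U"
  and V_bipolar: "a \<in> bipolar V \<Longrightarrow> centre a \<in> bipolar V"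
  unfolding centre_def by (intro bipolar_diff bipolar_closed; simp)+

text \<open>The middle part starts with a letter from \<open>U\<close> and ends with one from
  \<open>V\<close>, so \<open>t\<close> on the left and \<open>x\<close> on the right continue the
  alternation. Splitting these two into scalar and centred parts leaves four alternating centred
  words, all of which vanish.\<close>

lemma alternating_word_zero:
  assumes e: "e \<in> bipolar U" "\<phi> e = 0" and w: "w \<in> bipolar V" "\<phi> w = 0"
    and a: "a \<in> bipolar U" "\<phi> a = 0" and b: "b \<in> bipolar V" "\<phi> b = 0"
    and t: "t \<in> bipolar V" and x: "x \<in> bipolar U"
  shows "\<phi> (t * (e * (w * ((a * b) ^ m * x)))) = 0"
proof -
  define W where "W = (True, e) # (False, w) # concat (replicate m [(True, a), (False, b)])"
  define Y where "Y = e * (w * (a * b) ^ m)"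
  have "prod_list (map snd (concat (replicate m [(True, a), (False, b)]))) = (a * b) ^ m"
    by (induction m) (simp_all add: mult.assoc)
  then have prodW: "prod_list (map snd W) = Y"
    unfolding W_def Y_def by simp
  have tags: "map fst W = concat (replicate (Suc m) [True, False])"
    unfolding W_def by (induction m) simp_all
  have adj: "distinct_adj (map fst W)" "distinct_adj (False # map fst W)"
    "distinct_adj (map fst W @ [True])" "distinct_adj (False # map fst W @ [True])"
    unfolding tags by (induction m) auto
  have memW: "c \<in> bipolar (gen i) \<and> \<phi> c = 0" if "(i, c) \<in> set W" for i c
    using that e w a b by (auto simp: W_def split: if_splits)
  have mem: "c \<in> bipolar (gen i) \<and> \<phi> c = 0"
    if "(i, c) \<in> set ((False, centre t) # W @ [(True, centre x)])" for i c
    using that t x by (auto dest!: memW simp: U_bipolar V_bipolar split: if_splits)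
  have M: "e \<in> M" "w \<in> M" "a \<in> M" "b \<in> M" "t \<in> M" "x \<in> M"
    using e w a b t x bipolar_mem by blast+
  have zero: "\<phi> (prod_list (map snd xs)) = 0"
    if "xs \<noteq> []" "distinct_adj (map fst xs)" "set xs \<subseteq> set ((False, centre t) # W @ [(True, centre x)])" for xs
    by (rule free_word[OF that(1,2)]) (rule mem, use that(3) in blast)
  have 1: "\<phi> Y = 0"
    using zero[of W] adj(1) by (simp add: prodW subset_insertI2) (simp add: W_def)
  have 2: "\<phi> (centre t * Y) = 0"
    using zero[of "(False, centre t) # W"] adj(2) by (simp add: prodW subset_insertI2)
  have 3: "\<phi> (Y * centre x) = 0"
    using zero[of "W @ [(True, centre x)]"] adj(3) by (simp add: prodW subset_insertI2)
  have 4: "\<phi> (centre t * Y * centre x) = 0"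
    using zero[of "(False, centre t) # W @ [(True, centre x)]"] adj(4) by (simp add: prodW mult.assoc)
  have YM: "Y \<in> M" using M by (simp add: Y_def)
  have "t * Y * x = centre t * Y * centre x + \<phi> x *\<^sub>C (centre t * Y) + \<phi> t *\<^sub>C (Y * centre x)
      + (\<phi> t * \<phi> x) *\<^sub>C Y"
    by (simp add: centre_def algebra_simps)
  also have "\<phi> \<dots> = 0" using M YM by (simp add: 1 2 3 4)
  finally show ?thesis by (simp add: Y_def mult.assoc)
qed

lemma free_product2:
  assumes t: "t \<in> bipolar V" and x: "x \<in> bipolar U"
  shows "\<phi> (t * x) = \<phi> t * \<phi> x"
proof -
  have M: "t \<in> M" "x \<in> M" using t x bipolar_mem by blast+
  have "c \<in> bipolar (gen i) \<and> \<phi> c = 0" if "(i, c) \<in> set [(False, centre t), (True, centre x)]" for i c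
    using that t x M by (auto simp: U_bipolar V_bipolar)
  then have "\<phi> (prod_list (map snd [(False, centre t), (True, centre x)])) = 0"
    by (intro free_word) auto
  then have "\<phi> (centre t * centre x) = 0" by simp
  then show ?thesis using M by (simp add: centre_def left_diff_distrib right_diff_distrib)
qed

lemma free_power_zero:
  assumes "a \<in> bipolar U" "\<phi> a = 0" "b \<in> bipolar V" "\<phi> b = 0" "t \<in> bipolar V" "x \<in> bipolar U"
  shows "\<phi> (t * ((a * b) ^ Suc m * x)) = 0"
  using alternating_word_zero[of a b a b t x m] assms by (simp add: mult.assoc)

text \<open>With a \<open>V\<close>-element on the left and a \<open>U\<close>-element on the right
  of \<open>a * b\<close>, no neighbouring letters merge, so every term of positive order
  vanishes.\<close>

lemma free_geometric:
  assumes a: "a \<in> bipolar U" "\<phi> a = 0" and b: "b \<in> bipolar V" "\<phi> b = 0"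
    and small: "norm (s *\<^sub>C (a * b)) < 1" and t: "t \<in> bipolar V" and x: "x \<in> bipolar U"
  shows "\<phi> (t * (neumann (s *\<^sub>C (a * b)) * x)) = \<phi> t * \<phi> x"
proof -
  have M: "a \<in> M" "b \<in> M" "t \<in> M" "x \<in> M" using a b t x bipolar_mem by blast+
  have "(\<lambda>n. t * ((s *\<^sub>C (a * b)) ^ n * x)) sums (t * (neumann (s *\<^sub>C (a * b)) * x))"
    by (intro bounded_linear.sums[OF bounded_linear_mult_right] bounded_linear.sums[OF bounded_linear_mult_left]
        neumann_sums small)
  then have 1: "(\<lambda>n. \<phi> (t * ((s *\<^sub>C (a * b)) ^ n * x))) sums \<phi> (t * (neumann (s *\<^sub>C (a * b)) * x))"
    by (rule \<phi>_sums) (use M in simp)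
  have 0: "\<phi> (t * ((s *\<^sub>C (a * b)) ^ n * x)) = 0" if "n \<noteq> 0" for n
    using free_power_zero[OF a b t x, of "n - 1"] that M by (cases n) (simp_all add: scaleC_bop_power)
  have "(\<lambda>n. \<phi> (t * ((s *\<^sub>C (a * b)) ^ n * x))) sums (\<Sum>n\<in>{0}. \<phi> (t * ((s *\<^sub>C (a * b)) ^ n * x)))"
    by (rule sums_finite) (use 0 in auto)
  then show ?thesis using 1 sums_unique2 free_product2[OF t x] by fastforce
qed

text \<open>Only the terms of order 0 and 1 of the Neumann series survive.\<close>

lemma free_geometric4:
  assumes a: "a \<in> bipolar U" "\<phi> a = 0" and b: "b \<in> bipolar V" "\<phi> b = 0"
    and small: "norm (s *\<^sub>C (a * b)) < 1" and t: "t \<in> bipolar V" and F: "F \<in> bipolar U"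
    and w: "w \<in> bipolar V" and x: "x \<in> bipolar U"
  shows "\<phi> (t * (F * (w * (neumann (s *\<^sub>C (a * b)) * x)))) =
    \<phi> F * \<phi> x * \<phi> (t * w) + \<phi> w * \<phi> t * (\<phi> (F * x) - \<phi> F * \<phi> x)
      + s * \<phi> w * \<phi> (F * a) * \<phi> (t * b) * \<phi> x"
proof -
  have M: "a \<in> M" "b \<in> M" "t \<in> M" "x \<in> M" "F \<in> M" "w \<in> M" using a b t x F w bipolar_mem by blast+
  let ?Z = "\<lambda>n. (a * b) ^ n * x"
  have Ft: "centre F \<in> bipolar U" "\<phi> (centre F) = 0" "centre w \<in> bipolar V" "\<phi> (centre w) = 0"
    using F w M by (simp_all add: U_bipolar V_bipolar)
  have tw: "t * w \<in> bipolar V" by (intro bipolar_closed t w V_mem)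
  \<comment> \<open>\<open>F\<close> and \<open>w\<close> are split into scalar and centred parts;
    the word in which both are centred vanishes.\<close>
  have split: "\<phi> (t * (F * (w * ?Z n))) = \<phi> F * \<phi> (t * w * ?Z n) + \<phi> w * \<phi> (t * (centre F * ?Z n))" for n
  proof -
    have "t * (F * (w * ?Z n)) = t * (centre F * (centre w * ?Z n)) + \<phi> F *\<^sub>C (t * w * ?Z n) + \<phi> w *\<^sub>C (t * (centre F * ?Z n))"
      by (simp add: centre_def algebra_simps)
    also have "\<phi> \<dots> = \<phi> (t * (centre F * (centre w * ?Z n))) + \<phi> F * \<phi> (t * w * ?Z n) + \<phi> w * \<phi> (t * (centre F * ?Z n))"
      using M by simp
    finally show ?thesis using alternating_word_zero[OF Ft a b t x, of n] by simp
  qed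
  have v0: "\<phi> (t * (F * (w * ?Z 0))) = \<phi> F * \<phi> x * \<phi> (t * w) + \<phi> w * \<phi> t * (\<phi> (F * x) - \<phi> F * \<phi> x)"
  proof -
    have "\<phi> (t * (centre F * x)) = \<phi> t * \<phi> (centre F * x)"
      by (intro free_product2 bipolar_closed t x U_mem Ft)
    then show ?thesis
      unfolding split using free_product2[OF tw x] M by (simp add: centre_def left_diff_distrib)
  qed
  have vS: "\<phi> (t * (F * (w * ?Z (Suc m)))) = \<phi> w * (\<phi> (F * a) * \<phi> (t * b * ?Z m))" for m
  proof -
    \<comment> \<open>Now \<open>centre F\<close> meets \<open>a\<close>, a letter of its own
      algebra. The centred part of their product gives a vanishing word, the scalar
      \<open>\<phi> (F * a)\<close> removes one factor \<open>a\<close> and leaves \<open>b\<close>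
      next to \<open>t\<close>.\<close>
    let ?d = "centre (centre F * a)"
    have d: "?d \<in> bipolar U" "\<phi> ?d = 0"
      using Ft a M by (auto intro!: U_bipolar bipolar_closed)
    have "\<phi> (centre F * a) = \<phi> (F * a)"
      using M a(2) by (simp add: centre_def left_diff_distrib)
    then have "t * (centre F * ?Z (Suc m)) = t * (?d * (b * ?Z m)) + \<phi> (F * a) *\<^sub>C (t * b * ?Z m)"
      unfolding centre_def[of "centre F * a"] by (simp add: algebra_simps)
    then have "\<phi> (t * (centre F * ?Z (Suc m))) = \<phi> (F * a) * \<phi> (t * b * ?Z m)"
      using alternating_word_zero[OF d b a b t x, of m] M by simp
    then show ?thesis unfolding split using free_power_zero[OF a b tw x, of m] by simp
  qed
  have tb: "t * b \<in> bipolar V" by (intro bipolar_closed t b V_mem)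
  have v1: "\<phi> (t * (F * (w * ?Z 1))) = \<phi> w * (\<phi> (F * a) * (\<phi> (t * b) * \<phi> x))"
    using vS[of 0] free_product2[OF tb x] by simp
  have v2: "\<phi> (t * (F * (w * ?Z n))) = 0" if n: "n \<notin> {0, 1}" for n
  proof -
    obtain m where "n = Suc (Suc m)" using n by (metis One_nat_def insertCI not0_implies_Suc)
    then show ?thesis using vS[of "Suc m"] free_power_zero[OF a b tb x, of m] by simp
  qed
  let ?f = "\<lambda>n. \<phi> (t * (F * (w * ((s *\<^sub>C (a * b)) ^ n * x))))"
  have f: "?f n = s ^ n * \<phi> (t * (F * (w * ?Z n)))" for n
    using M by (simp add: scaleC_bop_power)
  have "(\<lambda>n. t * (F * (w * ((s *\<^sub>C (a * b)) ^ n * x)))) sums (t * (F * (w * (neumann (s *\<^sub>C (a * b)) * x))))"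
    by (intro bounded_linear.sums[OF bounded_linear_mult_right] bounded_linear.sums[OF bounded_linear_mult_left]
        neumann_sums small)
  then have 1: "?f sums \<phi> (t * (F * (w * (neumann (s *\<^sub>C (a * b)) * x))))"
    by (rule \<phi>_sums) (use M in simp)
  have "?f sums (\<Sum>n\<in>{0, 1}. ?f n)"
    by (rule sums_finite) (use v2 in \<open>auto simp: f\<close>)
  then have "\<phi> (t * (F * (w * (neumann (s *\<^sub>C (a * b)) * x)))) = ?f 0 + ?f 1"
    using 1 sums_unique2 by fastforce
  then show ?thesis unfolding f v0 v1 by simp
qed

end

section \<open>Subordination\<close>

text \<open>Everything at one fixed \<open>z\<close>, with \<open>w1\<close> and \<open>w2\<close>
  as mere numbers. The conditions are symmetric under exchanging \<open>U\<close> and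
  \<open>V\<close>, so that statements about \<open>w1\<close> follow from those about
  \<open>w2\<close>.\<close>

locale subordination = free_pair M \<phi> bd U V
  for M :: "'h::complex_hilbert bop set" and \<phi> bd U V +
  fixes z w1 w2 \<alpha> :: complex and R1 R2 :: "'h bop"
  assumes R1: "R1 \<in> bipolar U" "R1 * (1 - w2 *\<^sub>C U) = 1" "(1 - w2 *\<^sub>C U) * R1 = 1"
    and R2: "R2 \<in> bipolar V" "R2 * (1 - w1 *\<^sub>C V) = 1" "(1 - w1 *\<^sub>C V) * R2 = 1"
    and \<alpha>: "\<alpha> * \<phi> R1 = 1" "\<alpha> * \<phi> R2 = 1"
    and w1: "w1 = z * \<alpha> * \<phi> (U * R1)" and w2: "w2 = z * \<alpha> * \<phi> (V * R2)"
    and small_UV: "norm (z *\<^sub>C (U * V)) < 1" and small_VU: "norm (z *\<^sub>C (V * U)) < 1"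
    and small_ab: "norm ((z * \<alpha>\<^sup>2) *\<^sub>C (centre (U * R1) * centre (V * R2))) < 1"
    and small_ba: "norm ((z * \<alpha>\<^sup>2) *\<^sub>C (centre (V * R2) * centre (U * R1))) < 1"
    and small_z: "cmod z * ((1 + bd) * norm U * ((1 + bd) * norm V)) < 1"
    and small_w: "cmod w1 * ((1 + bd) * norm V) < 1" "cmod w2 * ((1 + bd) * norm U) < 1"
begin

lemma swap_subordination: "subordination M \<phi> bd V U z w2 w1 \<alpha> R2 R1"
proof -
  interpret swap: free_pair M \<phi> bd V U by (rule swap_free_pair)
  show ?thesis
    by unfold_locales
      (use R1 R2 \<alpha> w1 w2 small_UV small_VU small_ab small_ba small_z small_w in \<open>simp_all add: mult_ac\<close>)
qed

abbreviation "a \<equiv> centre (U * R1)"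
abbreviation "b \<equiv> centre (V * R2)"
abbreviation "p \<equiv> \<phi> (U * R1)"
abbreviation "q \<equiv> \<phi> (V * R2)"
abbreviation "S \<equiv> neumann (z *\<^sub>C (U * V))"
abbreviation "K \<equiv> neumann ((z * \<alpha>\<^sup>2) *\<^sub>C (a * b))"

lemma R_mem [simp]: "R1 \<in> M" "R2 \<in> M"
  using R1(1) R2(1) bipolar_mem by blast+

lemma UR_bipolar: "U * R1 \<in> bipolar U" "V * R2 \<in> bipolar V" "R1 * U \<in> bipolar U"
  by (intro bipolar_closed R1 R2; simp)+

lemma ab_bipolar: "a \<in> bipolar U" "b \<in> bipolar V" "\<phi> a = 0" "\<phi> b = 0"
  using UR_bipolar by (simp_all add: U_bipolar V_bipolar)

lemma resolvent_eqs: "R1 = 1 + w2 *\<^sub>C (U * R1)" "R1 = 1 + w2 *\<^sub>C (R1 * U)" "R1 * U = U * R1"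
  "R2 = 1 + w1 *\<^sub>C (V * R2)"
proof -
  show 1: "R1 = 1 + w2 *\<^sub>C (U * R1)" "R2 = 1 + w1 *\<^sub>C (V * R2)" "R1 = 1 + w2 *\<^sub>C (R1 * U)"
    using R1(2,3) R2(3) by (simp_all add: left_diff_distrib right_diff_distrib eq_diff_eq[symmetric] diff_eq_eq)
  have "(1 - w2 *\<^sub>C U) * U = U * (1 - w2 *\<^sub>C U)" by (simp add: algebra_simps)
  then show "R1 * U = U * R1"
    using R1(2,3) by (metis mult.assoc mult_1_left mult_1_right)
qed

lemma \<alpha>_eqs: "\<alpha> + \<alpha> * w2 * p = 1" "\<alpha> + \<alpha> * w1 * q = 1" "\<alpha> + z * \<alpha>\<^sup>2 * p * q = 1" "\<alpha> \<noteq> 0"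
proof -
  have "\<phi> R1 = \<phi> (1 + w2 *\<^sub>C (U * R1))" by (rule arg_cong[OF resolvent_eqs(1)])
  then show 1: "\<alpha> + \<alpha> * w2 * p = 1" using \<alpha>(1) by (simp add: distrib_left mult.assoc)
  have "\<phi> R2 = \<phi> (1 + w1 *\<^sub>C (V * R2))" by (rule arg_cong[OF resolvent_eqs(4)])
  then show "\<alpha> + \<alpha> * w1 * q = 1" using \<alpha>(2) by (simp add: distrib_left mult.assoc)
  show "\<alpha> + z * \<alpha>\<^sup>2 * p * q = 1" using 1 unfolding w2 by (simp add: power2_eq_square mult_ac)
  show "\<alpha> \<noteq> 0" using \<alpha>(1) by auto
qed

text \<open>Substituting \<open>U * R1 = p *\<^sub>C 1 + a\<close> and
  \<open>V * R2 = q *\<^sub>C 1 + b\<close> yields a combination of \<open>1\<close>,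
  \<open>a\<close>, \<open>b\<close> and \<open>a * b\<close>. The equations for \<open>w1\<close>
  and \<open>w2\<close> are exactly what makes the coefficients of \<open>a\<close> and
  \<open>b\<close> vanish.\<close>

lemma factorization: "\<alpha> *\<^sub>C (R1 * (1 - z *\<^sub>C (U * V)) * R2) = 1 - (z * \<alpha>\<^sup>2) *\<^sub>C (a * b)"
proof -
  have UR: "U * R1 = p *\<^sub>C 1 + a" "V * R2 = q *\<^sub>C 1 + b" by (simp_all add: centre_def)
  have expand: "(1 + w2 *\<^sub>C (c *\<^sub>C 1 + A)) * (1 + w1 *\<^sub>C (d *\<^sub>C 1 + B)) - z *\<^sub>C ((c *\<^sub>C 1 + A) * (d *\<^sub>C 1 + B)) =
      (1 + w1 * d + w2 * c + w1 * w2 * c * d - z * c * d) *\<^sub>C 1 + (w2 + w1 * w2 * d - z * d) *\<^sub>C A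
      + (w1 + w1 * w2 * c - z * c) *\<^sub>C B + (w1 * w2 - z) *\<^sub>C (A * B)" for c d and A B :: "'h bop"
    by (simp add: algebra_simps)
  have "R1 * (1 - z *\<^sub>C (U * V)) * R2 = R1 * R2 - z *\<^sub>C ((R1 * U) * (V * R2))"
    by (simp add: left_diff_distrib right_diff_distrib mult.assoc)
  also have "\<dots> = (1 + w2 *\<^sub>C (U * R1)) * (1 + w1 *\<^sub>C (V * R2)) - z *\<^sub>C ((U * R1) * (V * R2))"
    unfolding resolvent_eqs(3) using resolvent_eqs(1,4) by metis
  also have "\<dots> = (1 + w1 * q + w2 * p + w1 * w2 * p * q - z * p * q) *\<^sub>C 1 + (w2 + w1 * w2 * q - z * q) *\<^sub>C a
      + (w1 + w1 * w2 * p - z * p) *\<^sub>C b + (w1 * w2 - z) *\<^sub>C (a * b)"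
    using expand[of p a q b] unfolding UR[symmetric] .
  finally have "\<alpha> *\<^sub>C (R1 * (1 - z *\<^sub>C (U * V)) * R2) =
      (\<alpha> * (1 + w1 * q + w2 * p + w1 * w2 * p * q - z * p * q)) *\<^sub>C 1 + (\<alpha> * (w2 + w1 * w2 * q - z * q)) *\<^sub>C a
      + (\<alpha> * (w1 + w1 * w2 * p - z * p)) *\<^sub>C b + (\<alpha> * (w1 * w2 - z)) *\<^sub>C (a * b)"
    by (simp only: scaleC_bop(1,3))
  moreover have "\<alpha> * (1 + w1 * q + w2 * p + w1 * w2 * p * q - z * p * q) = 1"
  proof -
    \<comment> \<open>Another factor \<alpha> turns the bracket into products of the sums that
      \<open>\<alpha>_eqs\<close> evaluates; it is cancelled at the end.\<close>
    have "\<alpha> * (\<alpha> * (1 + w1 * q + w2 * p + w1 * w2 * p * q - z * p * q)) =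
      (\<alpha> + \<alpha> * w1 * q) * (\<alpha> + \<alpha> * w2 * p) - z * \<alpha>\<^sup>2 * p * q"
      by (simp add: power2_eq_square algebra_simps)
    also have "\<dots> = \<alpha> * 1" using \<alpha>_eqs by (simp add: algebra_simps)
    finally show ?thesis using \<alpha>_eqs(4) by simp
  qed
  moreover have "\<alpha> * (w2 + w1 * w2 * q - z * q) = 0"
  proof -
    have "\<alpha> * (w2 + w1 * w2 * q - z * q) = w2 * (\<alpha> + \<alpha> * w1 * q) - z * \<alpha> * q" by (simp add: algebra_simps)
    then show ?thesis using \<alpha>_eqs(2) w2 by simp
  qed
  moreover have "\<alpha> * (w1 + w1 * w2 * p - z * p) = 0"
  proof -
    have "\<alpha> * (w1 + w1 * w2 * p - z * p) = w1 * (\<alpha> + \<alpha> * w2 * p) - z * \<alpha> * p" by (simp add: algebra_simps)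
    then show ?thesis using \<alpha>_eqs(1) w1 by simp
  qed
  moreover have "\<alpha> * (w1 * w2 - z) = - (z * \<alpha>\<^sup>2)"
  proof -
    have "\<alpha> * (w1 * w2 - z) = z * \<alpha> * (z * \<alpha>\<^sup>2 * p * q - 1)"
      unfolding w1 w2 by (simp add: power2_eq_square algebra_simps)
    also have "z * \<alpha>\<^sup>2 * p * q - 1 = - \<alpha>" using \<alpha>_eqs(3) by (simp add: algebra_simps)
    finally show ?thesis by (simp add: power2_eq_square)
  qed
  ultimately show ?thesis by simp
qed

lemma S_eq: "S = \<alpha> *\<^sub>C (R2 * (K * R1))"
proof -
  have "\<alpha> *\<^sub>C (R2 * (K * R1)) * (1 - z *\<^sub>C (U * V))
      = \<alpha> *\<^sub>C (R2 * (K * R1)) * (1 - z *\<^sub>C (U * V)) * (R2 * (1 - w1 *\<^sub>C V))"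
    by (simp add: R2(2))
  also have "\<dots> = R2 * (K * (\<alpha> *\<^sub>C (R1 * (1 - z *\<^sub>C (U * V)) * R2))) * (1 - w1 *\<^sub>C V)"
    by (simp only: scaleC_bop mult.assoc)
  also have "\<dots> = 1"
    unfolding factorization neumann_inverse(4)[OF small_ab] by (simp add: R2(2))
  finally have 1: "\<alpha> *\<^sub>C (R2 * (K * R1)) * (1 - z *\<^sub>C (U * V)) = 1" .
  have "\<alpha> *\<^sub>C (R2 * (K * R1)) = \<alpha> *\<^sub>C (R2 * (K * R1)) * ((1 - z *\<^sub>C (U * V)) * S)"
    by (simp add: neumann_inverse(3)[OF small_UV])
  also have "\<dots> = S" unfolding mult.assoc[symmetric] using 1 by (simp add: mult.assoc)
  finally show ?thesis by simp
qed

lemma K_mem [simp]: "K \<in> M"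
  using small_ab by (intro neumann_mem) auto

text \<open>In \<open>S = \<alpha> *\<^sub>C (R2 * (K * R1))\<close> the \<open>V\<close>-element
  stands on the left and the \<open>U\<close>-element on the right, as \<open>free_geometric\<close>
  requires. Multiplying by \<open>V\<close> from the left or by \<open>U\<close> from the right
  keeps this shape.\<close>

lemma moments: "\<alpha> * \<phi> S = 1" "\<phi> (V * S) = q" "\<phi> (S * U) = p"
proof -
  note geo = free_geometric[OF ab_bipolar(1,3,2,4) small_ab]
  have c1: "\<alpha> * (c * \<phi> R1) = c" and c2: "\<alpha> * (\<phi> R2 * c) = c" for c
    using arg_cong[OF \<alpha>(1), of "(*) c"] arg_cong[OF \<alpha>(2), of "(*) c"] by (simp_all add: mult_ac)
  have "\<phi> S = \<alpha> * \<phi> (R2 * (K * R1))" by (subst S_eq) simp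
  then show "\<alpha> * \<phi> S = 1" using geo[OF R2(1) R1(1)] \<alpha>(1) by (simp add: c2)
  have "V * S = \<alpha> *\<^sub>C (V * R2 * (K * R1))" by (subst S_eq) (simp add: mult.assoc)
  then have "\<phi> (V * S) = \<alpha> * \<phi> (V * R2 * (K * R1))" by simp
  then show "\<phi> (V * S) = q" using geo[OF UR_bipolar(2) R1(1)] by (simp add: c1)
  have "S * U = \<alpha> *\<^sub>C (R2 * (K * (R1 * U)))" by (subst S_eq) (simp add: mult.assoc)
  then have "\<phi> (S * U) = \<alpha> * \<phi> (R2 * (K * (R1 * U)))" by simp
  then show "\<phi> (S * U) = p"
    using geo[OF R2(1) UR_bipolar(3)] by (simp add: c2 resolvent_eqs(3))
qed

text \<open>After multiplication by \<open>\<alpha>\<^sup>2\<close> the bracket in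
  \<open>alternating_cumulant_series\<close> becomes
  \<open>1 - z * \<alpha>\<^sup>2 * p * q = \<alpha>\<close>, and the right side becomes
  \<open>w2 * \<alpha>\<close>.\<close>

lemma cumulant_series_eq:
  assumes "(\<lambda>k. boolean_cumulant \<phi> (alternating V U k) * z ^ Suc k) sums \<omega>"
  shows "\<omega> = w2"
proof -
  have eq: "\<omega> * ((\<phi> S)\<^sup>2 - z * q * p) = z * q"
    using alternating_cumulant_series[OF V_mem U_mem _ small_UV assms] small_z by (simp add: moments mult_ac)
  have "\<omega> * (1 - z * \<alpha>\<^sup>2 * p * q) = \<omega> * ((\<alpha> * \<phi> S)\<^sup>2 - z * \<alpha>\<^sup>2 * p * q)"
    by (simp add: moments(1))
  also have "\<dots> = \<alpha>\<^sup>2 * (\<omega> * ((\<phi> S)\<^sup>2 - z * q * p))"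
    by (simp add: power2_eq_square algebra_simps)
  also have "\<dots> = w2 * \<alpha>" unfolding eq w2 by (simp add: power2_eq_square)
  finally have "\<omega> * (1 - z * \<alpha>\<^sup>2 * p * q) = w2 * \<alpha>" .
  moreover have "1 - z * \<alpha>\<^sup>2 * p * q = \<alpha>" using \<alpha>_eqs(3) by (simp add: algebra_simps)
  ultimately show ?thesis using \<alpha>_eqs(4) by simp
qed

text \<open>The two sides of the final formula, paired with \<open>t\<close>. Inserting
  \<open>S_eq\<close> produces the word \<open>F * (V * R2 * (K * (R1 * G)))\<close>, to which
  \<open>free_geometric4\<close> applies.\<close>

lemma moment_identity:
  assumes F: "F \<in> bipolar U" and G: "G \<in> bipolar U" and t: "t \<in> bipolar V"
  shows "\<phi> (t * (F * (z *\<^sub>C (V * S)) * G)) =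
    \<phi> (t * ((w2 * eta2 \<phi> U F G w2) *\<^sub>C 1 + (z * eta1 \<phi> U F w2 * eta1 \<phi> U G w2) *\<^sub>C (V * R2)))"
proof -
  have M: "F \<in> M" "G \<in> M" "t \<in> M" using F G t bipolar_mem by blast+
  define x where "x = R1 * G"
  have x: "x \<in> bipolar U" unfolding x_def by (intro bipolar_closed R1 G U_mem)
  have xM: "x \<in> M" using x by (rule bipolar_mem)
  have etaF: "eta1 \<phi> U F w2 = \<alpha> * \<phi> (F * R1)"
    by (rule eta1_eq) (use M small_w R1 \<alpha> in auto)
  have "eta1 \<phi> U G w2 = \<alpha> * \<phi> (G * R1)"
    by (rule eta1_eq) (use M small_w R1 \<alpha> in auto)
  then have etaG: "eta1 \<phi> U G w2 = \<alpha> * \<phi> x"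
    using \<phi>_trace[of G R1] M by (simp add: x_def)
  have etaFG: "eta2 \<phi> U F G w2 = \<phi> (F * x) - \<alpha> * \<phi> x * \<phi> (F * R1)"
    unfolding x_def by (rule eta2_eq) (use M small_w R1 \<alpha> in auto)
  have "F * (z *\<^sub>C (V * S)) * G = (z * \<alpha>) *\<^sub>C (F * (V * R2 * (K * x)))"
    by (subst S_eq) (simp add: x_def mult.assoc)
  then have "\<phi> (t * (F * (z *\<^sub>C (V * S)) * G)) = z * \<alpha> * \<phi> (t * (F * (V * R2 * (K * x))))"
    using M xM by simp
  also have "\<dots> = z * \<alpha> * (\<phi> F * \<phi> x * \<phi> (t * (V * R2)) + q * \<phi> t * (\<phi> (F * x) - \<phi> F * \<phi> x)
      + (z * \<alpha>\<^sup>2) * q * \<phi> (F * a) * \<phi> (t * b) * \<phi> x)"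
    by (subst free_geometric4[OF ab_bipolar(1,3,2,4) small_ab t F UR_bipolar(2) x]) simp
  also have "\<phi> (t * b) = \<phi> (t * (V * R2)) - q * \<phi> t"
    using M by (simp add: centre_def right_diff_distrib)
  finally have lhs: "\<phi> (t * (F * (z *\<^sub>C (V * S)) * G)) = z * \<alpha> * (\<phi> F * \<phi> x * \<phi> (t * (V * R2))
      + q * \<phi> t * (\<phi> (F * x) - \<phi> F * \<phi> x)
      + (z * \<alpha>\<^sup>2) * q * \<phi> (F * a) * (\<phi> (t * (V * R2)) - q * \<phi> t) * \<phi> x)" .
  \<comment> \<open>The first-order term completes \<open>\<phi> F\<close> to a resolvent moment,
    because \<open>z * \<alpha>\<^sup>2 * q = \<alpha> * w2\<close> and
    \<open>\<alpha> + \<alpha> * w2 * p = 1\<close>.\<close>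
  have key: "\<phi> F + z * \<alpha>\<^sup>2 * q * \<phi> (F * a) = \<alpha> * \<phi> (F * R1)"
  proof -
    have "F * R1 = F + w2 *\<^sub>C (F * (U * R1))"
      using arg_cong[OF resolvent_eqs(1), of "(*) F"] by (simp add: distrib_left)
    then have FR: "\<phi> (F * R1) = \<phi> F + w2 * \<phi> (F * (U * R1))" using M by simp
    have Fa: "\<phi> (F * a) = \<phi> (F * (U * R1)) - p * \<phi> F"
      using M by (simp add: centre_def right_diff_distrib)
    have "z * \<alpha>\<^sup>2 * q = \<alpha> * w2" unfolding w2 by (simp add: power2_eq_square mult_ac)
    then have "\<phi> F + z * \<alpha>\<^sup>2 * q * \<phi> (F * a) = \<phi> F + \<alpha> * w2 * (\<phi> (F * (U * R1)) - p * \<phi> F)"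
      by (simp add: Fa)
    also have "\<dots> = \<alpha> * \<phi> (F * R1) + (1 - (\<alpha> + \<alpha> * w2 * p)) * \<phi> F"
      unfolding FR by (simp add: algebra_simps)
    finally show ?thesis using \<alpha>_eqs(1) by simp
  qed
  have "\<phi> (t * (F * (z *\<^sub>C (V * S)) * G)) =
      z * \<alpha> * \<phi> x * (\<phi> F + z * \<alpha>\<^sup>2 * q * \<phi> (F * a)) * \<phi> (t * (V * R2))
      + z * \<alpha> * q * \<phi> t * (\<phi> (F * x) - \<phi> x * (\<phi> F + z * \<alpha>\<^sup>2 * q * \<phi> (F * a)))"
    unfolding lhs by (simp add: algebra_simps)
  also have "\<dots> = z * (\<alpha> * \<phi> (F * R1)) * (\<alpha> * \<phi> x) * \<phi> (t * (V * R2))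
      + w2 * (\<phi> (F * x) - \<alpha> * \<phi> x * \<phi> (F * R1)) * \<phi> t"
    unfolding key using w2 by (simp add: algebra_simps)
  also have "\<dots> = \<phi> (t * ((w2 * eta2 \<phi> U F G w2) *\<^sub>C 1 + (z * eta1 \<phi> U F w2 * eta1 \<phi> U G w2) *\<^sub>C (V * R2)))"
    unfolding etaF etaG etaFG using M by (simp add: distrib_left)
  finally show ?thesis .
qed

lemma Psi_reduced_eq: "Psi_reduced U V z = z *\<^sub>C (V * S)"
proof -
  have "(\<lambda>n. z *\<^sub>C (V * (z *\<^sub>C (U * V)) ^ n)) sums (z *\<^sub>C (V * S))"
    by (intro bounded_linear.sums[OF bounded_linear_scaleC_bop] bounded_linear.sums[OF bounded_linear_mult_right]
        neumann_sums small_UV)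
  from sums_unique[OF this] show ?thesis unfolding Psi_reduced_def by (simp add: scaleC_bop_power)
qed

lemma Psi_V_eq: "V * (1 + Psi V w1) = V * R2"
proof -
  have "op_inverse (1 - w1 *\<^sub>C V) = R2" by (rule op_inverse_eqI) (use R2 in auto)
  then have "1 + Psi V w1 = R2" using resolvent_eqs(4) by (simp add: Psi_def)
  then show ?thesis by simp
qed

end

section \<open>Quantitative estimates and the final assembly\<close>

section \<open>Existence of the subordination functions near 0\<close>

context tracial_functional
begin

text \<open>The 8 gives \<open>norm (w *\<^sub>C X) \<le> 1 / 8\<close>, hence
  \<open>norm R \<le> 2\<close>, and then \<open>\<phi> R\<close> differs from 1 by at most 1/4, so
  dividing by it is safe.\<close>

lemma small_resolvent:
  assumes X: "X \<in> M" "norm X \<le> N" and N: "1 \<le> N" and w: "cmod w * (8 * bd * N) \<le> 1"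
  defines "R \<equiv> neumann (w *\<^sub>C X)"
  shows "norm (w *\<^sub>C X) \<le> 1 / 8" "R \<in> bipolar X" "R * (1 - w *\<^sub>C X) = 1" "(1 - w *\<^sub>C X) * R = 1"
    "norm R \<le> 2" "cmod (\<phi> (X * R)) \<le> 2 * (bd * N)" "1 / 2 \<le> cmod (\<phi> R)"
    "norm (centre (X * R)) \<le> 4 * (bd * N)" "\<phi> R = 1 + w * \<phi> (X * R)"
proof -
  have bdN: "N \<le> bd * N" using bd_ge_one N mult_right_mono[of 1 bd N] by simp
  have "norm (w *\<^sub>C X) \<le> cmod w * N" using X(2) by (simp add: norm_scaleC_bop mult_left_mono)
  also have "\<dots> \<le> cmod w * (bd * N)" using bdN by (intro mult_left_mono) auto
  also have "\<dots> \<le> 1 / 8" using w by simp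
  finally show 1: "norm (w *\<^sub>C X) \<le> 1 / 8" .
  show R: "R \<in> bipolar X" unfolding R_def using 1 X(1)
    by (intro neumann_bipolar bipolar_closed) auto
  show "R * (1 - w *\<^sub>C X) = 1" and inv: "(1 - w *\<^sub>C X) * R = 1"
    unfolding R_def using 1 by (simp_all add: neumann_inverse)
  show nR: "norm R \<le> 2" unfolding R_def using 1 by (intro norm_neumann) simp
  have RM: "R \<in> M" using R by (rule bipolar_mem)
  have XR: "norm (X * R) \<le> 2 * N"
    using norm_mult_ineq[of X R] mult_mono[OF X(2) nR] N by simp
  have "cmod (\<phi> (X * R)) \<le> bd * norm (X * R)" using X(1) RM by (intro \<phi>_bounded) simp
  also have "\<dots> \<le> bd * (2 * N)" using XR bd_ge_one by (intro mult_left_mono) auto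
  finally show p: "cmod (\<phi> (X * R)) \<le> 2 * (bd * N)" by simp
  have "norm (centre (X * R)) \<le> (1 + bd) * norm (X * R)" using X(1) RM by (intro norm_centre) simp
  also have "\<dots> \<le> (2 * bd) * (2 * N)" using XR bd_ge_one by (intro mult_mono) auto
  finally show "norm (centre (X * R)) \<le> 4 * (bd * N)" by simp
  have "R = 1 + w *\<^sub>C (X * R)" using inv by (simp add: left_diff_distrib diff_eq_eq)
  then have "\<phi> R = \<phi> (1 + w *\<^sub>C (X * R))" by (rule arg_cong)
  then show e: "\<phi> R = 1 + w * \<phi> (X * R)" using X(1) RM by simp
  have "cmod (w * \<phi> (X * R)) \<le> cmod w * (2 * (bd * N))"
    unfolding norm_mult using p by (intro mult_left_mono) auto
  also have "\<dots> \<le> 1 / 4" using w by simp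
  finally have "cmod (w * \<phi> (X * R)) \<le> 1 / 4" .
  then show "1 / 2 \<le> cmod (\<phi> R)"
    unfolding e using norm_triangle_ineq2[of 1 "- (w * \<phi> (X * R))"] by simp
qed

text \<open>The resolvent identity \<open>R - R' = (w - w') *\<^sub>C (R * (X * R'))\<close> gives a
  Lipschitz constant; the 4 is the product of the two bounds on the resolvents.\<close>

lemma continuous_on_resolvent:
  assumes X: "X \<in> M" "norm X \<le> N" and N: "1 \<le> N" and C: "C \<in> M"
  shows "continuous_on {w. cmod w * (8 * bd * N) \<le> 1} (\<lambda>w. \<phi> (C * neumann (w *\<^sub>C X)))"
proof (rule lipschitz_on_continuous_on)
  show "(bd * norm C * 4 * norm X)-lipschitz_on {w. cmod w * (8 * bd * N) \<le> 1} (\<lambda>w. \<phi> (C * neumann (w *\<^sub>C X)))"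
  proof (rule lipschitz_onI)
    fix w w' assume "w \<in> {w. cmod w * (8 * bd * N) \<le> 1}" "w' \<in> {w. cmod w * (8 * bd * N) \<le> 1}"
    then have w: "cmod w * (8 * bd * N) \<le> 1" and w': "cmod w' * (8 * bd * N) \<le> 1" by auto
    let ?R = "neumann (w *\<^sub>C X)" and ?R' = "neumann (w' *\<^sub>C X)"
    note s = small_resolvent[OF X N w] and s' = small_resolvent[OF X N w']
    have RM: "?R \<in> M" "?R' \<in> M" using s(2) s'(2) bipolar_mem by blast+
    have expand: "P * (A' - A) * P' = P * (A' * P') - (P * A) * P'" for P P' A A' :: "'h bop"
      by (simp add: algebra_simps)
    have "?R * ((1 - w' *\<^sub>C X) - (1 - w *\<^sub>C X)) * ?R' = ?R - ?R'"
      unfolding expand s(3) s'(4) by simp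
    then have d: "?R - ?R' = (w - w') *\<^sub>C (?R * (X * ?R'))"
      by (simp add: mult.assoc flip: scaleC_bop_diff(2))
    have n: "norm (?R - ?R') \<le> cmod (w - w') * (2 * (norm X * 2))"
      unfolding d norm_scaleC_bop
      by (intro mult_left_mono order_trans[OF norm_mult_ineq] mult_mono s(5) s'(5) order_refl) auto
    have "dist (\<phi> (C * ?R)) (\<phi> (C * ?R')) = cmod (\<phi> (C * (?R - ?R')))"
      using C RM by (simp add: dist_norm right_diff_distrib)
    also have "\<dots> \<le> bd * norm (C * (?R - ?R'))" using C RM by (intro \<phi>_bounded) simp
    also have "\<dots> \<le> bd * (norm C * (cmod (w - w') * (2 * (norm X * 2))))"
      using bd_ge_one by (intro mult_left_mono[OF order_trans[OF norm_mult_ineq mult_left_mono[OF n]]]) auto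
    finally show "dist (\<phi> (C * ?R)) (\<phi> (C * ?R')) \<le> bd * norm C * 4 * norm X * dist w w'"
      by (simp add: dist_norm mult_ac)
  qed (use bd_ge_one in simp)
qed

end

text \<open>Eliminating \<open>w2\<close> leaves one equation for \<open>w1\<close>, a fixed point
  of a continuous self-map of a disc in the complex plane.\<close>

lemma (in free_pair) subordination_exists:
  "\<exists>r>0. \<forall>z. cmod z < r \<longrightarrow> (\<exists>w1 w2 \<alpha> R1 R2. subordination M \<phi> bd U V z w1 w2 \<alpha> R1 R2)"
proof -
  define N where "N = 1 + norm U + norm V"
  define B where "B = bd * N"
  have N: "1 \<le> N" "norm U \<le> N" "norm V \<le> N" by (simp_all add: N_def)
  have B: "1 \<le> B" "N \<le> B" using bd_ge_one N(1) mult_mono[of 1 bd 1 N] mult_right_mono[of 1 bd N] by (simp_all add: B_def)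
  define S where "S = {w. cmod w * (8 * bd * N) \<le> 1}"
  define h where "h X w = \<phi> (X * neumann (w *\<^sub>C X)) / \<phi> (neumann (w *\<^sub>C X))" for X w
  have S_eq: "S = cball 0 (1 / (8 * B))"
    using B by (auto simp: S_def B_def field_simps)
  have hb: "cmod (h X w) \<le> 4 * B" if "X \<in> M" "norm X \<le> N" "w \<in> S" for X w
  proof -
    have w: "cmod w * (8 * bd * N) \<le> 1" using that(3) by (simp add: S_def)
    note s = small_resolvent[OF that(1,2) N(1) w]
    have "cmod (h X w) \<le> (2 * B) / (1 / 2)"
      unfolding h_def norm_divide using s(6,7) B by (intro frac_le) (auto simp: B_def)
    then show ?thesis by simp
  qed
  have hc: "continuous_on S (h X)" if "X \<in> M" "norm X \<le> N" for X
    unfolding h_def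
  proof (intro continuous_on_divide ballI)
    show "continuous_on S (\<lambda>w. \<phi> (X * neumann (w *\<^sub>C X)))"
      unfolding S_def by (rule continuous_on_resolvent[OF that N(1) that(1)])
    show "continuous_on S (\<lambda>w. \<phi> (neumann (w *\<^sub>C X)))"
      unfolding S_def using continuous_on_resolvent[OF that N(1) one_mem] by simp
    fix w assume "w \<in> S"
    then have w: "cmod w * (8 * bd * N) \<le> 1" by (simp add: S_def)
    show "\<phi> (neumann (w *\<^sub>C X)) \<noteq> 0" using small_resolvent(7)[OF that N(1) w] by auto
  qed
  \<comment> \<open>The strictest demand is that of \<open>small_c\<close>, which requires
    \<open>64 * cmod z * B\<^sup>2 < 1\<close>; 100 leaves some room.\<close>
  have "\<exists>w1 w2 \<alpha> R1 R2. subordination M \<phi> bd U V z w1 w2 \<alpha> R1 R2" if z: "cmod z < 1 / (100 * B\<^sup>2)" for z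
  proof -
    have zB: "cmod z * B\<^sup>2 < 1 / 100" using z B by (simp add: field_simps)
    have zh: "z * h X w \<in> S" if "X \<in> M" "norm X \<le> N" "w \<in> S" for X w
    proof -
      have "cmod (z * h X w) * (8 * B) \<le> (cmod z * (4 * B)) * (8 * B)"
        unfolding norm_mult using hb[OF that] B by (intro mult_right_mono mult_left_mono) auto
      also have "\<dots> \<le> 1" using zB by (simp add: power2_eq_square)
      finally show ?thesis by (simp add: S_def B_def mult.assoc)
    qed
    have "\<exists>w\<in>S. z * h U (z * h V w) = w"
    proof (rule brouwer)
      show "continuous_on S (\<lambda>w. z * h U (z * h V w))"
      proof (intro continuous_intros)
        show "continuous_on S (\<lambda>w. h U (z * h V w))"
          by (rule continuous_on_compose2[OF hc[OF U_mem N(2)]])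
            (use zh[OF V_mem N(3)] in \<open>auto intro!: continuous_intros hc N(3)\<close>)
      qed
      show "(\<lambda>w. z * h U (z * h V w)) \<in> S \<rightarrow> S" using zh N by auto
    qed (use B in \<open>auto simp: S_eq\<close>)
    then obtain w1 where w1S: "w1 \<in> S" and w1: "w1 = z * h U (z * h V w1)" by metis
    define w2 where "w2 = z * h V w1"
    have w2S: "w2 \<in> S" unfolding w2_def by (rule zh[OF V_mem N(3) w1S])
    define R1 R2 where "R1 = neumann (w2 *\<^sub>C U)" and "R2 = neumann (w1 *\<^sub>C V)"
    have w: "cmod w1 * (8 * bd * N) \<le> 1" "cmod w2 * (8 * bd * N) \<le> 1" using w1S w2S by (simp_all add: S_def)
    note s1 = small_resolvent[OF U_mem N(2,1) w(2), folded R1_def]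
      and s2 = small_resolvent[OF V_mem N(3,1) w(1), folded R2_def]
    \<comment> \<open>At first each resolvent has its own normalisation. The resolvent equations for
      both contain the same product of \<open>z\<close>, \<alpha>, \<beta> and the two moments,
      which forces \<alpha> and \<beta> to be equal.\<close>
    define \<alpha> \<beta> where "\<alpha> = 1 / \<phi> R1" and "\<beta> = 1 / \<phi> R2"
    have nz: "\<phi> R1 \<noteq> 0" "\<phi> R2 \<noteq> 0" using s1(7) s2(7) by auto
    have w1': "w1 = z * \<alpha> * \<phi> (U * R1)"
      using w1[folded w2_def] unfolding h_def R1_def \<alpha>_def by simp
    have w2': "w2 = z * \<beta> * \<phi> (V * R2)"
      using w2_def unfolding h_def R2_def \<beta>_def by simp
    have "\<alpha> * (1 + w2 * \<phi> (U * R1)) = 1" "\<beta> * (1 + w1 * \<phi> (V * R2)) = 1"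
      unfolding s1(9)[symmetric] s2(9)[symmetric] using nz by (simp_all add: \<alpha>_def \<beta>_def)
    then have "\<alpha> + z * \<alpha> * \<beta> * \<phi> (U * R1) * \<phi> (V * R2) = 1" "\<beta> + z * \<alpha> * \<beta> * \<phi> (U * R1) * \<phi> (V * R2) = 1"
      by (simp_all add: w1' w2' distrib_left mult_ac)
    then have \<alpha>\<beta>: "\<beta> = \<alpha>" by (metis add_right_cancel)
    have c\<alpha>: "cmod \<alpha> \<le> 2" using s1(7) nz by (simp add: \<alpha>_def norm_divide field_simps)
    have zN: "cmod z * (norm X * norm Y) < 1" if "norm X \<le> 4 * B" "norm Y \<le> 4 * B" for X Y :: "'h bop"
    proof -
      have "cmod z * (norm X * norm Y) \<le> cmod z * ((4 * B) * (4 * B))"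
        using that B by (intro mult_left_mono mult_mono) auto
      also have "\<dots> < 1" using zB by (simp add: power2_eq_square)
      finally show ?thesis .
    qed
    have small: "norm (z *\<^sub>C (X * Y)) < 1" if "norm X \<le> N" "norm Y \<le> N" for X Y :: "'h bop"
    proof -
      have "norm (z *\<^sub>C (X * Y)) \<le> cmod z * (norm X * norm Y)"
        unfolding norm_scaleC_bop by (intro mult_left_mono norm_mult_ineq) simp
      also have "\<dots> < 1" using that B by (intro zN) auto
      finally show ?thesis .
    qed
    have small_c: "norm ((z * \<alpha>\<^sup>2) *\<^sub>C (X * Y)) < 1" if "norm X \<le> 4 * B" "norm Y \<le> 4 * B" for X Y :: "'h bop"
    proof -
      have "norm ((z * \<alpha>\<^sup>2) *\<^sub>C (X * Y)) \<le> (cmod z * 2\<^sup>2) * ((4 * B) * (4 * B))"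
        unfolding norm_scaleC_bop norm_mult norm_power
        using that B c\<alpha> by (intro mult_mono power_mono order_trans[OF norm_mult_ineq]) auto
      also have "\<dots> < 1" using zB by (simp add: power2_eq_square)
      finally show ?thesis .
    qed
    have bdX: "(1 + bd) * norm X \<le> 2 * B" if "norm X \<le> N" for X :: "'h bop"
    proof -
      have "(1 + bd) * norm X \<le> (2 * bd) * N" using that bd_ge_one by (intro mult_mono) auto
      then show ?thesis by (simp add: B_def)
    qed
    have "subordination M \<phi> bd U V z w1 w2 \<alpha> R1 R2"
    proof unfold_locales
      show "\<alpha> * \<phi> R1 = 1" "\<alpha> * \<phi> R2 = 1" using nz \<alpha>\<beta> by (simp_all add: \<alpha>_def \<beta>_def)
      show "w2 = z * \<alpha> * \<phi> (V * R2)" using w2' \<alpha>\<beta> by simp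
      show "cmod z * ((1 + bd) * norm U * ((1 + bd) * norm V)) < 1"
      proof -
        have "cmod z * ((1 + bd) * norm U * ((1 + bd) * norm V)) \<le> cmod z * ((2 * B) * (2 * B))"
          using B bd_ge_one by (intro mult_left_mono mult_mono[OF bdX[OF N(2)] bdX[OF N(3)]]) auto
        also have "\<dots> < 1" using zB by (simp add: power2_eq_square)
        finally show ?thesis .
      qed
      have "cmod w * ((1 + bd) * norm X) < 1" if "cmod w * (8 * bd * N) \<le> 1" "norm X \<le> N" for w and X :: "'h bop"
      proof -
        have "cmod w * ((1 + bd) * norm X) \<le> cmod w * (2 * B)" using bdX[OF that(2)] by (intro mult_left_mono) auto
        also have "\<dots> < 1" using that(1) by (simp add: B_def)
        finally show ?thesis .
      qed
      then show "cmod w1 * ((1 + bd) * norm V) < 1" "cmod w2 * ((1 + bd) * norm U) < 1" using w N by blast+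
    qed (use s1 s2 w1' N small small_c in \<open>auto simp: B_def\<close>)
    then show ?thesis by blast
  qed
  moreover have "0 < 1 / (100 * B\<^sup>2)" using B by simp
  ultimately show ?thesis by blast
qed

lemma commutant_inverse:
  assumes "T \<in> commutant Q" "S * T = 1" "T * S = 1"
  shows "S \<in> commutant Q"
  unfolding commutant_def
proof (clarify)
  fix A assume "A \<in> Q"
  then have TA: "T * A = A * T" using assms(1) by (simp add: commutant_def)
  have "S * A = S * A * (T * S)" using assms(3) by simp
  also have "\<dots> = S * (A * T) * S" by (simp only: mult.assoc)
  also have "\<dots> = (S * T) * A * S" by (simp only: TA[symmetric] mult.assoc)
  finally show "S * A = A * S" using assms(2) by simp
qed

text \<open>Puts \<open>R2\<close>, and with it the right-hand side of the formula, into the von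
  Neumann algebra of \<open>V\<close>.\<close>

lemma vn_generated_inverse:
  assumes "T \<in> vn_generated X" "S * T = 1" "T * S = 1"
  shows "S \<in> vn_generated X"
  unfolding vn_generated_def
proof (rule InterI, clarify)
  fix N assume N: "von_neumann_algebra N" "X \<in> N"
  then have "T \<in> N" using assms(1) by (auto simp: vn_generated_def)
  then show "S \<in> N"
    using N(1) commutant_inverse[of T "commutant N" S] assms(2,3) by (simp add: von_neumann_algebra_def)
qed

section \<open>The conditional expectation\<close>

theorem proposition3p3:
  fixes M :: "'h::complex_hilbert bop set" and \<phi> :: "'h bop \<Rightarrow> complex"
    and U V :: "'h bop" and f g :: "real \<Rightarrow> complex"
    and EU EV :: "'h bop \<Rightarrow> 'h bop" and \<omega>1 \<omega>2 :: "complex \<Rightarrow> complex"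
  assumes "wstar_probability_space M \<phi>"
    and "U \<in> M" and "V \<in> M"
    and "free_elements \<phi> U V"
    and "positive_op U" and "positive_op (1 - U)"
    and "\<And>x. bop_apply (1 - U) x = 0 \<Longrightarrow> x = 0"
    and "positive_op V"
    and "fun_calc_bounded U f" and "fun_calc_bounded U g"
    and "conditional_expectation M \<phi> (vn_generated U) EU"
    and "conditional_expectation M \<phi> (vn_generated V) EV"
    and "subordination_functions \<phi> EU EV U V \<omega>1 \<omega>2"
  shows "\<forall>\<^sub>F z in nhds 0.
    EV (fun_calc U f * Psi_reduced U V z * fun_calc U g) =
      (\<omega>2 z * eta2 \<phi> U (fun_calc U f) (fun_calc U g) (\<omega>2 z)) *\<^sub>C 1
      + (z * eta1 \<phi> U (fun_calc U f) (\<omega>2 z) * eta1 \<phi> U (fun_calc U g) (\<omega>2 z)) *\<^sub>C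
          (V * (1 + Psi V (\<omega>1 z)))"
proof -
  obtain bd where tf: "tracial_functional M \<phi> bd"
    and dc: "\<And>X. X \<in> M \<Longrightarrow> adj X = X \<Longrightarrow> commutant (commutant {X}) \<subseteq> tracial_functional.bipolar M \<phi> X"
    using wstar_tracial_functional[OF assms(1)] by blast
  interpret tracial_functional M \<phi> bd by (rule tf)
  interpret free_pair M \<phi> bd U V by unfold_locales (use assms(2-4) in auto)
  have saU: "adj U = U" and saV: "adj V = V" using assms(5,8) by (auto intro: positive_op_self_adjoint)
  define F G where "F = fun_calc U f" and "G = fun_calc U g"
  have FG: "F \<in> bipolar U" "G \<in> bipolar U"
    unfolding F_def G_def
    using fun_calc_double_commutant[OF _ saU] assms(9,10) dc[OF U_mem saU] by blast+
  have FGM: "F \<in> M" "G \<in> M" using FG bipolar_mem by blast+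
  let ?N = "vn_generated V"
  have N_bip: "?N \<subseteq> bipolar V"
    using vn_generated_subset_double_commutant[OF saV] dc[OF V_mem saV] by blast
  have faithful: "a = 0" if "a \<in> M" "\<phi> (adj a * a) = 0" for a
    using assms(1) that by (simp add: wstar_probability_space_def)
  have EV: "\<And>a. a \<in> M \<Longrightarrow> EV a \<in> ?N" "\<And>a. a \<in> M \<Longrightarrow> \<phi> (EV a) = \<phi> a"
    "\<And>a b c. a \<in> M \<Longrightarrow> b \<in> ?N \<Longrightarrow> c \<in> ?N \<Longrightarrow> EV (b * a * c) = b * EV a * c"
    using assms(12) by (auto simp: conditional_expectation_def)
  have VkN: "V ^ k \<in> ?N" for k by (induction k) (auto intro: vn_generated_closed)
  obtain r where r: "0 < r" "\<And>z. cmod z < r \<Longrightarrow> \<exists>w1 w2 \<alpha> R1 R2. subordination M \<phi> bd U V z w1 w2 \<alpha> R1 R2"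
    using subordination_exists by blast
  have "\<forall>\<^sub>F z in nhds (0::complex). cmod z < r"
    using eventually_nhds_metric r(1) by (metis dist_0_norm dist_commute)
  moreover have "\<forall>\<^sub>F z in nhds 0. (\<lambda>k. boolean_cumulant \<phi> (alternating U V k) * z ^ Suc k) sums \<omega>1 z"
    "\<forall>\<^sub>F z in nhds 0. (\<lambda>k. boolean_cumulant \<phi> (alternating V U k) * z ^ Suc k) sums \<omega>2 z"
    using assms(13) by (simp_all add: subordination_functions_def)
  ultimately show ?thesis
  proof eventually_elim
    case (elim z)
    obtain w1 w2 \<alpha> R1 R2 where sub: "subordination M \<phi> bd U V z w1 w2 \<alpha> R1 R2"
      using r(2) elim(1) by blast
    interpret s: subordination M \<phi> bd U V z w1 w2 \<alpha> R1 R2 by (rule sub)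
    have \<omega>2: "\<omega>2 z = w2" by (rule s.cumulant_series_eq[OF elim(3)])
    have \<omega>1: "\<omega>1 z = w1" by (rule subordination.cumulant_series_eq[OF s.swap_subordination elim(2)])
    define P where "P = F * (z *\<^sub>C (V * neumann (z *\<^sub>C (U * V)))) * G"
    define Q where "Q = (w2 * eta2 \<phi> U F G w2) *\<^sub>C 1 + (z * eta1 \<phi> U F w2 * eta1 \<phi> U G w2) *\<^sub>C (V * R2)"
    have PM: "P \<in> M" unfolding P_def using FGM s.small_UV by (simp add: neumann_mem)
    have "1 - w1 *\<^sub>C V \<in> ?N"
      using vn_generated_closed(3)[OF vn_generated_closed(1)
          vn_generated_closed(5)[OF vn_generated_closed(2)[where X = V], where c = "- w1"]] by simp
    then have "R2 \<in> ?N" by (rule vn_generated_inverse) (use s.R2 in auto)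
    then have QN: "Q \<in> ?N" unfolding Q_def by (intro vn_generated_closed)
    have QM: "Q \<in> M" using QN N_bip bipolar_mem by blast
    \<comment> \<open>Both terms lie in the von Neumann algebra of \<open>V\<close>, so the adjoint
      of \<open>d\<close> lies in \<open>bipolar V\<close>. Orthogonality of \<open>d\<close> to the
      powers of \<open>V\<close> therefore extends to \<open>\<phi> (adj d * d) = 0\<close>, and
      faithfulness applies.\<close>
    define d where "d = EV P - Q"
    have dN: "d \<in> ?N"
      using vn_generated_closed(3)[OF EV(1)[OF PM] vn_generated_closed(5)[OF QN, where c = "-1"]] by (simp add: d_def)
    have EVM: "EV P \<in> M" using EV(1)[OF PM] N_bip bipolar_mem by blast
    have dM: "d \<in> M" unfolding d_def using EVM QM by simp
    have orth: "\<phi> (V ^ k * d) = 0" for k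
    proof -
      \<comment> \<open>The power of \<open>V\<close> enters the conditional expectation by the
        bimodule property, with \<open>1\<close> as the right factor.\<close>
      have "\<phi> (V ^ k * EV P) = \<phi> (EV (V ^ k * P * 1))"
        using EV(3)[OF PM VkN vn_generated_closed(1)] by simp
      also have "\<dots> = \<phi> (V ^ k * P)" using PM by (subst EV(2)) simp_all
      also have "\<dots> = \<phi> (V ^ k * Q)"
        unfolding P_def Q_def by (rule s.moment_identity[OF FG]) (use VkN N_bip in blast)
      finally show ?thesis using EVM QM by (simp add: d_def right_diff_distrib)
    qed
    have "adj d \<in> bipolar V" using vn_generated_closed(6)[OF dN] N_bip by blast
    from bipolarD[OF this dM orth] have "\<phi> (adj d * d) = 0" .
    then have "EV P = Q" using faithful[OF dM] by (simp add: d_def)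
    then show ?case
      unfolding \<omega>1 \<omega>2 s.Psi_V_eq s.Psi_reduced_eq P_def Q_def F_def G_def .
  qed
qed

end
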